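(* Let $\ell$ be a prime and $G$ a finite group with a normal subgroup $N$ of order prime to $\ell$ such that $G/N$ is a cyclic $\ell$-group. Let $K$ be a complete discrete valuation field of characteristic zero and residue characteristic $\ell$, and $e=e(K)$. Suppose $V$ is a $K$-vector space of even dimension $2d$, $\ell>de+1$, $V$ is a faithful simple self-dual $K[G]$-module, and $K[N]$ is quasisplit. Then either (a) $V$ is simple as a $K[N]$-module, or (b) $\ell=2de+1$, $V\cong K(\zeta_\ell)$, and either $G\cong\mu_\ell$ or $G\cong\mu_\ell\times\{\pm1\}$, acting on $V$ naturally by multiplication.
   Context: For $K$ with valuation $v$ normalized by $v(K^\times)=\mathbf{Z}$, $e(K)=v(\ell)$. A semisimple algebra is quasisplit if it is a direct sum of matrix algebras over commutative fields. A $K[G]$-module $V$ is self-dual if there is a nondegenerate $G$-invariant bilinear form $V\times V\to K$. $\zeta_\ell$ is a primitive $\ell$-th root of unity and $\mu_\ell$ the group it generates. *)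

theory Defs
  imports "HOL-Algebra.Algebra" "HOL-Algebra.Algebraic_Closure_Type"
    "HOL-Computational_Algebra.Primes"
begin

text \<open>
  A valuation is a function on the nonzero elements with values in the integers; the (arbitrary)
  value \<open>v 0\<close> is never used. The last clause is the normalization \<open>v(K\<^sup>\<times>) = \<int>\<close>.
\<close>
definition normalized_discrete_valuation :: "('k::field \<Rightarrow> int) \<Rightarrow> bool" where
  "normalized_discrete_valuation v \<longleftrightarrow>
     (\<forall>x y. x \<noteq> 0 \<longrightarrow> y \<noteq> 0 \<longrightarrow> v (x * y) = v x + v y) \<and>
     (\<forall>x y. x \<noteq> 0 \<longrightarrow> y \<noteq> 0 \<longrightarrow> x + y \<noteq> 0 \<longrightarrow> min (v x) (v y) \<le> v (x + y)) \<and>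
     v ` (UNIV - {0}) = UNIV"

definition val_ge :: "('k::field \<Rightarrow> int) \<Rightarrow> 'k \<Rightarrow> int \<Rightarrow> bool" where
  "val_ge v x M \<longleftrightarrow> x = 0 \<or> M \<le> v x"

definition val_complete :: "('k::field \<Rightarrow> int) \<Rightarrow> bool" where
  "val_complete v \<longleftrightarrow>
     (\<forall>u :: nat \<Rightarrow> 'k.
        (\<forall>M. \<exists>n0. \<forall>m\<ge>n0. \<forall>n\<ge>n0. val_ge v (u m - u n) M) \<longrightarrow>
        (\<exists>L. \<forall>M. \<exists>n0. \<forall>n\<ge>n0. val_ge v (u n - L) M))"

definition complete_discrete_valuation :: "('k::field \<Rightarrow> int) \<Rightarrow> bool" where
  "complete_discrete_valuation v \<longleftrightarrow> normalized_discrete_valuation v \<and> val_complete v"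

definition valuation_ring :: "('k::field \<Rightarrow> int) \<Rightarrow> 'k ring" where
  "valuation_ring v = ring_of_type_algebra\<lparr>carrier := {x. val_ge v x 0}\<rparr>"

definition residue_field :: "('k::field \<Rightarrow> int) \<Rightarrow> 'k set ring" where
  "residue_field v = valuation_ring v Quot {x. val_ge v x 1}"

text \<open>The counterpart, for rings with explicit carrier, of the library's \<open>CHAR\<close>.\<close>
definition ring_char :: "('a, 'm) ring_scheme \<Rightarrow> nat" where
  "ring_char R = Gcd {n::nat. add_pow R n \<one>\<^bsub>R\<^esub> = \<zero>\<^bsub>R\<^esub>}"

text \<open>
  The group algebra of a finite group over a field \<open>'k\<close>: functions vanishing outside the group,
  with the convolution product. The ring record is extended by scalar multiplication
  (record type \<open>module\<close>).
\<close>
definition group_algebra :: "('g, 'm) monoid_scheme \<Rightarrow> ('k::field, 'g \<Rightarrow> 'k) module" where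
  "group_algebra G =
     \<lparr> carrier = {f. \<forall>x. x \<notin> carrier G \<longrightarrow> f x = 0},
       monoid.mult = (\<lambda>f h x.
         \<Sum>(y, z) \<in> {(y, z) \<in> carrier G \<times> carrier G. y \<otimes>\<^bsub>G\<^esub> z = x}. f y * h z),
       one = (\<lambda>x. if x = \<one>\<^bsub>G\<^esub> then 1 else 0),
       ring.zero = (\<lambda>x. 0),
       add = (\<lambda>f h x. f x + h x),
       module.smult = (\<lambda>c f x. c * f x) \<rparr>"

text \<open>\<open>n\<close>-by-\<open>n\<close> matrices over \<open>L\<close>, as functions extensional on the index square.\<close>
definition matrix_algebra :: "nat \<Rightarrow> ('k, 'a) module \<Rightarrow> ('k, nat \<times> nat \<Rightarrow> 'a) module" where
  "matrix_algebra n L =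
     \<lparr> carrier = ({..<n} \<times> {..<n}) \<rightarrow>\<^sub>E carrier L,
       monoid.mult = (\<lambda>A B. \<lambda>(i, j) \<in> {..<n} \<times> {..<n}.
         \<Oplus>\<^bsub>L\<^esub>k\<in>{..<n}. A (i, k) \<otimes>\<^bsub>L\<^esub> B (k, j)),
       one = (\<lambda>(i, j) \<in> {..<n} \<times> {..<n}. if i = j then \<one>\<^bsub>L\<^esub> else \<zero>\<^bsub>L\<^esub>),
       ring.zero = (\<lambda>_ \<in> {..<n} \<times> {..<n}. \<zero>\<^bsub>L\<^esub>),
       add = (\<lambda>A B. \<lambda>p \<in> {..<n} \<times> {..<n}. A p \<oplus>\<^bsub>L\<^esub> B p),
       module.smult = (\<lambda>c A. \<lambda>p \<in> {..<n} \<times> {..<n}. c \<odot>\<^bsub>L\<^esub> A p) \<rparr>"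

definition direct_sum_algebra ::
  "'i set \<Rightarrow> ('i \<Rightarrow> ('k, 'a) module) \<Rightarrow> ('k, 'i \<Rightarrow> 'a) module" where
  "direct_sum_algebra I A =
     \<lparr> carrier = (\<Pi>\<^sub>E i\<in>I. carrier (A i)),
       monoid.mult = (\<lambda>x y. \<lambda>i\<in>I. x i \<otimes>\<^bsub>A i\<^esub> y i),
       one = (\<lambda>i\<in>I. \<one>\<^bsub>A i\<^esub>),
       ring.zero = (\<lambda>i\<in>I. \<zero>\<^bsub>A i\<^esub>),
       add = (\<lambda>x y. \<lambda>i\<in>I. x i \<oplus>\<^bsub>A i\<^esub> y i),
       module.smult = (\<lambda>c x. \<lambda>i\<in>I. c \<odot>\<^bsub>A i\<^esub> x i) \<rparr>"

text \<open>
  A \<open>'k\<close>-algebra is quasisplit if it is isomorphic, as a \<open>'k\<close>-algebra, to a finite direct sum of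
  matrix algebras over commutative field extensions \<open>L i\<close> of \<open>'k\<close>; such an algebra is
  automatically semisimple. Taking the carriers of the \<open>L i\<close> in the carrier type of \<open>A\<close> is no
  restriction, since \<open>L i\<close> embeds into \<open>A\<close> as the scalar matrices in the \<open>i\<close>-th summand.
\<close>
definition quasisplit :: "('k::field, 'a) module \<Rightarrow> bool" where
  "quasisplit A \<longleftrightarrow>
     (\<exists>(r::nat) (n :: nat \<Rightarrow> nat) (L :: nat \<Rightarrow> ('k, 'a) module).
        (\<forall>i<r. 0 < n i \<and> field (L i) \<and> algebra (ring_of_type_algebra :: 'k ring) (L i)) \<and>
        (\<exists>h \<in> ring_iso A (direct_sum_algebra {..<r} (\<lambda>i. matrix_algebra (n i) (L i))).
           \<forall>c. \<forall>a\<in>carrier A.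
             h (c \<odot>\<^bsub>A\<^esub> a) =
               c \<odot>\<^bsub>direct_sum_algebra {..<r} (\<lambda>i. matrix_algebra (n i) (L i))\<^esub> h a))"

text \<open>
  A module over the group algebra of \<open>G\<close> is given by a vector space, the whole type \<open>'v\<close> with
  scalar multiplication \<open>s\<close>, together with a linear action \<open>\<rho>\<close> of \<open>G\<close>. Restriction to a
  subgroup \<open>N\<close> keeps \<open>\<rho>\<close> and replaces \<open>G\<close> by \<open>G\<lparr>carrier := N\<rparr>\<close>.
\<close>
definition linear_rep ::
  "('g, 'm) monoid_scheme \<Rightarrow> ('k::field \<Rightarrow> 'v::ab_group_add \<Rightarrow> 'v) \<Rightarrow> ('g \<Rightarrow> 'v \<Rightarrow> 'v) \<Rightarrow> bool" where
  "linear_rep G s \<rho> \<longleftrightarrow>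
     vector_space s \<and> group_action G UNIV \<rho> \<and>
     (\<forall>g\<in>carrier G. Vector_Spaces.linear s s (\<rho> g))"

definition simple_rep ::
  "('g, 'm) monoid_scheme \<Rightarrow> ('k::field \<Rightarrow> 'v::ab_group_add \<Rightarrow> 'v) \<Rightarrow> ('g \<Rightarrow> 'v \<Rightarrow> 'v) \<Rightarrow> bool" where
  "simple_rep G s \<rho> \<longleftrightarrow>
     linear_rep G s \<rho> \<and> (UNIV :: 'v set) \<noteq> {0} \<and>
     (\<forall>W. module.subspace s W \<longrightarrow> (\<forall>g\<in>carrier G. \<rho> g ` W \<subseteq> W) \<longrightarrow> W = {0} \<or> W = UNIV)"

text \<open>The action of \<open>G\<close> is faithful, not the action of the group algebra.\<close>
definition faithful_rep ::
  "('g, 'm) monoid_scheme \<Rightarrow> ('k::field \<Rightarrow> 'v::ab_group_add \<Rightarrow> 'v) \<Rightarrow> ('g \<Rightarrow> 'v \<Rightarrow> 'v) \<Rightarrow> bool" where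
  "faithful_rep G s \<rho> \<longleftrightarrow> linear_rep G s \<rho> \<and> faithful_action G UNIV \<rho>"

definition bilinear_form ::
  "('k::field \<Rightarrow> 'v::ab_group_add \<Rightarrow> 'v) \<Rightarrow> ('v \<Rightarrow> 'v \<Rightarrow> 'k) \<Rightarrow> bool" where
  "bilinear_form s b \<longleftrightarrow>
     (\<forall>x. Vector_Spaces.linear s (*) (\<lambda>y. b x y)) \<and>
     (\<forall>y. Vector_Spaces.linear s (*) (\<lambda>x. b x y))"

definition nondegenerate_form :: "('v::zero \<Rightarrow> 'v \<Rightarrow> 'k::zero) \<Rightarrow> bool" where
  "nondegenerate_form b \<longleftrightarrow>
     (\<forall>x. (\<forall>y. b x y = 0) \<longrightarrow> x = 0) \<and> (\<forall>y. (\<forall>x. b x y = 0) \<longrightarrow> y = 0)"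

definition self_dual_rep ::
  "('g, 'm) monoid_scheme \<Rightarrow> ('k::field \<Rightarrow> 'v::ab_group_add \<Rightarrow> 'v) \<Rightarrow> ('g \<Rightarrow> 'v \<Rightarrow> 'v) \<Rightarrow> bool" where
  "self_dual_rep G s \<rho> \<longleftrightarrow>
     linear_rep G s \<rho> \<and>
     (\<exists>b :: 'v \<Rightarrow> 'v \<Rightarrow> 'k. bilinear_form s b \<and> nondegenerate_form b \<and>
        (\<forall>g\<in>carrier G. \<forall>x y. b (\<rho> g x) (\<rho> g y) = b x y))"

definition primitive_root_of_unity :: "nat \<Rightarrow> 'a::field \<Rightarrow> bool" where
  "primitive_root_of_unity l z \<longleftrightarrow> z ^ l = 1 \<and> (\<forall>j. 0 < j \<longrightarrow> j < l \<longrightarrow> z ^ j \<noteq> 1)"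

text \<open>\<open>K(z)\<close>, as a subfield of the algebraic closure of \<open>K\<close>.\<close>
definition adjoin :: "'k::field alg_closure \<Rightarrow> 'k alg_closure set" where
  "adjoin z = generate_field ring_of_type_algebra (insert z (range to_ac))"

definition cyclic_units :: "'a::field \<Rightarrow> 'a monoid" where
  "cyclic_units z = subgroup_generated (units_of (ring_of_type_algebra :: 'a ring)) {z}"

text \<open>
  \<open>V\<close> is isomorphic over \<open>K\<close> to the subspace \<open>F\<close> of the algebraic closure, in such a way that
  each \<open>g\<close> acts as multiplication by \<open>\<chi> g\<close>.
\<close>
definition iso_mult_rep ::
  "('g, 'm) monoid_scheme \<Rightarrow> ('k::field \<Rightarrow> 'v::ab_group_add \<Rightarrow> 'v) \<Rightarrow> ('g \<Rightarrow> 'v \<Rightarrow> 'v) \<Rightarrow>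
   'k alg_closure set \<Rightarrow> ('g \<Rightarrow> 'k alg_closure) \<Rightarrow> bool" where
  "iso_mult_rep G s \<rho> F \<chi> \<longleftrightarrow>
     (\<exists>\<phi>. Vector_Spaces.linear s (\<lambda>c y. to_ac c * y) \<phi> \<and> bij_betw \<phi> UNIV F \<and>
        (\<forall>g\<in>carrier G. \<forall>x. \<phi> (\<rho> g x) = \<chi> g * \<phi> x))"

end

theory Submission
  imports Defs "Jordan_Normal_Form.Determinant" "HOL-Number_Theory.Totient" "HOL-Number_Theory.Cong"
begin

text \<open>
  Let \<open>g\<close> have \<open>l\<close>-power order and generate \<open>G\<close> modulo \<open>N\<close>. If \<open>\<zeta>\<close> acts on a \<open>K\<close>-space of dimension
  \<open>t\<close> as a primitive \<open>l\<close>-th root of unity, then \<open>(1 - \<zeta>) ^ (l - 1)\<close> is \<open>l\<close> times a unit and comparing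
  valuations of determinants gives \<open>l - 1 dvd t * e\<close>; so an operator of \<open>l\<close>-power order on a space of
  dimension at most \<open>d\<close> is trivial.

  Suppose that \<open>V\<close> is not simple over \<open>N\<close>. A simple \<open>N\<close>-submodule \<open>W\<close> has dimension at most \<open>d\<close> and,
  as \<open>l\<close> does not divide \<open>2 * d\<close>, is isomorphic to its conjugate under \<open>g\<close>. An intertwiner \<open>x\<close>
  commutes with the commutative field \<open>C = End\<^sub>N W\<close> (conjugation by \<open>x\<close> has \<open>l\<close>-power order on \<open>C\<close>,
  and \<open>dim C \<le> d\<close>), its \<open>l ^ k\<close>-th power lies in \<open>C\<close>, and because \<open>dim W < l\<close> it can be divided by an
  element of \<open>C\<close> so as to get \<open>l\<close>-power order. Hence \<open>x\<close> is a scalar and \<open>g\<close> centralizes \<open>N\<close>.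

  Now \<open>g\<close> is central. An eigenfunctional of \<open>g\<close> with values in the algebraic closure identifies \<open>V\<close>
  with \<open>K(\<zeta>)\<close> and \<open>G\<close> with a group of multiplications. The divisibility above yields
  \<open>l - 1 = 2 * d * e\<close> and excludes roots of unity of order \<open>l\<^sup>2\<close>. If some \<open>\<eta>\<close> in the image of \<open>N\<close> had
  \<open>\<eta>\<^sup>2 \<noteq> 1\<close>, then \<open>(\<zeta> - 1 / \<zeta>) / (\<eta> - 1 / \<eta>)\<close> would be self-adjoint for the invariant form, with
  \<open>(l - 1)\<close>-th power \<open>l\<close> times a unit, although self-adjoint elements span a space of dimension at
  most \<open>d\<close>.
\<close>

section \<open>Determinants and valuations\<close>

text \<open>The valuation stays on \<open>K\<close> throughout and is never extended to
  \<open>K(\<zeta>)\<close>. Units of extensions are units of a ring of sums of roots of unity with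
  integral coefficients, and norms are determinants of multiplications on \<open>K\<close>-subspaces
  of the closure. Likewise \<open>V\<close> is never tensored with the closure: eigenvectors are
  replaced by eigenfunctionals with values in the closure. The image of such a functional is a
  finite-dimensional \<open>K\<close>-subspace stable under the eigenvalue, which is exactly what
  the determinant argument consumes.

  The bound \<open>l > d * e + 1\<close> says that \<open>t * e\<close> can be a positive multiple
  of \<open>l - 1\<close> only if \<open>t > d\<close>, so half of \<open>dim V\<close> is the
  threshold. \<open>W\<close> stays below it because \<open>W\<close> and \<open>g W\<close> are
  simple: they meet in 0, or coincide and make \<open>W\<close> invariant under \<open>G\<close>.
  \<open>End\<^sub>N W\<close> stays below it because evaluation at a generator embeds it into
  \<open>W\<close>.

  Quasisplitness enters through one idempotent \<open>e i\<close> per block whose corner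
  \<open>e i K[N] e i\<close> is a commutative field. That corner is \<open>End\<^sub>N W\<close>;
  its commutativity gives a common eigenfunctional, which turns endomorphisms and the intertwiner
  into numbers in the closure.\<close>

global_interpretation Kb: vector_space "\<lambda>(c::'k::field) (y::'k alg_closure). to_ac c * y"
  by unfold_locales (simp_all add: algebra_simps)

lemma to_ac_eq_0_iff': "to_ac (x::'k::field) = 0 \<longleftrightarrow> x = 0"
proof
  assume h: "to_ac x = 0"
  show "x = 0"
  proof (rule ccontr)
    assume "x \<noteq> 0"
    then have "to_ac (x * inverse x) = 1" by simp
    with h show False by simp
  qed
qed simp

lemma of_nat_ac_eq_0_iff: "(of_nat n :: 'k::field_char_0 alg_closure) = 0 \<longleftrightarrow> n = 0"
  using to_ac_eq_0_iff'[of "of_nat n :: 'k"] by simp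

lemma independent_dual_functional:
  fixes B :: "'k::field alg_closure set"
  assumes "Kb.independent B"
  obtains c where "Vector_Spaces.linear (\<lambda>c y. to_ac c * y) (*) c" "\<And>x. x \<in> B \<Longrightarrow> c x = f x"
proof -
  interpret vector_space_pair "\<lambda>(c::'k) (y::'k alg_closure). to_ac c * y" "(*) :: 'k \<Rightarrow> 'k \<Rightarrow> 'k"
    by unfold_locales (simp_all add: algebra_simps)
  from linear_independent_extend[OF assms, of f] that show thesis by blast
qed

text \<open>This is the ring \<open>O[\<mu>_m]\<close> inside the closure, with \<open>O\<close> the
  valuation ring. It is described by sums alone, so that linear functionals on it can be bounded by
  induction; it is closed under products because the \<open>m\<close>-th roots of unity are.\<close>

inductive_set cyc_ring :: "('k::field \<Rightarrow> int) \<Rightarrow> nat \<Rightarrow> 'k alg_closure set"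
  for v :: "'k \<Rightarrow> int" and m :: nat where
  gen: "w ^ m = 1 \<Longrightarrow> val_ge v a 0 \<Longrightarrow> to_ac a * w \<in> cyc_ring v m"
| add: "x \<in> cyc_ring v m \<Longrightarrow> y \<in> cyc_ring v m \<Longrightarrow> x + y \<in> cyc_ring v m"

text \<open>Stands in for "element of valuation zero" in the closure, where there is no
  valuation.\<close>

definition cyc_unit :: "('k::field \<Rightarrow> int) \<Rightarrow> nat \<Rightarrow> 'k alg_closure \<Rightarrow> bool" where
  "cyc_unit v m u \<longleftrightarrow> u \<noteq> 0 \<and> u \<in> cyc_ring v m \<and> inverse u \<in> cyc_ring v m"

locale field_valuation =
  fixes v :: "'k::field_char_0 \<Rightarrow> int"
  assumes v_mult: "x \<noteq> 0 \<Longrightarrow> y \<noteq> 0 \<Longrightarrow> v (x * y) = v x + v y"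
    and v_add: "x \<noteq> 0 \<Longrightarrow> y \<noteq> 0 \<Longrightarrow> x + y \<noteq> 0 \<Longrightarrow> min (v x) (v y) \<le> v (x + y)"
begin

lemma v_1: "v 1 = 0"
  using v_mult[of 1 1] by simp

lemma v_minus: "v (- x) = v x"
proof (cases "x = 0")
  case False
  have "v (-1) + v (-1) = 0" using v_mult[of "-1" "-1"] v_1 by simp
  with v_mult[of "-1" x] False show ?thesis by simp
qed simp

lemma v_power: "x \<noteq> 0 \<Longrightarrow> v (x ^ n) = int n * v x"
  by (induction n) (simp_all add: v_1 v_mult algebra_simps)

lemma val_ge_0 [simp]: "val_ge v 0 M"
  by (simp add: val_ge_def)

lemma val_ge_add: "val_ge v x M \<Longrightarrow> val_ge v y M \<Longrightarrow> val_ge v (x + y) M"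
  unfolding val_ge_def using v_add[of x y] by (cases "x = 0"; cases "y = 0") fastforce+

lemma val_ge_mult: "val_ge v x M \<Longrightarrow> val_ge v y M' \<Longrightarrow> val_ge v (x * y) (M + M')"
  unfolding val_ge_def using v_mult[of x y] by (cases "x = 0"; cases "y = 0") auto

lemma val_ge_minus: "val_ge v x M \<Longrightarrow> val_ge v (- x) M"
  unfolding val_ge_def by (simp add: v_minus)

lemma val_ge_sum: "(\<And>i. i \<in> S \<Longrightarrow> val_ge v (f i) M) \<Longrightarrow> val_ge v (sum f S) M"
  by (induction S rule: infinite_finite_induct) (auto intro: val_ge_add)

lemma val_ge_prod:
  assumes "finite S" "\<And>i. i \<in> S \<Longrightarrow> val_ge v (f i) M"
  shows "val_ge v (prod f S) (int (card S) * M)"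
  using assms
proof (induction S rule: finite_induct)
  case empty
  then show ?case by (simp add: val_ge_def v_1)
next
  case (insert i S)
  then have "val_ge v (f i * prod f S) (M + int (card S) * M)" by (intro val_ge_mult) auto
  then show ?case using insert by (simp add: algebra_simps)
qed

lemma val_ge_of_nat: "val_ge v (of_nat n) 0"
  by (induction n) (auto intro!: val_ge_add simp: val_ge_def[of v 1] v_1)

lemma val_ge_1: "val_ge v 1 0"
  using val_ge_of_nat[of 1] by simp

lemma cyc_ring_root: "w ^ m = 1 \<Longrightarrow> w \<in> cyc_ring v m"
  using cyc_ring.gen[of w m v 1] val_ge_1 by simp

lemma cyc_ring_1: "1 \<in> cyc_ring v m"
  by (rule cyc_ring_root) simp

lemma cyc_ring_scalar: "val_ge v a 0 \<Longrightarrow> to_ac a \<in> cyc_ring v m"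
  using cyc_ring.gen[of 1 m v a] by simp

lemma cyc_ring_0: "0 \<in> cyc_ring v m"
  using cyc_ring_scalar[of 0] by simp

lemma cyc_ring_of_nat: "of_nat n \<in> cyc_ring v m"
  using cyc_ring_scalar[OF val_ge_of_nat] by simp

lemma cyc_ring_mult:
  assumes "x \<in> cyc_ring v m" "y \<in> cyc_ring v m"
  shows "x * y \<in> cyc_ring v m"
  using assms(1)
proof induction
  case (gen w a)
  from assms(2) show ?case
  proof induction
    case (gen w' a')
    from cyc_ring.gen[of "w * w'" m v "a * a'"] gen \<open>w ^ m = 1\<close> \<open>val_ge v a 0\<close> val_ge_mult[of a 0 a' 0]
    show ?case by (simp add: power_mult_distrib ac_simps)
  qed (auto simp: algebra_simps intro: cyc_ring.add)
qed (auto simp: algebra_simps intro: cyc_ring.add)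

lemma cyc_ring_minus: "x \<in> cyc_ring v m \<Longrightarrow> - x \<in> cyc_ring v m"
  using cyc_ring_mult[OF cyc_ring_scalar[OF val_ge_minus[OF val_ge_1]]] by simp

lemma cyc_ring_diff: "x \<in> cyc_ring v m \<Longrightarrow> y \<in> cyc_ring v m \<Longrightarrow> x - y \<in> cyc_ring v m"
  using cyc_ring.add[OF _ cyc_ring_minus] by fastforce

lemma cyc_ring_sum: "(\<And>i. i \<in> S \<Longrightarrow> f i \<in> cyc_ring v m) \<Longrightarrow> sum f S \<in> cyc_ring v m"
  by (induction S rule: infinite_finite_induct) (auto intro: cyc_ring.add cyc_ring_0)

lemma cyc_ring_power: "x \<in> cyc_ring v m \<Longrightarrow> x ^ n \<in> cyc_ring v m"
  by (induction n) (auto intro: cyc_ring_mult cyc_ring_1)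

lemma cyc_unit_mult: "cyc_unit v m x \<Longrightarrow> cyc_unit v m y \<Longrightarrow> cyc_unit v m (x * y)"
  unfolding cyc_unit_def by (auto intro: cyc_ring_mult)

lemma cyc_unit_inverse: "cyc_unit v m x \<Longrightarrow> cyc_unit v m (inverse x)"
  unfolding cyc_unit_def by auto

lemma cyc_unit_power: "cyc_unit v m x \<Longrightarrow> cyc_unit v m (x ^ n)"
  unfolding cyc_unit_def by (auto intro: cyc_ring_power simp: power_inverse[symmetric])

lemma cyc_unit_1: "cyc_unit v m 1"
  by (simp add: cyc_unit_def cyc_ring_1)

lemma cyc_unit_prod: "(\<And>i. i \<in> S \<Longrightarrow> cyc_unit v m (f i)) \<Longrightarrow> cyc_unit v m (prod f S)"
  by (induction S rule: infinite_finite_induct) (auto intro: cyc_unit_mult cyc_unit_1)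

lemma cyc_unit_root: 
  assumes "w ^ m = 1" "m > 0" shows "cyc_unit v m w"
proof -
  have "w \<noteq> 0" using assms by (auto simp: power_0_left)
  moreover have "inverse w ^ m = 1" using assms by (simp add: power_inverse)
  ultimately show ?thesis using assms by (auto simp: cyc_unit_def intro: cyc_ring_root)
qed

lemma cyc_unit_minus: "cyc_unit v m x \<Longrightarrow> cyc_unit v m (- x)"
  unfolding cyc_unit_def by (auto intro: cyc_ring_minus)

text \<open>There are finitely many \<open>m\<close>-th roots of unity \<open>w\<close>, and
  integral coefficients cannot lower a valuation, so the least \<open>v (c (w * b))\<close> bounds
  every sum.\<close>

lemma cyc_ring_bounded:
  assumes c: "Vector_Spaces.linear (\<lambda>c y. to_ac c * y) (*) c" and "m > 0"
  shows "\<exists>C. \<forall>x\<in>cyc_ring v m. val_ge v (c (x * b)) C"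
proof -
  interpret c: Vector_Spaces.linear "\<lambda>c y. to_ac c * y" "(*)" c by fact
  define M where "M = {w :: 'k alg_closure. w ^ m = 1}"
  \<comment> \<open>If some \<open>c (w * b)\<close> is 0, the arbitrary value \<open>v 0\<close>
    enters the minimum; it can only lower the bound.\<close>
  define C where "C = Min ((\<lambda>w. v (c (w * b))) ` M)"
  have fin: "finite M"
  proof -
    have "M \<subseteq> {w. poly (monom 1 m - 1) w = 0}" by (auto simp: M_def poly_monom)
    moreover have "monom 1 m - 1 \<noteq> (0 :: 'k alg_closure poly)"
    proof
      assume "monom 1 m - 1 = (0 :: 'k alg_closure poly)"
      then have "degree (monom (1::'k alg_closure) m) = degree (1 :: 'k alg_closure poly)" by simp
      with \<open>m > 0\<close> show False by (simp add: degree_monom_eq)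
    qed
    ultimately show ?thesis using poly_roots_finite finite_subset by blast
  qed
  have "val_ge v (c (x * b)) C" if "x \<in> cyc_ring v m" for x
    using that
  proof induction
    case (gen w a)
    then have "w \<in> M" by (simp add: M_def)
    with fin have "C \<le> v (c (w * b))" by (simp add: C_def)
    then have "val_ge v (c (w * b)) C" by (simp add: val_ge_def)
    from val_ge_mult[OF gen(2) this] show ?case
      using c.scale[of a "w * b"] by (simp add: mult.assoc)
  next
    case (add x y)
    then show ?case by (simp add: algebra_simps c.add val_ge_add)
  qed
  then show ?thesis by blast
qed

end

text \<open>Residue characteristic \<open>l\<close>, expressed through integers alone:
  \<open>l\<close> lies in the maximal ideal and integers prime to \<open>l\<close> are
  units.\<close>

locale residual_valuation = field_valuation v
  for v :: "'k::field_char_0 \<Rightarrow> int" +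
  fixes l :: nat
  assumes prime_l: "Factorial_Ring.prime l"
    and v_l: "1 \<le> v (of_nat l)"
    and v_coprime: "coprime n l \<Longrightarrow> v (of_nat n) = 0"
begin

lemma l_pos: "0 < l"
  using prime_l prime_gt_0_nat by blast

text \<open>
  The determinant of multiplication by \<open>\<alpha>\<close> on \<open>span B\<close> plays the role of a norm; for a unit \<open>u\<close>
  its valuation vanishes, because the matrix entries of all powers of \<open>u\<close> are uniformly bounded.
\<close>
theorem dvd_card_valuation:
  fixes B :: "'k alg_closure set"
  assumes B: "finite B" "Kb.independent B"
    and stable: "\<And>x. x \<in> Kb.span B \<Longrightarrow> \<alpha> * x \<in> Kb.span B"
    and \<alpha>: "\<alpha> ^ k = of_nat l * u" and u: "cyc_unit v m u" and m: "m > 0"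
  shows "int k dvd int (card B) * v (of_nat l)"
proof -
  define t where "t = card B"
  obtain b where b: "bij_betw b {..<t} B"
    using ex_bij_betw_nat_finite[OF B(1)] by (auto simp: t_def atLeast0LessThan)
  have "\<exists>c. \<forall>i. Vector_Spaces.linear (\<lambda>c y. to_ac c * y) (*) (c i) \<and>
      (\<forall>x\<in>B. c i x = (if x = b i then 1 else 0))"
  proof (rule choice, rule allI)
    fix i
    obtain c' where "Vector_Spaces.linear (\<lambda>c y. to_ac c * y) (*) c'"
      "\<And>x. x \<in> B \<Longrightarrow> c' x = (if x = b i then 1 else 0)"
      using independent_dual_functional[OF B(2), of "\<lambda>x. if x = b i then 1 else 0"] by blast
    then show "\<exists>c'. Vector_Spaces.linear (\<lambda>c y. to_ac c * y) (*) c' \<and>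
      (\<forall>x\<in>B. c' x = (if x = b i then 1 else 0))" by blast
  qed
  then obtain c where c: "\<And>i. Vector_Spaces.linear (\<lambda>c y. to_ac c * y) (*) (c i)"
    and cB: "\<And>i x. x \<in> B \<Longrightarrow> c i x = (if x = b i then 1 else 0)" by blast
  have cb: "c i (b j) = (if i = j then 1 else 0)" if "i < t" "j < t" for i j
    using that cB[of "b j" i] b by (auto simp: bij_betw_def inj_on_def)
  have c_add: "c i (x + y) = c i x + c i y" for i x y
    using Vector_Spaces.linear.axioms(3)[OF c[of i]] by (simp add: module_hom_def module_hom_axioms_def)
  have c_scale: "c i (to_ac a * x) = a * c i x" for i a x
    using Vector_Spaces.linear.axioms(3)[OF c[of i]] by (simp add: module_hom_def module_hom_axioms_def)
  have c_0: "c i 0 = 0" for i using c_scale[of i 0 0] by simp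
  have c_sum: "c i (sum f S) = (\<Sum>x\<in>S. c i (f x))" for i S and f :: "nat \<Rightarrow> _"
    by (induction S rule: infinite_finite_induct) (simp_all add: c_0 c_add)
  have expand: "y = (\<Sum>i<t. to_ac (c i y) * b i)" if "y \<in> Kb.span B" for y
    using that
  proof (induction rule: Kb.span_induct_alt)
    case base
    then show ?case by (simp add: c_0)
  next
    case (step a x y)
    obtain j where j: "j < t" "x = b j" using b step(1) by (auto simp: bij_betw_def)
    have "(\<Sum>i<t. to_ac (c i (to_ac a * x + y)) * b i) =
        (\<Sum>i<t. to_ac (a * c i x) * b i) + (\<Sum>i<t. to_ac (c i y) * b i)"
      by (simp add: c_add c_scale distrib_right sum.distrib)
    also have "(\<Sum>i<t. to_ac (a * c i x) * b i) = (\<Sum>i<t. if i = j then to_ac a * b i else 0)"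
      using j by (intro sum.cong) (auto simp: cb)
    also have "\<dots> = to_ac a * x" using j by simp
    finally show ?case using step by simp
  qed
  have bB: "b j \<in> Kb.span B" if "j < t" for j
    using b that by (intro Kb.span_base) (auto simp: bij_betw_def)
  \<comment> \<open>The coordinate functionals \<open>c i\<close> are defined on the whole closure,
    so \<open>A x\<close> makes sense even if \<open>x\<close> does not stabilise the span.
    Multiplicativity asks only the right factor to stabilise it, which allows
    \<open>A (inverse u ^ n) * A (u ^ n)\<close> to be evaluated at once.\<close>
  define A where "A x = mat t t (\<lambda>(i, j). c i (x * b j))" for x
  have A_carrier [simp]: "A x \<in> carrier_mat t t" for x by (simp add: A_def)
  have A_mult: "A (x * y) = A x * A y" if "\<And>z. z \<in> Kb.span B \<Longrightarrow> y * z \<in> Kb.span B" for x y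
  proof (rule eq_matI)
    fix i j assume ij: "i < dim_row (A x * A y)" "j < dim_col (A x * A y)"
    then have ij: "i < t" "j < t" by (auto simp: A_def)
    have "c i (x * y * b j) = c i (x * (\<Sum>k<t. to_ac (c k (y * b j)) * b k))"
      using expand[OF that[OF bB[OF ij(2)]]] by (simp add: mult.assoc)
    also have "\<dots> = (\<Sum>k<t. c i (to_ac (c k (y * b j)) * (x * b k)))"
      by (simp only: sum_distrib_left c_sum mult.left_commute)
    also have "\<dots> = (\<Sum>k<t. c i (x * b k) * c k (y * b j))"
      unfolding c_scale by (simp add: mult.commute)
    finally show "A (x * y) $$ (i, j) = (A x * A y) $$ (i, j)"
      using ij by (simp add: A_def scalar_prod_def atLeast0LessThan)
  qed (simp_all add: A_def)
  have A_1: "A 1 = 1\<^sub>m t" by (rule eq_matI) (auto simp: A_def cb)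
  have A_power: "det (A (y ^ n)) = det (A y) ^ n" if y: "\<And>z. z \<in> Kb.span B \<Longrightarrow> y * z \<in> Kb.span B" for y n
  proof (induction n)
    case (Suc n)
    have "A (y ^ Suc n) = A (y ^ n) * A y"
      using A_mult[OF y, of "y ^ n"] by (simp add: mult.commute)
    then show ?case using Suc by (simp add: det_mult[of _ t])
  qed (simp add: A_1)
  have pow: "\<alpha> ^ n * z \<in> Kb.span B" if "z \<in> Kb.span B" for n z
    using that by (induction n) (auto simp: mult.assoc stable)
  have l0: "(of_nat l :: 'k) \<noteq> 0" using l_pos by simp
  have u_eq: "u = to_ac (1 / of_nat l) * \<alpha> ^ k"
    using \<alpha> l0 l_pos by (simp add: of_nat_ac_eq_0_iff)
  have u_stable: "u * z \<in> Kb.span B" if "z \<in> Kb.span B" for z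
    using Kb.span_scale[OF pow[OF that]] by (simp add: u_eq mult.assoc del: to_ac_divide)
  have u_stable': "u ^ n * z \<in> Kb.span B" if "z \<in> Kb.span B" for n z
    using that by (induction n) (auto simp: mult.assoc u_stable)
  have u0: "u \<noteq> 0" using u by (simp add: cyc_unit_def)
  define D where "D = det (A u)"
  have inv: "det (A (inverse u ^ n)) * D ^ n = 1" for n
  proof -
    have "1\<^sub>m t = A (inverse u ^ n * u ^ n)" using u0 by (simp add: A_1 power_inverse)
    also have "\<dots> = A (inverse u ^ n) * A (u ^ n)" by (rule A_mult[OF u_stable'])
    finally have "1\<^sub>m t = \<dots>" .
    from arg_cong[OF this, of det] show ?thesis
      by (simp add: det_mult[of _ t] A_power[OF u_stable] D_def)
  qed
  have D0: "D \<noteq> 0" using inv[of 1] by auto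
  have "\<exists>C. \<forall>i j. i < t \<longrightarrow> j < t \<longrightarrow> (\<forall>x\<in>cyc_ring v m. val_ge v (c i (x * b j)) C)"
  proof -
    have "\<exists>C. \<forall>p. \<forall>x\<in>cyc_ring v m. val_ge v (c (fst p) (x * b (snd p))) (C p)"
      by (rule choice) (use cyc_ring_bounded[OF c m] in blast)
    then obtain C where C: "\<And>i j x. x \<in> cyc_ring v m \<Longrightarrow> val_ge v (c i (x * b j)) (C (i, j))" by auto
    define C' where "C' = Min (C ` ({..<t} \<times> {..<t}))"
    have "val_ge v (c i (x * b j)) C'" if "i < t" "j < t" "x \<in> cyc_ring v m" for i j x
    proof -
      have "C' \<le> C (i, j)" using that by (auto simp: C'_def intro!: Min_le)
      with C[OF that(3), of i j] show ?thesis by (auto simp: val_ge_def)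
    qed
    then show ?thesis by blast
  qed
  then obtain C where C: "\<And>i j x. i < t \<Longrightarrow> j < t \<Longrightarrow> x \<in> cyc_ring v m \<Longrightarrow> val_ge v (c i (x * b j)) C"
    by blast
  have bound: "val_ge v (det (A x)) (int t * C)" if x: "x \<in> cyc_ring v m" for x
  proof -
    have "det (A x) = (\<Sum>p\<in>{p. p permutes {0..<t}}. signof p * (\<Prod>i = 0..<t. A x $$ (i, p i)))"
      by (rule det_def') simp
    moreover have "val_ge v (signof p * (\<Prod>i = 0..<t. A x $$ (i, p i))) (int t * C)"
      if p: "p permutes {0..<t}" for p
    proof -
      have "val_ge v (\<Prod>i = 0..<t. A x $$ (i, p i)) (int (card {0..<t}) * C)"
        using p permutes_in_image[OF p] by (intro val_ge_prod) (auto simp: A_def intro!: C x)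
      then show ?thesis by (auto simp: sign_def intro: val_ge_minus)
    qed
    ultimately show ?thesis by (auto intro!: val_ge_sum)
  qed
  have nD: "int t * C \<le> int n * v D" for n
  proof -
    have "u ^ n \<in> cyc_ring v m" using u by (auto simp: cyc_unit_def intro: cyc_ring_power)
    from bound[OF this] D0 show ?thesis
      by (simp add: A_power[OF u_stable] D_def[symmetric] val_ge_def v_power)
  qed
  have nD': "int t * C \<le> - (int n * v D)" for n
  proof -
    have "inverse u ^ n \<in> cyc_ring v m" using u by (auto simp: cyc_unit_def intro: cyc_ring_power)
    from bound[OF this] have b: "val_ge v (det (A (inverse u ^ n))) (int t * C)" .
    have nz: "det (A (inverse u ^ n)) \<noteq> 0" using inv[of n] by auto
    have "v (det (A (inverse u ^ n))) + int n * v D = 0"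
      using v_mult[OF nz, of "D ^ n"] D0 inv[of n] by (simp add: v_power v_1)
    with b nz show ?thesis by (simp add: val_ge_def)
  qed
  have vD: "v D = 0"
  proof (rule ccontr)
    assume "v D \<noteq> 0"
    then have "\<bar>v D\<bar> \<ge> 1" by simp
    define n where "n = nat (\<bar>int t * C\<bar> + 1)"
    have "int n * \<bar>v D\<bar> \<ge> int n * 1" using \<open>\<bar>v D\<bar> \<ge> 1\<close> by (intro mult_left_mono) auto
    moreover have "int n * \<bar>v D\<bar> \<le> - (int t * C)"
      using nD[of n] nD'[of n] by (cases "v D \<ge> 0") auto
    ultimately have "int n \<le> - (int t * C)" by linarith
    then show False by (simp add: n_def)
  qed
  \<comment> \<open>The determinant of \<open>\<alpha> ^ k = l * u\<close> gives
    \<open>det (A \<alpha>) ^ k = l ^ t * D\<close>. Since \<open>v D = 0\<close>, valuations read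
    \<open>k * v (det (A \<alpha>)) = t * v l\<close>.\<close>
  have "det (A \<alpha>) ^ k = det (A (\<alpha> ^ k))" by (rule A_power[OF stable, symmetric])
  also have "A (\<alpha> ^ k) = of_nat l \<cdot>\<^sub>m A u"
    unfolding \<alpha> by (rule eq_matI) (auto simp: A_def mult.assoc c_scale simp flip: to_ac_of_nat)
  also have "det \<dots> = of_nat l ^ t * D" by (simp add: D_def A_def)
  finally have *: "det (A \<alpha>) ^ k = of_nat l ^ t * D" .
  show ?thesis
  proof (cases "k = 0")
    case True
    then have "v (of_nat l ^ t * D) = 0" using * v_1 by simp
    then have "int t * v (of_nat l) = 0" using D0 l0 vD by (simp add: v_mult v_power)
    then show ?thesis by (auto simp: t_def)
  next
    case False
    then have "det (A \<alpha>) \<noteq> 0" using * D0 l0 by (auto simp: power_0_left)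
    then have "int k * v (det (A \<alpha>)) = int t * v (of_nat l)"
      using arg_cong[OF *, of v] D0 l0 vD by (simp add: v_mult v_power)
    then show ?thesis by (metis dvd_triv_left t_def)
  qed
qed

end

section \<open>Roots of unity\<close>

lemma primitive_power_eq_1_iff:
  assumes "primitive_root_of_unity n z" "n > 0"
  shows "z ^ i = 1 \<longleftrightarrow> n dvd i"
proof -
  have zn: "z ^ n = 1" using assms by (simp add: primitive_root_of_unity_def)
  have "z ^ i = z ^ (n * (i div n) + i mod n)" by simp
  also have "\<dots> = z ^ (i mod n)" by (simp only: power_add power_mult zn) simp
  finally have *: "z ^ i = z ^ (i mod n)" .
  have "z ^ (i mod n) = 1 \<longleftrightarrow> i mod n = 0"
    using assms by (auto simp: primitive_root_of_unity_def)
  with * show ?thesis by (simp add: dvd_eq_mod_eq_0)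
qed

lemma primitive_nonzero: "primitive_root_of_unity n z \<Longrightarrow> n > 0 \<Longrightarrow> z \<noteq> 0"
  by (auto simp: primitive_root_of_unity_def power_0_left)

lemma primitive_inj_on:
  assumes "primitive_root_of_unity n z" "n > 0"
  shows "inj_on (\<lambda>i. z ^ i) {i. 0 < i \<and> i \<le> n}"
proof -
  have *: "i = j" if "z ^ i = z ^ j" "0 < i" "i \<le> j" "j \<le> n" for i j
  proof -
    have "z ^ j = z ^ i * z ^ (j - i)" using le_add_diff_inverse[OF that(3)] by (metis power_add)
    then have "z ^ (j - i) = 1"
      using that(1) primitive_nonzero[OF assms] by simp
    then have "n dvd j - i" using primitive_power_eq_1_iff[OF assms] by simp
    then show ?thesis using that by (metis diff_less dual_order.strict_trans1 le_less_trans less_imp_diff_less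
        nat_dvd_not_less order_le_less zero_less_diff diff_is_0_eq le_antisym nat_less_le)
  qed
  show ?thesis
    by (rule inj_onI) (metis (mono_tags, lifting) * linear mem_Collect_eq)
qed

lemma primitive_coprime_power:
  assumes z: "primitive_root_of_unity n z" "n > 0" and i: "coprime i n"
  shows "primitive_root_of_unity n (z ^ i)"
  unfolding primitive_root_of_unity_def
proof (intro conjI allI impI)
  show "(z ^ i) ^ n = 1"
    using primitive_power_eq_1_iff[OF z, of "i * n"] by (simp add: power_mult)
next
  fix j assume j: "0 < j" "j < n"
  have "\<not> n dvd i * j"
    using i j by (metis coprime_commute coprime_dvd_mult_right_iff nat_dvd_not_less)
  then show "(z ^ i) ^ j \<noteq> 1"
    using primitive_power_eq_1_iff[OF z, of "i * j"] by (simp add: power_mult)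
qed

lemma primitive_root_of_power:
  assumes "primitive_root_of_unity (a * b) z" "a > 0" "b > 0"
  shows "primitive_root_of_unity b (z ^ a)"
  unfolding primitive_root_of_unity_def
proof (intro conjI allI impI)
  show "(z ^ a) ^ b = 1" using assms by (simp add: primitive_root_of_unity_def power_mult)
next
  fix j assume "0 < j" "j < b"
  then show "(z ^ a) ^ j \<noteq> 1"
    using assms by (simp add: primitive_root_of_unity_def flip: power_mult)
qed

lemma primitive_prime_powerI:
  assumes "Factorial_Ring.prime l" "z ^ (l ^ k) = 1" "z \<noteq> 1"
  obtains j where "j \<ge> 1" "j \<le> k" "primitive_root_of_unity (l ^ j) z"
proof -
  define n where "n = (LEAST n. 0 < n \<and> z ^ n = 1)"
  have l0: "l > 0" using assms(1) prime_gt_0_nat by blast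
  have n: "0 < n" "z ^ n = 1"
    using LeastI[of "\<lambda>n. 0 < n \<and> z ^ n = 1" "l ^ k"] assms l0 by (auto simp: n_def)
  have prim: "primitive_root_of_unity n z"
    using n not_less_Least[of _ "\<lambda>n. 0 < n \<and> z ^ n = 1"]
    by (auto simp: primitive_root_of_unity_def n_def)
  then have "n dvd l ^ k" using primitive_power_eq_1_iff[OF prim n(1)] assms by blast
  then obtain j where j: "j \<le> k" "n = l ^ j" using assms(1) divides_primepow_nat by blast
  moreover have "j \<noteq> 0" using n j assms(3) by (cases j) auto
  ultimately show thesis using that[of j] prim by auto
qed

text \<open>The polynomial \<open>p\<close> of the proof is the cyclotomic polynomial of
  \<open>l ^ Suc j\<close>, the sum of the monomials \<open>X^(a * l^j)\<close> for
  \<open>a < l\<close>, and its value at 1 is visibly \<open>l\<close>. It is the product of the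
  linear factors at the primitive powers of \<open>z\<close>, since both are monic of the same
  degree and vanish at all these points.\<close>

lemma prime_power_cyclotomic_at_one:
  fixes z :: "'a::field"
  assumes l: "Factorial_Ring.prime l" and z: "primitive_root_of_unity (l ^ Suc j) z" and l0: "(of_nat l :: 'a) \<noteq> 0"
  shows "(\<Prod>i\<in>totatives (l ^ Suc j). 1 - z ^ i) = of_nat l"
proof -
  have lp: "l > 1" using l prime_gt_1_nat by blast
  define p :: "'a poly" where "p = (\<Sum>a<l. Polynomial.monom 1 (a * l ^ j))"
  define I where "I = totatives (l ^ Suc j)"
  define n where "n = (l - 1) * l ^ j"
  have cI: "card I = n"
    using totient_prime_power[OF l, of "Suc j"] by (simp add: I_def n_def totient_def mult.commute)
  have finI: "finite I" by (simp add: I_def)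
  define p' where "p' = (\<Prod>i\<in>I. [:- (z ^ i), 1:])"
  have N: "l ^ Suc j > 0" using lp by simp
  have inj: "inj_on (\<lambda>i. z ^ i) I"
    using primitive_inj_on[OF z N] by (rule inj_on_subset) (auto simp: I_def totatives_def)
  have "p = p'"
  proof (rule poly_eqI_degree_lead_coeff[where n = n and A = "(\<lambda>i. z ^ i) ` I"])
    have deg: "Polynomial.degree p' = n"
      unfolding p'_def by (subst degree_prod_eq_sum_degree) (auto simp: cI)
    have "lead_coeff p' = 1" unfolding p'_def by (simp add: lead_coeff_prod)
    then have "poly.coeff p' n = 1" by (simp add: deg)
    moreover have "poly.coeff p n = 1"
    proof -
      have "poly.coeff p n = (\<Sum>a<l. if a = l - 1 then 1 else 0)"
        unfolding p_def coeff_sum using lp by (intro sum.cong) (auto simp: n_def)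
      then show ?thesis using lp by simp
    qed
    ultimately show "poly.coeff p n = poly.coeff p' n" by simp
    show "n \<le> card ((\<lambda>i. z ^ i) ` I)" using card_image[OF inj] cI by simp
    show "Polynomial.degree p \<le> n" unfolding p_def n_def
      by (rule degree_sum_le) (auto intro!: order.trans[OF degree_monom_le] mult_right_mono)
    show "Polynomial.degree p' \<le> n" by (simp add: deg)
    fix w assume "w \<in> (\<lambda>i. z ^ i) ` I"
    then obtain i where i: "i \<in> I" "w = z ^ i" by blast
    define w' where "w' = w ^ (l ^ j)"
    have "poly p w = (\<Sum>a<l. w' ^ a)"
      by (simp add: p_def poly_sum poly_monom w'_def mult.commute flip: power_mult)
    moreover have "w' \<noteq> 1"
    proof
      assume "w' = 1"
      then have "z ^ (i * l ^ j) = 1" by (simp add: w'_def i power_mult)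
      then have "l ^ Suc j dvd i * l ^ j" using primitive_power_eq_1_iff[OF z N] by blast
      then have "l dvd i" using lp by simp
      with i have "coprime i l" by (auto simp: I_def totatives_def)
      with \<open>l dvd i\<close> lp show False by (metis coprime_common_divisor_nat dvd_refl less_numeral_extra(4) nat_dvd_1_iff_1)
    qed
    moreover have "w' ^ l = 1"
    proof -
      have "w' ^ l = (z ^ (l ^ Suc j)) ^ i"
        by (simp add: w'_def i mult.commute mult.left_commute flip: power_mult)
      then show ?thesis using z by (simp add: primitive_root_of_unity_def)
    qed
    ultimately have "poly p w = 0" by (simp add: geometric_sum[of w' l])
    moreover have "poly p' w = 0" using i finI by (auto simp: p'_def poly_prod)
    ultimately show "poly p w = poly p' w" by simp
  qed
  moreover have "poly p 1 = of_nat l" by (simp add: p_def poly_sum poly_monom)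
  moreover have "poly p' 1 = (\<Prod>i\<in>I. 1 - z ^ i)" by (simp add: p'_def poly_prod)
  ultimately show ?thesis by (simp add: I_def)
qed

context residual_valuation
begin

text \<open>These are the cyclotomic units. A quotient \<open>(1 - w ^ a) / (1 - w)\<close> is a
  geometric sum, hence integral. With \<open>i'\<close> inverse to \<open>i\<close> modulo
  \<open>n\<close>, both the ratio and its inverse have this shape, because
  \<open>z = (z ^ i) ^ i'\<close>.\<close>

lemma cyc_unit_root_ratio:
  fixes z :: "'k alg_closure"
  assumes z: "primitive_root_of_unity n z" "n > 1" and m: "n dvd m" "m > 0" and i: "coprime i n"
  shows "cyc_unit v m ((1 - z) / (1 - z ^ i))"
proof -
  have *: "(1 - w ^ a) / (1 - w) \<in> cyc_ring v m" if w: "w ^ m = 1" for w :: "'k alg_closure" and a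
  proof (cases "w = 1")
    case False
    then have "(1 - w ^ a) / (1 - w) = (\<Sum>b<a. w ^ b)" by (simp add: sum_gp_strict)
    moreover have "(\<Sum>b<a. w ^ b) \<in> cyc_ring v m"
      by (intro cyc_ring_sum cyc_ring_power cyc_ring_root w)
    ultimately show ?thesis by simp
  qed (simp add: cyc_ring_0)
  have zm: "z ^ m = 1" using primitive_power_eq_1_iff[OF z(1)] z(2) m by simp
  have zim: "(z ^ i) ^ m = 1" using zm by (metis power_mult mult.commute power_one)
  obtain i' where i': "[i * i' = 1] (mod n)"
    using cong_solve_coprime_nat[OF i] by auto
  have "z ^ (i * i') = z ^ (n * (i * i' div n) + i * i' mod n)" by simp
  also have "\<dots> = z ^ (i * i' mod n)"
    using z by (simp only: power_add power_mult primitive_root_of_unity_def) simp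
  also have "i * i' mod n = 1" using i' z(2) by (simp add: cong_def)
  finally have zi': "(z ^ i) ^ i' = z" by (simp add: power_mult)
  have ne: "z \<noteq> 1" "z ^ i \<noteq> 1"
    using primitive_power_eq_1_iff[OF z(1), of 1] primitive_power_eq_1_iff[OF z(1), of i] z(2) i
    by (auto simp: coprime_absorb_right)
  have "inverse ((1 - z) / (1 - z ^ i)) = (1 - z ^ i) / (1 - z)" by simp
  moreover have "(1 - z) / (1 - z ^ i) = (1 - (z ^ i) ^ i') / (1 - z ^ i)" by (simp add: zi')
  ultimately show ?thesis
    using *[OF zm, of i] *[OF zim, of i'] ne by (simp add: cyc_unit_def)
qed

text \<open>Each of the \<open>(l - 1) * l ^ j\<close> factors of the product with value
  \<open>l\<close> differs from \<open>1 - z\<close> by a cyclotomic unit. The order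
  \<open>m\<close> is left free so that \<open>z\<close> can share one ring with roots of unity of
  other orders.\<close>

lemma one_minus_primitive_power:
  fixes z :: "'k alg_closure"
  assumes z: "primitive_root_of_unity (l ^ Suc j) z" and m: "l ^ Suc j dvd m" "m > 0"
  obtains u where "cyc_unit v m u" "(1 - z) ^ ((l - 1) * l ^ j) = of_nat l * u"
proof
  let ?I = "totatives (l ^ Suc j)"
  let ?u = "\<Prod>i\<in>?I. (1 - z) / (1 - z ^ i)"
  have l1: "l ^ Suc j > 1" using prime_gt_1_nat[OF prime_l] by (intro one_less_power) auto
  show "cyc_unit v m ?u"
    by (intro cyc_unit_prod cyc_unit_root_ratio[OF z l1 m]) (auto simp: totatives_def)
  have "(1 - z) ^ card ?I = (\<Prod>i\<in>?I. 1 - z ^ i) * ?u"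
  proof -
    have "(1 - z) = (1 - z ^ i) * ((1 - z) / (1 - z ^ i))" if "i \<in> ?I" for i
    proof -
      have "coprime i (l ^ Suc j)" using that by (simp add: totatives_def)
      then have "\<not> l ^ Suc j dvd i"
        using l1 by (metis coprime_absorb_right nat_dvd_1_iff_1 less_irrefl)
      then have "z ^ i \<noteq> 1" using primitive_power_eq_1_iff[OF z, of i] l_pos by simp
      then show ?thesis by simp
    qed
    then have "(\<Prod>i\<in>?I. 1 - z) = (\<Prod>i\<in>?I. (1 - z ^ i) * ((1 - z) / (1 - z ^ i)))"
      by (intro prod.cong) auto
    also have "\<dots> = (\<Prod>i\<in>?I. 1 - z ^ i) * ?u" by (rule prod.distrib)
    finally show ?thesis by simp
  qed
  moreover have "card ?I = (l - 1) * l ^ j"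
    using totient_prime_power[OF prime_l, of "Suc j"] by (simp add: totient_def mult.commute)
  ultimately show "(1 - z) ^ ((l - 1) * l ^ j) = of_nat l * ?u"
    using prime_power_cyclotomic_at_one[OF prime_l z] l_pos by (simp add: of_nat_ac_eq_0_iff)
qed

text \<open>Takes the place of ramification theory, where \<open>(l - 1) * l ^ j\<close> would be
  the ramification index of \<open>1 - z\<close> over the \<open>l\<close>-adic numbers and hence
  divide \<open>[K(z):K] * e\<close>. Every space stable under \<open>z\<close> is covered, so the
  degree of \<open>z\<close> need not be known beforehand.\<close>

lemma primitive_stable_dvd:
  fixes z :: "'k alg_closure"
  assumes B: "finite B" "Kb.independent B" and z: "primitive_root_of_unity (l ^ Suc j) z"
    and stable: "\<And>x. x \<in> Kb.span B \<Longrightarrow> z * x \<in> Kb.span B"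
  shows "int ((l - 1) * l ^ j) dvd int (card B) * v (of_nat l)"
proof -
  obtain u where u: "cyc_unit v (l ^ Suc j) u" "(1 - z) ^ ((l - 1) * l ^ j) = of_nat l * u"
    using one_minus_primitive_power[OF z, of "l ^ Suc j"] l_pos by auto
  have "(1 - z) * x \<in> Kb.span B" if "x \<in> Kb.span B" for x
    using Kb.span_diff[OF that stable[OF that]] by (simp add: algebra_simps)
  from dvd_card_valuation[OF B this u(2) u(1)] l_pos show ?thesis by simp
qed

text \<open>The inverse of \<open>1 - w\<close> comes from \<open>(1 - w) * (\<Sum>i<n. i * w ^ i) = - n\<close>.\<close>
lemma cyc_unit_one_minus_coprime_root:
  fixes w :: "'k alg_closure"
  assumes w: "w ^ n = 1" "w \<noteq> 1" and n: "coprime n l" "n > 0" and m: "n dvd m" "m > 0"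
  shows "cyc_unit v m (1 - w)"
proof -
  have wm: "w ^ m = 1" using w(1) m by (auto elim!: dvdE simp: power_mult)
  have n0: "(of_nat n :: 'k) \<noteq> 0" using n by simp
  have gen: "(1 - w) * (\<Sum>i<a. of_nat i * w ^ i) = (\<Sum>i<a. w ^ i) - 1 - (of_nat a - 1) * w ^ a" if "a > 0" for a
    using that
  proof (induction a)
    case (Suc a)
    show ?case
    proof (cases "a = 0")
      case False
      then show ?thesis using Suc by (simp add: algebra_simps)
    qed simp
  qed simp
  have "(\<Sum>i<n. w ^ i) = 0" using w by (simp add: geometric_sum)
  then have "(1 - w) * (\<Sum>i<n. of_nat i * w ^ i) = - of_nat n"
    using gen[OF n(2)] w by simp
  moreover have ne: "(of_nat n :: 'k alg_closure) \<noteq> 0" using n by (simp add: of_nat_ac_eq_0_iff)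
  ultimately have "(1 - w) * (- (\<Sum>i<n. of_nat i * w ^ i) / of_nat n) = 1"
    by (simp add: field_simps)
  then have inv: "inverse (1 - w) = to_ac (1 / of_nat n) * - (\<Sum>i<n. of_nat i * w ^ i)"
    by (subst inverse_unique) (auto simp: field_simps)
  have "v (1 / of_nat n) = 0"
  proof -
    have "v (of_nat n * (1 / of_nat n)) = v (of_nat n) + v (1 / of_nat n)"
      by (rule v_mult) (use n0 in auto)
    then show ?thesis using n0 v_coprime[OF n(1)] v_1 by simp
  qed
  then have "to_ac (1 / of_nat n) \<in> cyc_ring v m"
    by (intro cyc_ring_scalar) (simp add: val_ge_def)
  then have "inverse (1 - w) \<in> cyc_ring v m" unfolding inv
    by (rule cyc_ring_mult) (intro cyc_ring_mult cyc_ring_minus cyc_ring_sum cyc_ring_of_nat cyc_ring_power cyc_ring_root wm)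
  moreover have "1 - w \<in> cyc_ring v m"
    by (intro cyc_ring_diff cyc_ring_1 cyc_ring_root wm)
  ultimately show ?thesis using w by (simp add: cyc_unit_def)
qed

end

section \<open>Eigenfunctionals\<close>

text \<open>This is \<open>\<phi>\<close> composed with \<open>p(T)\<close>. Since \<open>p\<close>
  has coefficients in the closure, \<open>p(T)\<close> does not act on a \<open>K\<close>-space, but
  it does act on functionals with values in the closure.\<close>

definition apply_poly :: "'a::comm_ring_1 poly \<Rightarrow> ('v \<Rightarrow> 'v) \<Rightarrow> ('v \<Rightarrow> 'a) \<Rightarrow> 'v \<Rightarrow> 'a" where
  "apply_poly p T \<phi> u = (\<Sum>i\<le>Polynomial.degree p. poly.coeff p i * \<phi> ((T ^^ i) u))"

lemma apply_poly_altdef: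
  assumes "Polynomial.degree p \<le> n"
  shows "apply_poly p T \<phi> u = (\<Sum>i\<le>n. poly.coeff p i * \<phi> ((T ^^ i) u))"
  unfolding apply_poly_def
  by (rule sum.mono_neutral_left) (use assms in \<open>auto simp: coeff_eq_0\<close>)

lemma apply_poly_0 [simp]: "apply_poly 0 T \<phi> u = 0"
  by (simp add: apply_poly_def)

lemma apply_poly_add: "apply_poly (p + q) T \<phi> u = apply_poly p T \<phi> u + apply_poly q T \<phi> u"
proof -
  let ?n = "max (Polynomial.degree p) (Polynomial.degree q)"
  show ?thesis
    using apply_poly_altdef[of p ?n T \<phi> u] apply_poly_altdef[of q ?n T \<phi> u]
      apply_poly_altdef[of "p + q" ?n T \<phi> u]
    by (simp add: degree_add_le_max sum.distrib algebra_simps)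
qed

lemma apply_poly_smult: "apply_poly (Polynomial.smult a p) T \<phi> u = a * apply_poly p T \<phi> u"
  using apply_poly_altdef[OF degree_smult_le[of a p], of T \<phi> u]
  by (simp add: apply_poly_def sum_distrib_left mult.assoc)

lemma apply_poly_pCons: "apply_poly (pCons a p) T \<phi> u = a * \<phi> u + apply_poly p T \<phi> (T u)"
proof -
  have "apply_poly (pCons a p) T \<phi> u =
      (\<Sum>i\<le>Suc (Polynomial.degree p). poly.coeff (pCons a p) i * \<phi> ((T ^^ i) u))"
    by (rule apply_poly_altdef) (rule degree_pCons_le)
  then show ?thesis
    by (simp add: apply_poly_def sum.atMost_Suc_shift funpow_swap1 del: sum.atMost_Suc)
qed

lemma apply_poly_mult: "apply_poly (p * q) T \<phi> u = apply_poly p T (apply_poly q T \<phi>) u"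
  by (induction p arbitrary: u) (simp_all add: apply_poly_pCons apply_poly_add apply_poly_smult)

lemma funpow_range: "(\<And>x. x \<in> U \<Longrightarrow> T x \<in> U) \<Longrightarrow> u \<in> U \<Longrightarrow> (T ^^ i) u \<in> U"
  by (induction i) auto

section \<open>Operators and closure-valued functionals on subspaces\<close>

locale fd_space = finite_dimensional_vector_space scale Basis
  for scale :: "'a::field \<Rightarrow> 'b::ab_group_add \<Rightarrow> 'b" (infixr \<open>*s\<close> 75) and Basis :: "'b set"
begin

text \<open>Operators are total functions whose values outside \<open>U\<close> are immaterial; this
  suits operators on \<open>U\<close> that are built by choice or by inverting a map on
  \<open>U\<close>.\<close>

definition lin_on :: "'b set \<Rightarrow> ('b \<Rightarrow> 'b) \<Rightarrow> bool" where
  "lin_on U T \<longleftrightarrow> (\<forall>x\<in>U. T x \<in> U) \<and> (\<forall>x\<in>U. \<forall>y\<in>U. T (x + y) = T x + T y) \<and>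
     (\<forall>a. \<forall>x\<in>U. T (a *s x) = a *s T x)"

definition functional_on :: "'b set \<Rightarrow> ('b \<Rightarrow> 'a alg_closure) \<Rightarrow> bool" where
  "functional_on U \<phi> \<longleftrightarrow> (\<forall>x\<in>U. \<forall>y\<in>U. \<phi> (x + y) = \<phi> x + \<phi> y) \<and>
     (\<forall>a. \<forall>x\<in>U. \<phi> (a *s x) = to_ac a * \<phi> x)"

lemma lin_on_funpow: "lin_on U T \<Longrightarrow> lin_on U (T ^^ i)"
  by (induction i) (auto simp: lin_on_def)

lemma lin_on_comp: "lin_on U S \<Longrightarrow> lin_on U T \<Longrightarrow> lin_on U (\<lambda>x. S (T x))"
  by (auto simp: lin_on_def)

lemma lin_on_0: "subspace U \<Longrightarrow> lin_on U T \<Longrightarrow> T 0 = 0"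
  using subspace_0[of U] unfolding lin_on_def by (metis scale_zero_left)

lemma lin_on_diff: "subspace U \<Longrightarrow> lin_on U T \<Longrightarrow> x \<in> U \<Longrightarrow> y \<in> U \<Longrightarrow> T (x - y) = T x - T y"
  using subspace_scale[of U y "-1"] unfolding lin_on_def
  by (metis scale_minus_left scale_one uminus_add_conv_diff add.commute)

lemma functional_on_0: "subspace U \<Longrightarrow> functional_on U \<phi> \<Longrightarrow> \<phi> 0 = 0"
  using subspace_0[of U] unfolding functional_on_def by (metis scale_zero_left to_ac_0 mult_zero_left)

lemma functional_on_diff:
  "subspace U \<Longrightarrow> functional_on U \<phi> \<Longrightarrow> x \<in> U \<Longrightarrow> y \<in> U \<Longrightarrow> \<phi> (x - y) = \<phi> x - \<phi> y"
  by (metis add_diff_cancel diff_add_cancel functional_on_def subspace_diff)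

lemma functional_on_sum:
  assumes "subspace U" "functional_on U \<phi>" "\<And>i. i \<in> S \<Longrightarrow> f i \<in> U"
  shows "\<phi> (sum f S) = (\<Sum>i\<in>S. \<phi> (f i))"
  using assms(3)
proof (induction S rule: infinite_finite_induct)
  case (insert i S)
  then show ?case using assms subspace_sum[of U S f] by (auto simp: functional_on_def)
qed (use functional_on_0[OF assms(1,2)] in auto)

lemma functional_on_apply_poly:
  assumes "subspace U" "lin_on U T" "functional_on U \<phi>"
  shows "functional_on U (apply_poly p T \<phi>)"
proof -
  have "lin_on U (T ^^ i)" for i by (rule lin_on_funpow) fact
  then show ?thesis using assms(3)
    by (auto simp: functional_on_def lin_on_def apply_poly_def sum.distrib sum_distrib_left algebra_simps)
qed

lemma functional_on_span_eq_0:
  assumes "functional_on (span B) \<phi>" "\<And>b. b \<in> B \<Longrightarrow> \<phi> b = 0" "u \<in> span B"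
  shows "\<phi> u = 0"
proof -
  from assms(3) have "u \<in> span B \<and> \<phi> u = 0"
  proof (induction rule: span_induct_alt)
    case base
    show ?case using functional_on_0[OF subspace_span assms(1)] span_zero by simp
  next
    case (step a x y)
    then show ?case using assms(1,2) span_base[of x B] span_scale[of x B a] span_add
      by (auto simp: functional_on_def)
  qed
  then show ?thesis by blast
qed

text \<open>The \<open>dim U + 1\<close> iterates of \<open>u\<close> cannot be independent. A
  repeated iterate is treated apart, because the set of iterates would then be too small for the
  dimension count; it yields a relation with coefficients 1 and -1.\<close>

lemma power_relation:
  assumes U: "subspace U" and T: "\<And>x. x \<in> U \<Longrightarrow> T x \<in> U" and u: "u \<in> U"
  obtains a where "\<exists>i\<le>dim U. a i \<noteq> 0" "(\<Sum>i\<le>dim U. a i *s (T ^^ i) u) = 0"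
proof (cases "inj_on (\<lambda>i. (T ^^ i) u) {..dim U}")
  case True
  let ?B = "(\<lambda>i. (T ^^ i) u) ` {..dim U}"
  have sub: "?B \<subseteq> U" using funpow_range[of U T u] T u by blast
  have "card ?B = Suc (dim U)" using card_image[OF True] by simp
  then have "dependent ?B" using independent_card_le_dim[OF sub] by auto
  then obtain w where w: "(\<Sum>x\<in>?B. w x *s x) = 0" "\<exists>x\<in>?B. w x \<noteq> 0"
    unfolding dependent_finite[OF finite_imageI[OF finite_atMost]] by blast
  show thesis
  proof (rule that[of "\<lambda>i. w ((T ^^ i) u)"])
    show "\<exists>i\<le>dim U. w ((T ^^ i) u) \<noteq> 0" using w(2) by auto
    show "(\<Sum>i\<le>dim U. w ((T ^^ i) u) *s (T ^^ i) u) = 0"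
      using w(1) by (subst (asm) sum.reindex[OF True]) simp
  qed
next
  case False
  then obtain i j where ij: "i \<le> dim U" "j \<le> dim U" "i \<noteq> j" "(T ^^ i) u = (T ^^ j) u"
    by (auto simp: inj_on_def)
  let ?a = "\<lambda>k. (if k = i then (1::'a) else 0) - (if k = j then 1 else 0)"
  have "(\<Sum>k\<le>dim U. ?a k *s (T ^^ k) u) =
      (\<Sum>k\<le>dim U. if k = i then (T ^^ k) u else 0) - (\<Sum>k\<le>dim U. if k = j then (T ^^ k) u else 0)"
    unfolding sum_subtractf[symmetric] by (intro sum.cong) (auto simp: scale_left_diff_distrib)
  also have "\<dots> = 0" using ij by simp
  finally have "(\<Sum>k\<le>dim U. ?a k *s (T ^^ k) u) = 0" .
  moreover have "\<exists>k\<le>dim U. ?a k \<noteq> 0" using ij by (intro exI[of _ i]) simp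
  ultimately show thesis by (rule that[rotated])
qed

text \<open>Multiplies the cyclic relations at the vectors of \<open>B\<close>. The functional is
  quantified inside the existential because the induction applies the earlier factors to functionals
  that are already modified by the new one, and conversely.\<close>

lemma annihilating_poly:
  assumes U: "subspace U" and T: "lin_on U T" and "finite B" "B \<subseteq> U"
  shows "\<exists>p\<noteq>0. \<forall>\<phi>. functional_on U \<phi> \<longrightarrow> (\<forall>b\<in>B. apply_poly p T \<phi> b = 0)"
  using assms(3,4)
proof (induction B rule: finite_induct)
  case empty
  show ?case by (rule exI[of _ 1]) simp
next
  case (insert b B)
  then obtain p where p: "p \<noteq> 0" "\<And>\<phi> b. functional_on U \<phi> \<Longrightarrow> b \<in> B \<Longrightarrow> apply_poly p T \<phi> b = 0" by auto
  have TU: "T x \<in> U" if "x \<in> U" for x using T that by (auto simp: lin_on_def)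
  obtain a where a: "\<exists>i\<le>dim U. a i \<noteq> 0" "(\<Sum>i\<le>dim U. a i *s (T ^^ i) b) = 0"
    using power_relation[of U T b, OF U TU] insert.prems by auto
  define q where "q = (\<Sum>i\<le>dim U. Polynomial.monom (to_ac (a i)) i)"
  have cq: "poly.coeff q i = (if i \<le> dim U then to_ac (a i) else 0)" for i
    unfolding q_def coeff_sum by (simp add: if_distrib cong: if_cong)
  have "q \<noteq> 0"
  proof
    assume "q = 0"
    with a(1) cq show False by (metis coeff_0 to_ac_eq_0_iff')
  qed
  have dq: "Polynomial.degree q \<le> dim U" by (rule degree_le) (simp add: cq)
  have q: "apply_poly q T \<phi> b = 0" if \<phi>: "functional_on U \<phi>" for \<phi>
  proof -
    have bi: "(T ^^ i) b \<in> U" for i using funpow_range[of U T b] TU insert.prems by auto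
    have "apply_poly q T \<phi> b = (\<Sum>i\<le>dim U. \<phi> (a i *s (T ^^ i) b))"
      unfolding apply_poly_altdef[OF dq] using \<phi> bi by (simp add: cq functional_on_def)
    also have "\<dots> = \<phi> (\<Sum>i\<le>dim U. a i *s (T ^^ i) b)"
      using functional_on_sum[OF U \<phi>, of "{..dim U}"] bi U by (simp add: subspace_scale)
    also have "\<dots> = 0" using a(2) functional_on_0[OF U \<phi>] by simp
    finally show ?thesis .
  qed
  show ?case
  proof (intro exI[of _ "p * q"] conjI allI impI ballI)
    show "p * q \<noteq> 0" using p \<open>q \<noteq> 0\<close> by simp
    fix \<phi> b' assume \<phi>: "functional_on U \<phi>" and b': "b' \<in> insert b B"
    show "apply_poly (p * q) T \<phi> b' = 0"
    proof (cases "b' = b")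
      case True
      have "apply_poly (q * p) T \<phi> b = 0"
        unfolding apply_poly_mult by (intro q functional_on_apply_poly U T \<phi>)
      then show ?thesis by (simp add: True mult.commute)
    next
      case False
      then show ?thesis using b' unfolding apply_poly_mult
        by (intro p(2) functional_on_apply_poly U T \<phi>) auto
    qed
  qed
qed

text \<open>Take \<open>p\<close> of least degree with \<open>p(T)\<close> killing
  \<open>\<phi>\<close> and split off a root, \<open>p = (X - y) * q\<close>. Then
  \<open>q(T)\<close> does not kill \<open>\<phi>\<close> and produces an eigenfunctional. Its form
  as a polynomial in \<open>T\<close> applied to \<open>\<phi>\<close> is kept in the conclusion,
  since it preserves the eigenvalues of operators that commute with \<open>T\<close>.\<close>

lemma eigenfunctional:
  assumes U: "subspace U" and T: "lin_on U T" and \<phi>: "functional_on U \<phi>" and nz: "\<exists>u\<in>U. \<phi> u \<noteq> 0"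
  obtains q y where "functional_on U (apply_poly q T \<phi>)" "\<exists>u\<in>U. apply_poly q T \<phi> u \<noteq> 0"
    "\<And>u. u \<in> U \<Longrightarrow> apply_poly q T \<phi> (T u) = y * apply_poly q T \<phi> u"
proof -
  define P where "P p \<longleftrightarrow> p \<noteq> 0 \<and> (\<forall>u\<in>U. apply_poly p T \<phi> u = 0)" for p
  obtain B where B: "finite B" "B \<subseteq> U" "span B = U" using basis_subspace_exists[OF U] by metis
  obtain p0 where p0: "p0 \<noteq> 0" "\<And>b. b \<in> B \<Longrightarrow> apply_poly p0 T \<phi> b = 0"
    using annihilating_poly[OF U T B(1,2)] \<phi> by blast
  have "functional_on (span B) (apply_poly p0 T \<phi>)"
    using functional_on_apply_poly[OF U T \<phi>] B(3) by simp
  from functional_on_span_eq_0[OF this p0(2)] B(3) p0(1) have "P p0" by (auto simp: P_def)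
  then obtain p where p: "P p" and min: "\<And>q. P q \<Longrightarrow> Polynomial.degree p \<le> Polynomial.degree q"
    using ex_has_least_nat[of P p0 Polynomial.degree] by blast
  have "Polynomial.degree p > 0"
  proof (rule ccontr)
    assume "\<not> ?thesis"
    then obtain a where "p = [:a:]" "a \<noteq> 0" using p by (auto simp: P_def elim!: degree_eq_zeroE)
    with p nz show False by (auto simp: P_def apply_poly_pCons)
  qed
  then obtain y where "poly p y = 0" using alg_closed_imp_poly_has_root by blast
  then obtain q where q: "p = [:- y, 1:] * q" by (metis poly_eq_0_iff_dvd dvdE)
  have q0: "q \<noteq> 0" using p q by (auto simp: P_def)
  have "Polynomial.degree p = Suc (Polynomial.degree q)"
    unfolding q using q0 by (subst degree_mult_eq) auto
  then have "\<not> P q" using min[of q] by auto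
  then have "\<exists>u\<in>U. apply_poly q T \<phi> u \<noteq> 0" using q0 by (auto simp: P_def)
  moreover have "apply_poly q T \<phi> (T u) = y * apply_poly q T \<phi> u" if "u \<in> U" for u
  proof -
    have "apply_poly p T \<phi> u = 0" using p that by (simp add: P_def)
    then show ?thesis unfolding q apply_poly_mult apply_poly_pCons by simp
  qed
  ultimately show thesis using that functional_on_apply_poly[OF U T \<phi>] by blast
qed

lemma nonzero_functional:
  assumes "subspace U" "u \<in> U" "u \<noteq> 0"
  obtains \<phi> where "functional_on U \<phi>" "\<exists>u\<in>U. \<phi> u \<noteq> 0"
proof -
  interpret p: vector_space_pair scale "(*) :: 'a \<Rightarrow> 'a \<Rightarrow> 'a"
    by unfold_locales (simp_all add: algebra_simps)
  have "independent {u}" using assms by simp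
  then obtain g where g: "Vector_Spaces.linear scale (*) g" "g u = 1"
    using p.linear_independent_extend[of "{u}" "\<lambda>_. 1"] by auto
  interpret g: Vector_Spaces.linear scale "(*)" g by fact
  show thesis
    by (rule that[of "\<lambda>x. to_ac (g x)"])
      (use assms g in \<open>auto simp: functional_on_def g.add g.scale intro!: bexI[of _ u]\<close>)
qed

text \<open>One operator is added at a time: the new eigenfunctional is a polynomial in
  \<open>T\<close> applied to the old one, and operators commuting with \<open>T\<close> keep their
  eigenvalues under this change.\<close>

lemma common_eigenfunctional:
  assumes U: "subspace U" "u \<in> U" "u \<noteq> 0"
    and S: "finite S" "\<And>T. T \<in> S \<Longrightarrow> lin_on U T"
    and comm: "\<And>T T' x. T \<in> S \<Longrightarrow> T' \<in> S \<Longrightarrow> x \<in> U \<Longrightarrow> T (T' x) = T' (T x)"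
  obtains \<phi> where "functional_on U \<phi>" "\<exists>u\<in>U. \<phi> u \<noteq> 0"
    "\<And>T. T \<in> S \<Longrightarrow> \<exists>y. \<forall>x\<in>U. \<phi> (T x) = y * \<phi> x"
proof -
  have "\<exists>\<phi>. functional_on U \<phi> \<and> (\<exists>u\<in>U. \<phi> u \<noteq> 0) \<and> (\<forall>T\<in>S. \<exists>y. \<forall>x\<in>U. \<phi> (T x) = y * \<phi> x)"
    using S comm
  proof (induction S rule: finite_induct)
    case empty
    obtain \<phi> where "functional_on U \<phi>" "\<exists>u\<in>U. \<phi> u \<noteq> 0"
      using nonzero_functional[OF U] by metis
    then show ?case by auto
  next
    case (insert T S)
    have "\<exists>\<phi>. functional_on U \<phi> \<and> (\<exists>u\<in>U. \<phi> u \<noteq> 0) \<and> (\<forall>T\<in>S. \<exists>y. \<forall>x\<in>U. \<phi> (T x) = y * \<phi> x)"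
      by (rule insert.IH) (use insert.prems in blast)+
    then obtain \<phi> where \<phi>: "functional_on U \<phi>" "\<exists>u\<in>U. \<phi> u \<noteq> 0"
      "\<And>T. T \<in> S \<Longrightarrow> \<exists>y. \<forall>x\<in>U. \<phi> (T x) = y * \<phi> x" by blast
    have T: "lin_on U T" using insert by auto
    obtain q y where q: "functional_on U (apply_poly q T \<phi>)" "\<exists>u\<in>U. apply_poly q T \<phi> u \<noteq> 0"
      "\<And>u. u \<in> U \<Longrightarrow> apply_poly q T \<phi> (T u) = y * apply_poly q T \<phi> u"
      using eigenfunctional[OF U(1) T \<phi>(1,2)] by metis
    have "\<exists>y. \<forall>x\<in>U. apply_poly q T \<phi> (T' x) = y * apply_poly q T \<phi> x" if T': "T' \<in> S" for T'
    proof -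
      obtain y' where y': "\<And>x. x \<in> U \<Longrightarrow> \<phi> (T' x) = y' * \<phi> x" using \<phi>(3)[OF T'] by blast
      have TU: "x \<in> U \<Longrightarrow> (T ^^ i) x \<in> U" for i x
        using lin_on_funpow[OF T, of i] by (auto simp: lin_on_def)
      have "(T ^^ i) (T' x) = T' ((T ^^ i) x)" if "x \<in> U" for i x
        using that by (induction i) (use insert.prems(2)[of T T'] T' TU in auto)
      then have "apply_poly q T \<phi> (T' x) = y' * apply_poly q T \<phi> x" if "x \<in> U" for x
        using that TU by (simp add: apply_poly_def y' sum_distrib_left mult.left_commute)
      then show ?thesis by blast
    qed
    with q show ?case by (intro exI[of _ "apply_poly q T \<phi>"]) auto
  qed
  then show thesis using that by blast
qed

text \<open>Half of rank-nullity for \<open>\<phi>\<close> as a \<open>K\<close>-linear map into the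
  closure: a basis \<open>D\<close> of the kernel extends to a basis \<open>C\<close> of
  \<open>U\<close>, and the images of \<open>C - D\<close> already span the image.\<close>

lemma functional_image_basis:
  assumes U: "subspace U" and \<phi>: "functional_on U \<phi>"
  obtains B where "finite B" "Kb.independent B" "Kb.span B = \<phi> ` U"
    "card B + dim {u \<in> U. \<phi> u = 0} \<le> dim U"
proof -
  let ?K = "{u \<in> U. \<phi> u = 0}"
  have K: "subspace ?K"
    using U \<phi> functional_on_0[OF U \<phi>]
    by (intro subspaceI) (auto simp: functional_on_def subspace_0 subspace_add subspace_scale)
  obtain D where D: "finite D" "D \<subseteq> ?K" "independent D" "span D = ?K" "card D = dim ?K"
    by (rule basis_subspace_exists[OF K])
  have "D \<subseteq> U" using D(2) by auto
  from maximal_independent_subset_extend[OF this D(3)] obtain C where C: "D \<subseteq> C" "C \<subseteq> U" "independent C" "U \<subseteq> span C"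
    .
  have C': "finite C" "span C = U" "card C = dim U"
    using finiteI_independent[OF C(3)] span_subspace[OF C(2,4) U] basis_card_eq_dim[OF C(2,4,3)] by auto
  obtain B where B: "B \<subseteq> \<phi> ` (C - D)" "Kb.independent B" "\<phi> ` (C - D) \<subseteq> Kb.span B"
    using Kb.maximal_independent_subset[of "\<phi> ` (C - D)"] by metis
  have "card B \<le> card (C - D)"
    using B(1) C'(1) card_mono[of "\<phi> ` (C - D)" B] card_image_le[of "C - D" \<phi>] by simp
  also have "\<dots> = dim U - dim ?K" using card_Diff_subset[OF D(1) C(1)] C'(3) D(5) by simp
  finally have "card B \<le> dim U - dim ?K" .
  moreover have "dim ?K \<le> dim U" by (rule dim_subset) auto
  ultimately have 1: "finite B" "card B + dim ?K \<le> dim U"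
    using B(1) C'(1) finite_subset[of B "\<phi> ` (C - D)"] by auto
  have \<phi>C: "\<phi> c \<in> Kb.span B" if "c \<in> C" for c
    using that B(3) subsetD[OF D(2), of c] Kb.span_zero[of B] by (cases "c \<in> D") auto
  have sub: "Kb.subspace (\<phi> ` U)"
  proof (rule Kb.subspaceI)
    show "0 \<in> \<phi> ` U" using functional_on_0[OF U \<phi>] subspace_0[OF U] by (metis image_eqI)
    show "x + y \<in> \<phi> ` U" if xy: "x \<in> \<phi> ` U" "y \<in> \<phi> ` U" for x y
    proof -
      obtain a b where "a \<in> U" "b \<in> U" "x = \<phi> a" "y = \<phi> b" using xy by blast
      then have "x + y = \<phi> (a + b)" "a + b \<in> U" using \<phi> U by (auto simp: functional_on_def subspace_add)
      then show ?thesis by blast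
    qed
    show "to_ac c * x \<in> \<phi> ` U" if x: "x \<in> \<phi> ` U" for c x
    proof -
      obtain a where "a \<in> U" "x = \<phi> a" using x by blast
      then have "to_ac c * x = \<phi> (c *s a)" "c *s a \<in> U" using \<phi> U by (auto simp: functional_on_def subspace_scale)
      then show ?thesis by blast
    qed
  qed
  have "Kb.span B = \<phi> ` U"
  proof
    show "Kb.span B \<subseteq> \<phi> ` U" using B(1) C(2) by (intro Kb.span_minimal sub) auto
    show "\<phi> ` U \<subseteq> Kb.span B"
    proof
      fix x assume "x \<in> \<phi> ` U"
      then obtain u where u: "u \<in> span C" "x = \<phi> u" using C'(2) by blast
      from u(1) have "u \<in> U \<and> \<phi> u \<in> Kb.span B"
      proof (induction rule: span_induct_alt)
        case base
        then show ?case using functional_on_0[OF U \<phi>] subspace_0[OF U] Kb.span_zero by simp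
      next
        case (step a x y)
        have xU: "x \<in> U" "a *s x \<in> U" using C(2) step subspace_scale[OF U] by auto
        then have "\<phi> (a *s x + y) = to_ac a * \<phi> x + \<phi> y"
          using \<phi> step by (auto simp: functional_on_def)
        moreover have "\<phi> x \<in> Kb.span B" using step \<phi>C by auto
        moreover have "a *s x + y \<in> U" using xU step subspace_add[OF U] by auto
        ultimately show ?case using step Kb.span_add Kb.span_scale by metis
      qed
      then show "x \<in> Kb.span B" using u by simp
    qed
  qed
  with that[of B] 1 B(2) show thesis by blast
qed

end

locale valued_space = fd_space s Basis + residual_valuation v l
  for s :: "'k::field_char_0 \<Rightarrow> 'v::ab_group_add \<Rightarrow> 'v" and Basis :: "'v set"
    and v :: "'k \<Rightarrow> int" and l :: nat
begin

text \<open>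
  A primitive \<open>l\<close>-th root of unity acting on a nonzero space forces its dimension to be a multiple
  of \<open>(l - 1) / e\<close>, so operators of \<open>l\<close>-power order on smaller spaces are trivial.
\<close>
lemma small_dim_trivial:
  assumes U: "subspace U" and dim: "int (dim U) * v (of_nat l) < int l - 1"
    and T: "lin_on U T" and Tq: "\<And>u. u \<in> U \<Longrightarrow> (T ^^ (l ^ k)) u = u" and u: "u \<in> U"
  shows "T u = u"
proof (rule ccontr)
  assume ne: "T u \<noteq> u"
  \<comment> \<open>Passing to the image of \<open>T - 1\<close> excludes the eigenvalue 1. On this
    image the first \<open>l ^ k\<close> iterates of \<open>T\<close> sum to 0 by telescoping,
    whereas an eigenvalue 1 would multiply a nonzero value of \<open>\<phi>\<close> by
    \<open>l ^ k\<close>.\<close>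
  define U' where "U' = (\<lambda>x. T x - x) ` U"
  have TU: "T x \<in> U" if "x \<in> U" for x using T that by (auto simp: lin_on_def)
  have TiU: "(T ^^ i) x \<in> U" if "x \<in> U" for i x using funpow_range[of U T x i] TU that by auto
  have U'U: "U' \<subseteq> U" using TU subspace_diff[OF U] by (auto simp: U'_def)
  have U': "subspace U'"
  proof (rule subspaceI)
    show "0 \<in> U'" using lin_on_0[OF U T] subspace_0[OF U] by (force simp: U'_def)
    show "x + y \<in> U'" if "x \<in> U'" "y \<in> U'" for x y
    proof -
      obtain a b where ab: "a \<in> U" "b \<in> U" "x = T a - a" "y = T b - b" using \<open>x \<in> U'\<close> \<open>y \<in> U'\<close> by (auto simp: U'_def)
      then have "x + y = T (a + b) - (a + b)" using T by (auto simp: lin_on_def)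
      then show ?thesis using subspace_add[OF U ab(1,2)] unfolding U'_def by blast
    qed
    show "s c x \<in> U'" if "x \<in> U'" for c x
    proof -
      obtain a where a: "a \<in> U" "x = T a - a" using \<open>x \<in> U'\<close> by (auto simp: U'_def)
      then have "s c x = T (s c a) - s c a" using T by (auto simp: lin_on_def scale_right_diff_distrib)
      then show ?thesis using subspace_scale[OF U a(1), of c] unfolding U'_def by blast
    qed
  qed
  have T': "lin_on U' T"
  proof -
    have "T (T a - a) \<in> U'" if "a \<in> U" for a
      using that TU lin_on_diff[OF U T TU that] by (auto simp: U'_def)
    then show ?thesis using T U'U unfolding lin_on_def U'_def by blast
  qed
  have "T u - u \<in> U'" "T u - u \<noteq> 0" using u ne by (auto simp: U'_def)
  from common_eigenfunctional[OF U' this, of "{T}"] T'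
  obtain \<phi> where \<phi>: "functional_on U' \<phi>" "\<exists>u\<in>U'. \<phi> u \<noteq> 0" "\<exists>y. \<forall>x\<in>U'. \<phi> (T x) = y * \<phi> x"
    by auto
  then obtain y where y: "\<And>x. x \<in> U' \<Longrightarrow> \<phi> (T x) = y * \<phi> x" by blast
  obtain a where a: "a \<in> U" "\<phi> (T a - a) \<noteq> 0" using \<phi>(2) by (auto simp: U'_def)
  have U'i: "(T ^^ i) (T a - a) \<in> U'" for i
    by (rule funpow_range) (use T' a in \<open>auto simp: lin_on_def U'_def\<close>)
  have yi: "\<phi> ((T ^^ i) (T a - a)) = y ^ i * \<phi> (T a - a)" for i
    by (induction i) (use y U'i in auto)
  have yq: "y ^ (l ^ k) = 1"
    using yi[of "l ^ k"] Tq U'U a by (auto simp: U'_def)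
  have "(\<Sum>i<n. (T ^^ i) (T a - a)) = (T ^^ n) a - a" for n
  proof (induction n)
    case (Suc n)
    have "(T ^^ n) (T a - a) = (T ^^ n) (T a) - (T ^^ n) a"
      using lin_on_diff[OF U lin_on_funpow[OF T] TU[OF a(1)] a(1)] .
    with Suc show ?case by (simp add: funpow_swap1)
  qed simp
  then have "(\<Sum>i<l ^ k. (T ^^ i) (T a - a)) = 0" using Tq a by simp
  then have "(\<Sum>i<l ^ k. y ^ i * \<phi> (T a - a)) = 0"
    using functional_on_sum[OF U' \<phi>(1), of "{..<l ^ k}" "\<lambda>i. (T ^^ i) (T a - a)"] U'i functional_on_0[OF U' \<phi>(1)]
    by (simp flip: yi)
  then have sum0: "(\<Sum>i<l ^ k. y ^ i) = 0" using a by (simp flip: sum_distrib_right)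
  have "y \<noteq> 1"
  proof
    assume "y = 1"
    then have "(of_nat (l ^ k) :: 'k alg_closure) = 0" using sum0 by simp
    then show False using l_pos by (simp only: of_nat_ac_eq_0_iff) simp
  qed
  from primitive_prime_powerI[OF prime_l yq this]
  obtain j where j: "j \<ge> 1" "primitive_root_of_unity (l ^ j) y" by metis
  have "l ^ j = l ^ (j - 1) * l" using j(1) by (metis power_Suc2 Suc_diff_1 less_eq_Suc_le One_nat_def)
  then have z: "primitive_root_of_unity (l ^ Suc 0) (y ^ (l ^ (j - 1)))"
    using primitive_root_of_power[of "l ^ (j - 1)" l y] j l_pos by simp
  obtain B where B: "finite B" "Kb.independent B" "Kb.span B = \<phi> ` U'" "card B \<le> dim U'"
    using functional_image_basis[OF U' \<phi>(1)] by (metis add_leD1)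
  have yB: "y * x \<in> Kb.span B" if "x \<in> Kb.span B" for x
    using that y T' unfolding B(3) lin_on_def by (metis (no_types, lifting) image_iff)
  then have "y ^ i * x \<in> Kb.span B" if "x \<in> Kb.span B" for x i
    using that by (induction i) (auto simp: mult.assoc)
  from primitive_stable_dvd[OF B(1,2) z this] have dvd: "int (l - 1) dvd int (card B) * v (of_nat l)" by simp
  have "B \<noteq> {}" using B(3) \<phi>(2) by force
  then have "card B > 0" using B(1) by (simp add: card_gt_0_iff)
  then have "int (card B) * v (of_nat l) > 0" using v_l by simp
  with dvd have "int (l - 1) \<le> int (card B) * v (of_nat l)" by (rule zdvd_imp_le)
  also have "\<dots> \<le> int (dim U) * v (of_nat l)"
    using B(4) dim_subset[OF U'U] v_l by (intro mult_right_mono) auto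
  finally show False using dim l_pos by simp
qed

end

section \<open>Quasisplit group algebras\<close>

definition coeffs_in :: "'a::zero set \<Rightarrow> 'a poly \<Rightarrow> bool" where
  "coeffs_in F p \<longleftrightarrow> (\<forall>i. poly.coeff p i \<in> F)"

locale subfield_set =
  fixes F :: "'a::field set"
  assumes one_in: "1 \<in> F" and diff_in: "x \<in> F \<Longrightarrow> y \<in> F \<Longrightarrow> x - y \<in> F"
    and mult_in: "x \<in> F \<Longrightarrow> y \<in> F \<Longrightarrow> x * y \<in> F" and inverse_in: "x \<in> F \<Longrightarrow> inverse x \<in> F"
begin

lemma zero_in: "0 \<in> F"
  using diff_in[OF one_in one_in] by simp

lemma power_in: "x \<in> F \<Longrightarrow> x ^ n \<in> F"
  by (induction n) (auto intro: one_in mult_in)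

text \<open>Long division by a monic polynomial uses only ring operations on the coefficients, so it
  never leaves \<open>F\<close>.\<close>

lemma remainder_coeffs_in:
  assumes p: "coeffs_in F p" "lead_coeff p = 1" and f: "coeffs_in F f"
  obtains r where "coeffs_in F r" "p dvd f - r" "r = 0 \<or> Polynomial.degree r < Polynomial.degree p"
proof -
  have "\<exists>r. coeffs_in F r \<and> p dvd f - r \<and> (r = 0 \<or> Polynomial.degree r < Polynomial.degree p)"
    using f
  proof (induction "Polynomial.degree f" arbitrary: f rule: less_induct)
    case less
    show ?case
    proof (cases "f = 0 \<or> Polynomial.degree f < Polynomial.degree p")
      case True
      then show ?thesis using less.prems by (intro exI[of _ f]) auto
    next
      case False
      define c where "c = Polynomial.monom (lead_coeff f) (Polynomial.degree f - Polynomial.degree p)"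
      define g where "g = f - c * p"
      have p0: "p \<noteq> 0" using p(2) by auto
      have dc: "Polynomial.degree (c * p) = Polynomial.degree f"
        using False p0 by (simp add: c_def degree_mult_eq degree_monom_eq monom_eq_0_iff)
      have gF: "coeffs_in F g"
        using less.prems p(1) diff_in mult_in zero_in unfolding coeffs_in_def g_def c_def
        by (auto simp: coeff_monom_mult)
      have "poly.coeff g (Polynomial.degree f) = 0"
        using False p(2) by (simp add: g_def c_def coeff_monom_mult)
      moreover have "Polynomial.degree g \<le> Polynomial.degree f"
        unfolding g_def using degree_diff_le[of f _ "c * p"] dc by simp
      ultimately have "g = 0 \<or> Polynomial.degree g < Polynomial.degree f"
        by (metis leading_coeff_0_iff le_neq_implies_less)
      then obtain r where r: "coeffs_in F r" "p dvd g - r" "r = 0 \<or> Polynomial.degree r < Polynomial.degree p"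
      proof
        assume "g = 0"
        then show ?thesis using that[of 0] zero_in by (simp add: coeffs_in_def)
      qed (use less.hyps gF in blast)
      have "p dvd (g - r) + c * p" using r(2) by simp
      also have "(g - r) + c * p = f - r" by (simp add: g_def)
      finally have "p dvd f - r" .
      then show ?thesis using r by blast
    qed
  qed
  with that show thesis by blast
qed

end

text \<open>
  The constant term of the minimal polynomial of \<open>y\<close> over \<open>F\<close> is, up to a \<open>q\<close>-th root of unity,
  a power of \<open>y\<close> with exponent prime to \<open>q\<close>.
\<close>
lemma prime_power_root_in_subfield:
  fixes y :: "'a::alg_closed_field"
  assumes "subfield_set F" and l: "Factorial_Ring.prime l" and y: "y \<noteq> 0" "y ^ (l ^ k) \<in> F"
    and p0: "p0 \<noteq> 0" "coeffs_in F p0" "poly p0 y = 0" "Polynomial.degree p0 < l"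
  obtains b where "b \<in> F" "b ^ (l ^ k) = y ^ (l ^ k)"
proof -
  interpret subfield_set F by fact
  define q where "q = l ^ k"
  define c where "c = y ^ q"
  have q0: "q > 0" using prime_gt_0_nat[OF l] by (simp add: q_def)
  define P where "P p \<longleftrightarrow> p \<noteq> 0 \<and> coeffs_in F p \<and> poly p y = 0" for p
  obtain p1 where p1: "P p1" and min: "\<And>q. P q \<Longrightarrow> Polynomial.degree p1 \<le> Polynomial.degree q"
    using ex_has_least_nat[of P p0 Polynomial.degree] p0 unfolding P_def by blast
  define p where "p = Polynomial.smult (inverse (lead_coeff p1)) p1"
  define t where "t = Polynomial.degree p"
  have lc: "lead_coeff p1 \<noteq> 0" using p1 by (simp add: P_def)
  have p: "coeffs_in F p" "lead_coeff p = 1" "poly p y = 0" "p \<noteq> 0" "Polynomial.degree p = Polynomial.degree p1"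
    using p1 lc by (auto simp: P_def p_def coeffs_in_def intro!: mult_in inverse_in)
  have tl: "t < l" using min[of p0] p0 p(5) by (simp add: P_def t_def)
  have t0: "t > 0"
  proof (rule ccontr)
    assume "\<not> ?thesis"
    then obtain a where "p = [:a:]" by (auto simp: t_def elim!: degree_eq_zeroE)
    with p(3,4) show False by simp
  qed
  \<comment> \<open>The remainder of \<open>X^q - c\<close> modulo the minimal polynomial
    \<open>p\<close> vanishes at \<open>y\<close>, hence is 0. So every root of \<open>p\<close> is
    a \<open>q\<close>-th root of \<open>c\<close>.\<close>
  define f where "f = Polynomial.monom 1 q - [:c:]"
  have "coeffs_in F f"
    using y(2) one_in zero_in diff_in
    by (auto simp: coeffs_in_def f_def c_def q_def coeff_pCons split: nat.split)
  then obtain r where r: "coeffs_in F r" "p dvd f - r" "r = 0 \<or> Polynomial.degree r < Polynomial.degree p"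
    using remainder_coeffs_in[OF p(1,2)] by metis
  have "poly f y = 0" by (simp add: f_def poly_monom c_def)
  moreover have "poly (f - r) y = 0" using r(2) p(3) by (metis dvdE mult_zero_left poly_mult)
  ultimately have "poly r y = 0" by simp
  then have "r = 0" using min[of r] r(1,3) p(5) unfolding P_def by linarith
  with r(2) have pf: "p dvd f" by simp
  obtain A where A: "size A = t" "p = (\<Prod>x\<in>#A. [:- x, 1:])"
    using alg_closed_imp_factorization[OF p(4)] p(2) by (auto simp: t_def)
  have xq: "x ^ q = c" if "x \<in># A" for x
  proof -
    have "poly p x = 0" using that by (auto simp: A(2) poly_prod_mset)
    then have "poly f x = 0" using pf by (auto elim!: dvdE)
    then show ?thesis by (simp add: f_def poly_monom)
  qed
  define b0 where "b0 = prod_mset A"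
  have "poly p 0 = (-1) ^ t * b0"
  proof -
    have "(\<Prod>x\<in>#A'. - x) = (-1) ^ size A' * prod_mset A'" for A' :: "'a multiset"
      by (induction A') auto
    then show ?thesis unfolding A(2) b0_def using A(1) by (simp add: poly_prod_mset)
  qed
  then have b0_eq: "b0 = (-1) ^ t * poly p 0"
    by (simp add: mult.assoc[symmetric] power_mult_distrib[symmetric])
  have m1: "-1 \<in> F" using diff_in[OF zero_in one_in] by simp
  have b0F: "b0 \<in> F" unfolding b0_eq using p(1) m1
    by (intro mult_in power_in) (auto simp: coeffs_in_def poly_0_coeff_0)
  have b0q: "b0 ^ q = c ^ t"
  proof -
    have "prod_mset A' ^ q = c ^ size A'" if "\<forall>x\<in>#A'. x ^ q = c" for A'
      using that by (induction A') (auto simp: power_mult_distrib)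
    then show ?thesis using xq A(1) by (simp add: b0_def)
  qed
  have "coprime t q"
    using prime_imp_coprime[OF l, of t] t0 tl nat_dvd_not_less unfolding q_def
    by (metis coprime_commute coprime_power_right_iff)
  \<comment> \<open>The product \<open>b0\<close> of the \<open>t\<close> roots of \<open>p\<close>
    lies in \<open>F\<close>, being the constant term up to sign, and \<open>b0 ^ q = c ^ t\<close>.
    Since \<open>0 < t < l\<close>, Bezout turns the exponent \<open>t\<close> into 1 modulo
    \<open>q\<close>, and the surplus \<open>c ^ (q * b')\<close> is the \<open>q\<close>-th power
    of an element of \<open>F\<close>.\<close>
  then obtain a' b' where ab: "t * a' = q * b' + 1"
    using bezout_nat[of t q] t0 by (metis coprime_imp_gcd_eq_1 less_irrefl)
  have c0: "c \<noteq> 0" using y(1) by (simp add: c_def)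
  define b where "b = b0 ^ a' * inverse (c ^ b')"
  have "c \<in> F" using y(2) by (simp add: c_def q_def)
  then have "b \<in> F" unfolding b_def by (intro mult_in inverse_in power_in b0F)
  moreover have "b ^ q = c"
  proof -
    have "b ^ q = (b0 ^ q) ^ a' * inverse ((c ^ b') ^ q)"
      by (simp add: b_def power_mult_distrib power_inverse mult.commute flip: power_mult)
    also have "\<dots> = c ^ (q * b' + 1) * inverse (c ^ (q * b'))"
      unfolding b0q ab[symmetric] by (simp add: mult.commute flip: power_mult)
    also have "\<dots> = c" using c0 by simp
    finally show ?thesis .
  qed
  ultimately show thesis using that[of b] by (simp add: c_def q_def)
qed

section \<open>Matrix units in a sum of matrix algebras\<close>

lemma matrix_unit_mult_left:
  assumes "ring L" "y \<in> {..<n} \<times> {..<n} \<rightarrow>\<^sub>E carrier L" "a < n" "b < n" "p < n" "q < (n::nat)" "c \<in> carrier L"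
  shows "(\<Oplus>\<^bsub>L\<^esub>k\<in>{..<n}. (if p = a \<and> k = b then c else \<zero>\<^bsub>L\<^esub>) \<otimes>\<^bsub>L\<^esub> y (k, q)) =
    (if p = a then c \<otimes>\<^bsub>L\<^esub> y (b, q) else \<zero>\<^bsub>L\<^esub>)"
proof -
  interpret ring L by fact
  have y: "y (k, q) \<in> carrier L" if "k < n" for k using assms that by auto
  have "(\<Oplus>\<^bsub>L\<^esub>k\<in>{..<n}. (if p = a \<and> k = b then c else \<zero>\<^bsub>L\<^esub>) \<otimes>\<^bsub>L\<^esub> y (k, q)) =
      (\<Oplus>\<^bsub>L\<^esub>k\<in>{..<n}. if b = k then (if p = a then c \<otimes>\<^bsub>L\<^esub> y (k, q) else \<zero>\<^bsub>L\<^esub>) else \<zero>\<^bsub>L\<^esub>)"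
    using y assms by (intro finsum_cong') auto
  also have "\<dots> = (if p = a then c \<otimes>\<^bsub>L\<^esub> y (b, q) else \<zero>\<^bsub>L\<^esub>)"
    using y assms by (intro finsum_singleton) auto
  finally show ?thesis .
qed

lemma matrix_unit_mult_right:
  assumes "ring L" "y \<in> {..<n} \<times> {..<n} \<rightarrow>\<^sub>E carrier L" "a < n" "b < n" "p < n" "q < (n::nat)" "c \<in> carrier L"
  shows "(\<Oplus>\<^bsub>L\<^esub>k\<in>{..<n}. y (p, k) \<otimes>\<^bsub>L\<^esub> (if k = a \<and> q = b then c else \<zero>\<^bsub>L\<^esub>)) =
    (if q = b then y (p, a) \<otimes>\<^bsub>L\<^esub> c else \<zero>\<^bsub>L\<^esub>)"
proof -
  interpret ring L by fact
  have y: "y (p, k) \<in> carrier L" if "k < n" for k using assms that by auto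
  have "(\<Oplus>\<^bsub>L\<^esub>k\<in>{..<n}. y (p, k) \<otimes>\<^bsub>L\<^esub> (if k = a \<and> q = b then c else \<zero>\<^bsub>L\<^esub>)) =
      (\<Oplus>\<^bsub>L\<^esub>k\<in>{..<n}. if a = k then (if q = b then y (p, k) \<otimes>\<^bsub>L\<^esub> c else \<zero>\<^bsub>L\<^esub>) else \<zero>\<^bsub>L\<^esub>)"
    using y assms by (intro finsum_cong') auto
  also have "\<dots> = (if q = b then y (p, a) \<otimes>\<^bsub>L\<^esub> c else \<zero>\<^bsub>L\<^esub>)"
    using y assms by (intro finsum_singleton) auto
  finally show ?thesis .
qed

text \<open>
  The elements \<open>e i\<close> are the matrix units \<open>E\<^sub>1\<^sub>1\<close> of the blocks of a quasisplit group algebra.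
\<close>
theorem quasisplit_idempotents:
  fixes H :: "('g, 'm) monoid_scheme"
  defines "A \<equiv> group_algebra H :: ('k::field, 'g \<Rightarrow> 'k) module"
  assumes "group H" "quasisplit A"
  obtains r :: nat and e where
    "\<And>i. i < r \<Longrightarrow> e i \<in> carrier A"
    "\<And>i. i < r \<Longrightarrow> e i \<otimes>\<^bsub>A\<^esub> e i = e i"
    "\<And>i j a. i < r \<Longrightarrow> j < r \<Longrightarrow> i \<noteq> j \<Longrightarrow> a \<in> carrier A \<Longrightarrow> (e i \<otimes>\<^bsub>A\<^esub> a) \<otimes>\<^bsub>A\<^esub> e j = \<zero>\<^bsub>A\<^esub>"
    "\<And>i a b. i < r \<Longrightarrow> a \<in> carrier A \<Longrightarrow> b \<in> carrier A \<Longrightarrow>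
       ((e i \<otimes>\<^bsub>A\<^esub> a) \<otimes>\<^bsub>A\<^esub> e i) \<otimes>\<^bsub>A\<^esub> ((e i \<otimes>\<^bsub>A\<^esub> b) \<otimes>\<^bsub>A\<^esub> e i) =
       ((e i \<otimes>\<^bsub>A\<^esub> b) \<otimes>\<^bsub>A\<^esub> e i) \<otimes>\<^bsub>A\<^esub> ((e i \<otimes>\<^bsub>A\<^esub> a) \<otimes>\<^bsub>A\<^esub> e i)"
    "\<And>i a. i < r \<Longrightarrow> a \<in> carrier A \<Longrightarrow> (e i \<otimes>\<^bsub>A\<^esub> a) \<otimes>\<^bsub>A\<^esub> e i \<noteq> \<zero>\<^bsub>A\<^esub> \<Longrightarrow>
       \<exists>b\<in>carrier A. b \<otimes>\<^bsub>A\<^esub> ((e i \<otimes>\<^bsub>A\<^esub> a) \<otimes>\<^bsub>A\<^esub> e i) = e i"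
    "\<And>I. \<zero>\<^bsub>A\<^esub> \<in> I \<Longrightarrow> (\<And>x y. x \<in> I \<Longrightarrow> y \<in> I \<Longrightarrow> x \<oplus>\<^bsub>A\<^esub> y \<in> I) \<Longrightarrow>
       (\<And>i a b. i < r \<Longrightarrow> a \<in> carrier A \<Longrightarrow> b \<in> carrier A \<Longrightarrow> (a \<otimes>\<^bsub>A\<^esub> e i) \<otimes>\<^bsub>A\<^esub> b \<in> I) \<Longrightarrow> \<one>\<^bsub>A\<^esub> \<in> I"
proof -
  obtain r :: nat and n :: "nat \<Rightarrow> nat" and L :: "nat \<Rightarrow> ('k, 'g \<Rightarrow> 'k) module" and h
    where nL: "\<And>i. i < r \<Longrightarrow> 0 < n i" "\<And>i. i < r \<Longrightarrow> field (L i)"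
      and h: "h \<in> ring_iso A (direct_sum_algebra {..<r} (\<lambda>i. matrix_algebra (n i) (L i)))"
    using assms(3) unfolding quasisplit_def by blast
  define T where "T = direct_sum_algebra {..<r} (\<lambda>i. matrix_algebra (n i) (L i))"
  have field: "ring (L i)" "cring (L i)" if "i < r" for i
    using nL(2)[OF that] fieldE(1) cring.axioms(1) by (auto intro: fieldE(1) cring.axioms(1))
  have one: "\<one>\<^bsub>L i\<^esub> \<in> carrier (L i)" and zero: "\<zero>\<^bsub>L i\<^esub> \<in> carrier (L i)" if "i < r" for i
    using ring.ring_simprules(6,2)[OF field(1)[OF that]] by auto
  have carT: "carrier T = (\<Pi>\<^sub>E i\<in>{..<r}. {..<n i} \<times> {..<n i} \<rightarrow>\<^sub>E carrier (L i))"
    by (simp add: T_def direct_sum_algebra_def matrix_algebra_def)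
  have T_eqI: "x = y" if "x \<in> carrier T" "y \<in> carrier T"
    "\<And>i p q. i < r \<Longrightarrow> p < n i \<Longrightarrow> q < n i \<Longrightarrow> x i (p, q) = y i (p, q)" for x y
  proof (rule PiE_ext[OF that(1)[unfolded carT] that(2)[unfolded carT]])
    fix i assume i: "i \<in> {..<r}"
    show "x i = y i"
      by (rule PiE_ext[of _ "{..<n i} \<times> {..<n i}" "\<lambda>_. carrier (L i)"])
        (use that i in \<open>auto simp: carT\<close>)
  qed
  have T_mult: "(x \<otimes>\<^bsub>T\<^esub> y) i (p, q) = (\<Oplus>\<^bsub>L i\<^esub>k\<in>{..<n i}. x i (p, k) \<otimes>\<^bsub>L i\<^esub> y i (k, q))"
    if "i < r" "p < n i" "q < n i" for x y i p q
    using that by (simp add: T_def direct_sum_algebra_def matrix_algebra_def)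
  have T_add: "(x \<oplus>\<^bsub>T\<^esub> y) i (p, q) = x i (p, q) \<oplus>\<^bsub>L i\<^esub> y i (p, q)"
    if "i < r" "p < n i" "q < n i" for x y i p q
    using that by (simp add: T_def direct_sum_algebra_def matrix_algebra_def)
  have car: "x i (p, q) \<in> carrier (L i)" if "x \<in> carrier T" "i < r" "p < n i" "q < n i" for x i p q
    using that by (auto simp: carT)
  have mult_closed: "x \<otimes>\<^bsub>T\<^esub> y \<in> carrier T" if "x \<in> carrier T" "y \<in> carrier T" for x y
  proof -
    have "(\<Oplus>\<^bsub>L i\<^esub>k\<in>{..<n i}. x i (p, k) \<otimes>\<^bsub>L i\<^esub> y i (k, q)) \<in> carrier (L i)"
      if i: "i < r" "p < n i" "q < n i" for i p q
    proof -
      interpret ring "L i" using field i by auto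
      show ?thesis using i car[OF \<open>x \<in> carrier T\<close>] car[OF \<open>y \<in> carrier T\<close>]
        by (intro finsum_closed) auto
    qed
    then show ?thesis
      by (auto simp: carT T_def direct_sum_algebra_def matrix_algebra_def)
  qed
  have add_closed: "x \<oplus>\<^bsub>T\<^esub> y \<in> carrier T" if "x \<in> carrier T" "y \<in> carrier T" for x y
  proof -
    have "x i (p, q) \<oplus>\<^bsub>L i\<^esub> y i (p, q) \<in> carrier (L i)"
      if i: "i < r" "p < n i" "q < n i" for i p q
    proof -
      interpret ring "L i" using field i by auto
      show ?thesis using i car[OF \<open>x \<in> carrier T\<close>] car[OF \<open>y \<in> carrier T\<close>] by auto
    qed
    then show ?thesis
      by (auto simp: carT T_def direct_sum_algebra_def matrix_algebra_def)
  qed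
  \<comment> \<open>\<open>U i a b c\<close> is \<open>c\<close> times the matrix unit at position
    \<open>(a, b)\<close> of block \<open>i\<close>.\<close>
  define U where "U i a b c = (\<lambda>j\<in>{..<r}. \<lambda>(p, q)\<in>{..<n j} \<times> {..<n j}.
    if j = i then (if p = a \<and> q = b then c else \<zero>\<^bsub>L j\<^esub>) else \<zero>\<^bsub>L j\<^esub>)" for i a b c
  have U_closed: "U i a b c \<in> carrier T" if "i < r" "c \<in> carrier (L i)" for i a b c
    using that zero by (auto simp: U_def carT)
  have U_entry: "U i a b c j (p, q) = (if j = i then (if p = a \<and> q = b then c else \<zero>\<^bsub>L j\<^esub>) else \<zero>\<^bsub>L j\<^esub>)"
    if "j < r" "p < n j" "q < n j" for i a b c j p q
    using that by (simp add: U_def)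
  have U_left: "(U i a b c \<otimes>\<^bsub>T\<^esub> y) j (p, q) =
      (if j = i \<and> p = a then c \<otimes>\<^bsub>L i\<^esub> y i (b, q) else \<zero>\<^bsub>L j\<^esub>)"
    if "y \<in> carrier T" "i < r" "a < n i" "b < n i" "c \<in> carrier (L i)" "j < r" "p < n j" "q < n j" for i a b c y j p q
  proof (cases "j = i")
    case True
    have "(U i a b c \<otimes>\<^bsub>T\<^esub> y) j (p, q) =
        (\<Oplus>\<^bsub>L i\<^esub>k\<in>{..<n i}. (if p = a \<and> k = b then c else \<zero>\<^bsub>L i\<^esub>) \<otimes>\<^bsub>L i\<^esub> y i (k, q))"
    proof -
      interpret ring "L i" using field that by auto
      show ?thesis unfolding True T_mult[OF that(6-8)[unfolded True]]
        by (rule finsum_cong'[OF refl]) (use that True car[OF that(1)] in \<open>auto simp: U_entry\<close>)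
    qed
    also have "\<dots> = (if p = a then c \<otimes>\<^bsub>L i\<^esub> y i (b, q) else \<zero>\<^bsub>L i\<^esub>)"
      using that True field by (intro matrix_unit_mult_left) (auto simp: carT)
    finally show ?thesis using True by simp
  next
    case False
    interpret ring "L j" using field that by auto
    have "(U i a b c \<otimes>\<^bsub>T\<^esub> y) j (p, q) = (\<Oplus>\<^bsub>L j\<^esub>k\<in>{..<n j}. \<zero>\<^bsub>L j\<^esub>)"
      unfolding T_mult[OF that(6-8)] using that False car[OF that(1)]
      by (intro finsum_cong') (auto simp: U_entry)
    then show ?thesis using False by simp
  qed
  have U_right: "(y \<otimes>\<^bsub>T\<^esub> U i a b c) j (p, q) =
      (if j = i \<and> q = b then y i (p, a) \<otimes>\<^bsub>L i\<^esub> c else \<zero>\<^bsub>L j\<^esub>)"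
    if "y \<in> carrier T" "i < r" "a < n i" "b < n i" "c \<in> carrier (L i)" "j < r" "p < n j" "q < n j" for i a b c y j p q
  proof (cases "j = i")
    case True
    have "(y \<otimes>\<^bsub>T\<^esub> U i a b c) j (p, q) =
        (\<Oplus>\<^bsub>L i\<^esub>k\<in>{..<n i}. y i (p, k) \<otimes>\<^bsub>L i\<^esub> (if k = a \<and> q = b then c else \<zero>\<^bsub>L i\<^esub>))"
    proof -
      interpret ring "L i" using field that by auto
      show ?thesis unfolding True T_mult[OF that(6-8)[unfolded True]]
        by (rule finsum_cong'[OF refl]) (use that True car[OF that(1)] in \<open>auto simp: U_entry\<close>)
    qed
    also have "\<dots> = (if q = b then y i (p, a) \<otimes>\<^bsub>L i\<^esub> c else \<zero>\<^bsub>L i\<^esub>)"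
      using that True field by (intro matrix_unit_mult_right) (auto simp: carT)
    finally show ?thesis using True by simp
  next
    case False
    interpret ring "L j" using field that by auto
    have "(y \<otimes>\<^bsub>T\<^esub> U i a b c) j (p, q) = (\<Oplus>\<^bsub>L j\<^esub>k\<in>{..<n j}. \<zero>\<^bsub>L j\<^esub>)"
      unfolding T_mult[OF that(6-8)] using that False car[OF that(1)]
      by (intro finsum_cong') (auto simp: U_entry)
    then show ?thesis using False by simp
  qed
  define E where "E i = U i 0 0 \<one>\<^bsub>L i\<^esub>" for i
  define Z where "Z = (\<lambda>j\<in>{..<r}. \<lambda>(p, q)\<in>{..<n j} \<times> {..<n j}. \<zero>\<^bsub>L j\<^esub>)"
  have Z_closed: "Z \<in> carrier T" using zero by (auto simp: Z_def carT)
  have Z_entry: "Z j (p, q) = \<zero>\<^bsub>L j\<^esub>" if "j < r" "p < n j" "q < n j" for j p q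
    using that by (simp add: Z_def)
  have E_closed: "E i \<in> carrier T" if "i < r" for i using that one U_closed by (simp add: E_def)
  \<comment> \<open>The corner cut out by \<open>E i\<close> sees only the entry
    \<open>(0, 0)\<close> of block \<open>i\<close>, so it is a copy of the field
    \<open>L i\<close>. Commutativity and division in the corner both come from this.\<close>
  have EXE: "(E i \<otimes>\<^bsub>T\<^esub> x) \<otimes>\<^bsub>T\<^esub> E j = (if i = j then U i 0 0 (x i (0, 0)) else Z)"
    if "i < r" "j < r" "x \<in> carrier T" for i j x
  proof (rule T_eqI)
    show "(E i \<otimes>\<^bsub>T\<^esub> x) \<otimes>\<^bsub>T\<^esub> E j \<in> carrier T" using that by (intro mult_closed E_closed)
    show "(if i = j then U i 0 0 (x i (0, 0)) else Z) \<in> carrier T"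
      using that nL car Z_closed by (auto intro!: U_closed)
    fix k p q assume k: "k < r" "p < n k" "q < n k"
    interpret ring "L k" using field k by auto
    interpret Lj: ring "L j" using field that by auto
    interpret Li: ring "L i" using field that by auto
    show "((E i \<otimes>\<^bsub>T\<^esub> x) \<otimes>\<^bsub>T\<^esub> E j) k (p, q) = (if i = j then U i 0 0 (x i (0, 0)) else Z) k (p, q)"
      using that k nL one car mult_closed[OF E_closed that(3)]
      by (auto simp: E_def U_left U_right U_entry Z_entry)
  qed
  have UU: "U i 0 0 c \<otimes>\<^bsub>T\<^esub> U i 0 0 c' = U i 0 0 (c \<otimes>\<^bsub>L i\<^esub> c')"
    if "i < r" "c \<in> carrier (L i)" "c' \<in> carrier (L i)" for i c c'
  proof (rule T_eqI)
    interpret Li: ring "L i" using field that by auto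
    show "U i 0 0 c \<otimes>\<^bsub>T\<^esub> U i 0 0 c' \<in> carrier T" using that by (intro mult_closed U_closed)
    show "U i 0 0 (c \<otimes>\<^bsub>L i\<^esub> c') \<in> carrier T" using that by (intro U_closed) auto
    fix k p q assume k: "k < r" "p < n k" "q < n k"
    show "(U i 0 0 c \<otimes>\<^bsub>T\<^esub> U i 0 0 c') k (p, q) = U i 0 0 (c \<otimes>\<^bsub>L i\<^esub> c') k (p, q)"
      using that k nL by (auto simp: U_left U_entry U_closed)
  qed
  have EE: "E i \<otimes>\<^bsub>T\<^esub> E i = E i" if "i < r" for i
  proof -
    interpret Li: ring "L i" using field that by auto
    show ?thesis using UU[of i "\<one>\<^bsub>L i\<^esub>" "\<one>\<^bsub>L i\<^esub>"] that by (simp add: E_def)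
  qed
  have EXE_ne: "\<exists>y\<in>carrier T. y \<otimes>\<^bsub>T\<^esub> ((E i \<otimes>\<^bsub>T\<^esub> x) \<otimes>\<^bsub>T\<^esub> E i) = E i"
    if "i < r" "x \<in> carrier T" "(E i \<otimes>\<^bsub>T\<^esub> x) \<otimes>\<^bsub>T\<^esub> E i \<noteq> Z" for i x
  proof -
    interpret Li: field "L i" using nL that by auto
    define c where "c = x i (0, 0)"
    have c: "c \<in> carrier (L i)" using car that nL by (simp add: c_def)
    have "c \<noteq> \<zero>\<^bsub>L i\<^esub>"
    proof
      assume "c = \<zero>\<^bsub>L i\<^esub>"
      then have "U i 0 0 c = Z" using that c by (intro T_eqI U_closed Z_closed) (auto simp: U_entry Z_entry)
      then show False using EXE[of i i x] that by (simp add: c_def)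
    qed
    then have "c \<in> Units (L i)" using c Li.field_Units by auto
    then have "inv\<^bsub>L i\<^esub> c \<otimes>\<^bsub>L i\<^esub> c = \<one>\<^bsub>L i\<^esub>" "inv\<^bsub>L i\<^esub> c \<in> carrier (L i)" by auto
    then have "U i 0 0 (inv\<^bsub>L i\<^esub> c) \<otimes>\<^bsub>T\<^esub> U i 0 0 c = E i" "U i 0 0 (inv\<^bsub>L i\<^esub> c) \<in> carrier T"
      using UU[of i "inv\<^bsub>L i\<^esub> c" c] that c by (auto simp: E_def intro: U_closed)
    then show ?thesis using EXE[of i i x] that by (auto simp: c_def)
  qed
  have T_one: "\<one>\<^bsub>T\<^esub> \<in> I" if I: "Z \<in> I" "\<And>x y. x \<in> I \<Longrightarrow> y \<in> I \<Longrightarrow> x \<oplus>\<^bsub>T\<^esub> y \<in> I"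
    "\<And>i a b. i < r \<Longrightarrow> a \<in> carrier T \<Longrightarrow> b \<in> carrier T \<Longrightarrow> (a \<otimes>\<^bsub>T\<^esub> E i) \<otimes>\<^bsub>T\<^esub> b \<in> I" for I
  proof -
    \<comment> \<open>\<open>D S\<close> is the part of the identity supported on a set
      \<open>S\<close> of diagonal positions. Each step of the induction adds
      \<open>E_aa = E_a0 E_00 E_0a\<close>, an element of the ideal generated by
      \<open>E i\<close>.\<close>
    define D where "D S = (\<lambda>j\<in>{..<r}. \<lambda>(p, q)\<in>{..<n j} \<times> {..<n j}.
      if p = q \<and> (j, p) \<in> S then \<one>\<^bsub>L j\<^esub> else \<zero>\<^bsub>L j\<^esub>)" for S
    have D_closed: "D S \<in> carrier T" for S using one zero by (auto simp: D_def carT)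
    have D_entry: "D S j (p, q) = (if p = q \<and> (j, p) \<in> S then \<one>\<^bsub>L j\<^esub> else \<zero>\<^bsub>L j\<^esub>)"
      if "j < r" "p < n j" "q < n j" for S j p q
      using that by (simp add: D_def)
    have "D S \<in> I" if "finite S" "S \<subseteq> (SIGMA j:{..<r}. {..<n j})" for S
      using that
    proof (induction S rule: finite_induct)
      case empty
      have "D {} = Z" by (rule T_eqI[OF D_closed Z_closed]) (simp add: D_entry Z_entry)
      then show ?case using I(1) by simp
    next
      case (insert x S)
      obtain i a where x: "x = (i, a)" "i < r" "a < n i" using insert.prems by auto
      interpret Li: ring "L i" using field x by auto
      define W where "W = (U i a 0 \<one>\<^bsub>L i\<^esub> \<otimes>\<^bsub>T\<^esub> E i) \<otimes>\<^bsub>T\<^esub> U i 0 a \<one>\<^bsub>L i\<^esub>"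
      have WI: "W \<in> I" unfolding W_def using x by (intro I(3) U_closed) auto
      have W1: "U i a 0 \<one>\<^bsub>L i\<^esub> \<otimes>\<^bsub>T\<^esub> E i \<in> carrier T" using x by (intro mult_closed U_closed E_closed) auto
      have W_closed: "W \<in> carrier T" unfolding W_def using x by (intro mult_closed[OF W1] U_closed) auto
      have W_entry: "W j (p, q) = (if j = i \<and> p = a \<and> q = a then \<one>\<^bsub>L j\<^esub> else \<zero>\<^bsub>L j\<^esub>)"
        if "j < r" "p < n j" "q < n j" for j p q
        using that x nL(1)[OF x(2)] W1 U_closed[of i] E_closed[OF x(2)]
        by (auto simp: W_def U_right U_left E_def U_entry)
      have "D (insert x S) = W \<oplus>\<^bsub>T\<^esub> D S"
      proof (rule T_eqI[OF D_closed add_closed[OF W_closed D_closed]])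
        fix j p q assume j: "j < r" "p < n j" "q < n j"
        interpret Lj: ring "L j" using field j by auto
        show "D (insert x S) j (p, q) = (W \<oplus>\<^bsub>T\<^esub> D S) j (p, q)"
          using j x insert.hyps by (auto simp: T_add D_entry W_entry)
      qed
      then show ?case using I(2)[OF WI] insert by auto
    qed
    from this[of "SIGMA j:{..<r}. {..<n j}"] have "D (SIGMA j:{..<r}. {..<n j}) \<in> I" by auto
    moreover have "D (SIGMA j:{..<r}. {..<n j}) = \<one>\<^bsub>T\<^esub>"
      unfolding D_def T_def direct_sum_algebra_def matrix_algebra_def
      by (auto intro!: restrict_ext)
    ultimately show ?thesis by simp
  qed
  have hT: "h \<in> ring_iso A T" using h by (simp add: T_def)
  have hb: "bij_betw h (carrier A) (carrier T)" using hT by (simp add: ring_iso_def)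
  have hm: "h (x \<otimes>\<^bsub>A\<^esub> y) = h x \<otimes>\<^bsub>T\<^esub> h y" and ha: "h (x \<oplus>\<^bsub>A\<^esub> y) = h x \<oplus>\<^bsub>T\<^esub> h y"
    if "x \<in> carrier A" "y \<in> carrier A" for x y
    using that hT ring_hom_mult[of h A T x y] ring_hom_add[of h A T x y] by (auto simp: ring_iso_def)
  have h1: "h \<one>\<^bsub>A\<^esub> = \<one>\<^bsub>T\<^esub>" using hT ring_hom_one[of h A T] by (auto simp: ring_iso_def)
  have hc: "h x \<in> carrier T" if "x \<in> carrier A" for x using hb that by (auto simp: bij_betw_def)
  have hinj: "x = y" if "h x = h y" "x \<in> carrier A" "y \<in> carrier A" for x y
    using hb that by (auto simp: bij_betw_def inj_on_def)
  define k where "k = inv_into (carrier A) h"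
  have kc: "k x \<in> carrier A" and hk: "h (k x) = x" if "x \<in> carrier T" for x
    using hb that unfolding k_def by (metis bij_betw_def inv_into_into, metis bij_betw_inv_into_right)
  have A_mult: "x \<otimes>\<^bsub>A\<^esub> y \<in> carrier A" if "x \<in> carrier A" "y \<in> carrier A" for x y
  proof -
    interpret H: group H by fact
    show ?thesis by (auto simp: A_def group_algebra_def intro!: sum.neutral)
  qed
  have A0: "\<zero>\<^bsub>A\<^esub> \<in> carrier A" "\<zero>\<^bsub>A\<^esub> \<oplus>\<^bsub>A\<^esub> \<zero>\<^bsub>A\<^esub> = \<zero>\<^bsub>A\<^esub>" "\<one>\<^bsub>A\<^esub> \<in> carrier A"
    using group.is_monoid[OF assms(2)] by (auto simp: A_def group_algebra_def)
  have A_add: "x \<oplus>\<^bsub>A\<^esub> y \<in> carrier A" if "x \<in> carrier A" "y \<in> carrier A" for x y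
    using that by (simp add: A_def group_algebra_def)
  have h0: "h \<zero>\<^bsub>A\<^esub> = Z"
  proof (rule T_eqI)
    show "h \<zero>\<^bsub>A\<^esub> \<in> carrier T" by (rule hc[OF A0(1)])
    fix i p q assume i: "i < r" "p < n i" "q < n i"
    interpret Li: ring "L i" using field i by auto
    have "h \<zero>\<^bsub>A\<^esub> = h \<zero>\<^bsub>A\<^esub> \<oplus>\<^bsub>T\<^esub> h \<zero>\<^bsub>A\<^esub>" using ha[OF A0(1) A0(1)] A0(2) by simp
    then have "h \<zero>\<^bsub>A\<^esub> i (p, q) = h \<zero>\<^bsub>A\<^esub> i (p, q) \<oplus>\<^bsub>L i\<^esub> h \<zero>\<^bsub>A\<^esub> i (p, q)"
      using T_add[OF i] by metis
    then show "h \<zero>\<^bsub>A\<^esub> i (p, q) = Z i (p, q)"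
      using car[OF hc[OF A0(1)] i] Z_entry[OF i] Li.add.l_cancel_one'  by metis
  qed (rule Z_closed)
  show thesis
  proof (rule that[of r "\<lambda>i. k (E i)"])
    show "k (E i) \<in> carrier A" if "i < r" for i using kc[OF E_closed[OF that]] .
    show "k (E i) \<otimes>\<^bsub>A\<^esub> k (E i) = k (E i)" if "i < r" for i
      using that by (intro hinj) (simp_all add: hm kc hk E_closed A_mult EE)
    show "(k (E i) \<otimes>\<^bsub>A\<^esub> a) \<otimes>\<^bsub>A\<^esub> k (E j) = \<zero>\<^bsub>A\<^esub>" if "i < r" "j < r" "i \<noteq> j" "a \<in> carrier A" for i j a
      using that by (intro hinj) (simp_all add: hm kc hk E_closed A_mult EXE hc h0 A0)
    show "((k (E i) \<otimes>\<^bsub>A\<^esub> a) \<otimes>\<^bsub>A\<^esub> k (E i)) \<otimes>\<^bsub>A\<^esub> ((k (E i) \<otimes>\<^bsub>A\<^esub> b) \<otimes>\<^bsub>A\<^esub> k (E i)) =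
       ((k (E i) \<otimes>\<^bsub>A\<^esub> b) \<otimes>\<^bsub>A\<^esub> k (E i)) \<otimes>\<^bsub>A\<^esub> ((k (E i) \<otimes>\<^bsub>A\<^esub> a) \<otimes>\<^bsub>A\<^esub> k (E i))"
      if "i < r" "a \<in> carrier A" "b \<in> carrier A" for i a b
    proof -
      interpret Li: cring "L i" using field that by auto
      show ?thesis using that nL car[OF hc, of _ i 0 0]
        by (intro hinj) (simp_all add: hm kc hk E_closed A_mult EXE hc UU Li.m_comm)
    qed
    show "\<exists>b\<in>carrier A. b \<otimes>\<^bsub>A\<^esub> ((k (E i) \<otimes>\<^bsub>A\<^esub> a) \<otimes>\<^bsub>A\<^esub> k (E i)) = k (E i)"
      if ia: "i < r" "a \<in> carrier A" "(k (E i) \<otimes>\<^bsub>A\<^esub> a) \<otimes>\<^bsub>A\<^esub> k (E i) \<noteq> \<zero>\<^bsub>A\<^esub>" for i a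
    proof -
      have eq: "h ((k (E i) \<otimes>\<^bsub>A\<^esub> a) \<otimes>\<^bsub>A\<^esub> k (E i)) = (E i \<otimes>\<^bsub>T\<^esub> h a) \<otimes>\<^bsub>T\<^esub> E i"
        using that by (simp add: hm kc hk E_closed A_mult)
      have c: "(k (E i) \<otimes>\<^bsub>A\<^esub> a) \<otimes>\<^bsub>A\<^esub> k (E i) \<in> carrier A"
        using that by (simp add: kc E_closed A_mult)
      then have "(E i \<otimes>\<^bsub>T\<^esub> h a) \<otimes>\<^bsub>T\<^esub> E i \<noteq> Z"
        using that(3) hinj[OF _ c A0(1)] eq h0 by auto
      then obtain y where y: "y \<in> carrier T" "y \<otimes>\<^bsub>T\<^esub> ((E i \<otimes>\<^bsub>T\<^esub> h a) \<otimes>\<^bsub>T\<^esub> E i) = E i"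
        using EXE_ne[OF ia(1) hc[OF ia(2)]] by blast
      show ?thesis
        by (rule bexI[of _ "k y"], rule hinj)
          (use y that c in \<open>simp_all add: hm[of "k y"] eq kc hk A_mult E_closed\<close>)
    qed
    fix I assume I: "\<zero>\<^bsub>A\<^esub> \<in> I" "\<And>x y. x \<in> I \<Longrightarrow> y \<in> I \<Longrightarrow> x \<oplus>\<^bsub>A\<^esub> y \<in> I"
       "\<And>i a b. i < r \<Longrightarrow> a \<in> carrier A \<Longrightarrow> b \<in> carrier A \<Longrightarrow> (a \<otimes>\<^bsub>A\<^esub> k (E i)) \<otimes>\<^bsub>A\<^esub> b \<in> I"
    have "\<one>\<^bsub>T\<^esub> \<in> h ` (I \<inter> carrier A)"
    proof (rule T_one)
      show "Z \<in> h ` (I \<inter> carrier A)" using I(1) A0 h0 by force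
      show "x \<oplus>\<^bsub>T\<^esub> y \<in> h ` (I \<inter> carrier A)" if xy: "x \<in> h ` (I \<inter> carrier A)" "y \<in> h ` (I \<inter> carrier A)" for x y
      proof -
        obtain x' y' where "x = h x'" "y = h y'" "x' \<in> I" "y' \<in> I" "x' \<in> carrier A" "y' \<in> carrier A"
          using xy by blast
        then have "x \<oplus>\<^bsub>T\<^esub> y = h (x' \<oplus>\<^bsub>A\<^esub> y')" "x' \<oplus>\<^bsub>A\<^esub> y' \<in> I \<inter> carrier A"
          using ha I(2) A_add by auto
        then show ?thesis by blast
      qed
      fix i a b assume i: "i < r" and ab: "a \<in> carrier T" "b \<in> carrier T"
      have "(a \<otimes>\<^bsub>T\<^esub> E i) \<otimes>\<^bsub>T\<^esub> b = h ((k a \<otimes>\<^bsub>A\<^esub> k (E i)) \<otimes>\<^bsub>A\<^esub> k b)"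
        using i ab by (simp add: hm kc hk E_closed A_mult)
      moreover have "(k a \<otimes>\<^bsub>A\<^esub> k (E i)) \<otimes>\<^bsub>A\<^esub> k b \<in> I \<inter> carrier A"
        using i ab I(3) by (simp add: kc E_closed A_mult)
      ultimately show "(a \<otimes>\<^bsub>T\<^esub> E i) \<otimes>\<^bsub>T\<^esub> b \<in> h ` (I \<inter> carrier A)" by blast
    qed
    then obtain x where "x \<in> I" "x \<in> carrier A" "h x = \<one>\<^bsub>T\<^esub>" by auto
    then show "\<one>\<^bsub>A\<^esub> \<in> I" using hinj h1 A0 by metis
  qed
qed

section \<open>The action of the group algebra of N\<close>

locale prime_cyclic_rep = valued_space s Basis v l + G: group G
  for s :: "'k::field_char_0 \<Rightarrow> 'v::ab_group_add \<Rightarrow> 'v" and Basis v l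
    and G :: "('g, 'm) monoid_scheme" (structure) +
  fixes N :: "'g set" and \<rho> :: "'g \<Rightarrow> 'v \<Rightarrow> 'v" and d :: nat and g :: 'g and k :: nat
  assumes finite_G: "finite (carrier G)" and N: "N \<lhd> G"
    and \<rho>_add: "x \<in> carrier G \<Longrightarrow> \<rho> x (u + w) = \<rho> x u + \<rho> x w"
    and \<rho>_scale: "x \<in> carrier G \<Longrightarrow> \<rho> x (s c w) = s c (\<rho> x w)"
    and \<rho>_mult: "x \<in> carrier G \<Longrightarrow> y \<in> carrier G \<Longrightarrow> \<rho> (x \<otimes> y) w = \<rho> x (\<rho> y w)"
    and \<rho>_one: "\<rho> \<one> w = w"
    and faithful: "x \<in> carrier G \<Longrightarrow> (\<And>w. \<rho> x w = w) \<Longrightarrow> x = \<one>"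
    and simple: "subspace W \<Longrightarrow> (\<And>x w. x \<in> carrier G \<Longrightarrow> w \<in> W \<Longrightarrow> \<rho> x w \<in> W) \<Longrightarrow> W = {0} \<or> W = UNIV"
    and dim_V: "dim UNIV = 2 * d" and d_pos: "d > 0"
    and d_small: "int d * v (of_nat l) < int l - 1"
    and quasisplit_N: "quasisplit (group_algebra (G\<lparr>carrier := N\<rparr>) :: ('k, 'g \<Rightarrow> 'k) module)"
    and g: "g \<in> carrier G" and g_power: "g [^] (l ^ k) = \<one>"
    and generated: "x \<in> carrier G \<Longrightarrow> \<exists>n\<in>N. \<exists>i::nat. x = n \<otimes> g [^] i"
begin

lemma N_sub: "n \<in> N \<Longrightarrow> n \<in> carrier G"
  using normal_imp_subgroup[OF N] subgroup.subset by blast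

lemma finite_N: "finite N"
  using finite_G N_sub by (meson finite_subset subsetI)

lemma N_subgroup: "subgroup N G"
  using N by (rule normal_imp_subgroup)

lemma \<rho>_0: "x \<in> carrier G \<Longrightarrow> \<rho> x 0 = 0"
  using \<rho>_scale[of x 0 0] by simp

lemma \<rho>_diff: "x \<in> carrier G \<Longrightarrow> \<rho> x (u - w) = \<rho> x u - \<rho> x w"
  by (metis \<rho>_add add_diff_cancel diff_add_cancel)

lemma \<rho>_sum: "x \<in> carrier G \<Longrightarrow> \<rho> x (sum f S) = (\<Sum>i\<in>S. \<rho> x (f i))"
  by (induction S rule: infinite_finite_induct) (auto simp: \<rho>_0 \<rho>_add)

lemma \<rho>_inv: "x \<in> carrier G \<Longrightarrow> \<rho> (inv x) (\<rho> x w) = w" "x \<in> carrier G \<Longrightarrow> \<rho> x (\<rho> (inv x) w) = w"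
  by (simp_all flip: \<rho>_mult add: \<rho>_one)

lemma \<rho>_inj: "x \<in> carrier G \<Longrightarrow> \<rho> x u = \<rho> x w \<Longrightarrow> u = w"
  by (metis \<rho>_inv(1))

lemma \<rho>_eq_0_iff: "x \<in> carrier G \<Longrightarrow> \<rho> x w = 0 \<longleftrightarrow> w = 0"
  by (metis \<rho>_inj \<rho>_0)

definition conj where "conj n = g \<otimes> n \<otimes> inv g"

lemma conj_in: "n \<in> N \<Longrightarrow> conj n \<in> N"
  unfolding conj_def using normal.inv_op_closed2[OF N g] .

lemma conj_bij: "bij_betw conj N N"
proof (rule bij_betwI[where g = "\<lambda>n. inv g \<otimes> n \<otimes> g"])
  show "conj \<in> N \<rightarrow> N" using conj_in by auto
  show "(\<lambda>n. inv g \<otimes> n \<otimes> g) \<in> N \<rightarrow> N" using normal.inv_op_closed1[OF N g] by auto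
  show "inv g \<otimes> conj n \<otimes> g = n" if "n \<in> N" for n
    using N_sub[OF that] g by (simp add: conj_def G.m_assoc) (simp flip: G.m_assoc)
  show "conj (inv g \<otimes> n \<otimes> g) = n" if "n \<in> N" for n
    using N_sub[OF that] g by (simp add: conj_def G.m_assoc) (simp flip: G.m_assoc)
qed

lemma conj_eq: "n \<in> N \<Longrightarrow> \<rho> g (\<rho> n w) = \<rho> (conj n) (\<rho> g w)"
  using N_sub[of n] g by (simp add: conj_def G.m_assoc flip: \<rho>_mult)

lemma stableI:
  assumes "\<And>w. w \<in> W \<Longrightarrow> \<rho> g w \<in> W" "\<And>n w. n \<in> N \<Longrightarrow> w \<in> W \<Longrightarrow> \<rho> n w \<in> W" "x \<in> carrier G" "w \<in> W"
  shows "\<rho> x w \<in> W"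
proof -
  obtain n i where x: "n \<in> N" "x = n \<otimes> g [^] (i::nat)" using generated[OF assms(3)] by blast
  have "\<rho> (g [^] (i::nat)) w \<in> W" for i
    using assms(4)
  proof (induction i)
    case (Suc i)
    have "\<rho> (g [^] Suc i) w = \<rho> g (\<rho> (g [^] i) w)"
      unfolding G.nat_pow_Suc2[OF g] using g by (intro \<rho>_mult) auto
    then show ?case using assms(1) Suc by simp
  qed (simp add: \<rho>_one)
  then show ?thesis using x assms(2) N_sub g by (simp add: \<rho>_mult)
qed

lemma \<rho>_g_funpow: "(\<rho> g ^^ i) w = \<rho> (g [^] i) w"
proof (induction i)
  case (Suc i)
  have "\<rho> (g [^] Suc i) w = \<rho> g (\<rho> (g [^] i) w)"
    unfolding G.nat_pow_Suc2[OF g] using g by (intro \<rho>_mult) auto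
  with Suc show ?case by simp
qed (simp add: \<rho>_one)

lemma \<rho>_g_funpow_order: "(\<rho> g ^^ (l ^ k)) w = w"
  by (simp add: \<rho>_g_funpow g_power \<rho>_one)

text \<open>The action of \<open>f\<close> as an element of \<open>K[N]\<close>, with values off
  \<open>N\<close> ignored. The image \<open>alg\<close> of \<open>K[N]\<close> among the operators
  is used in place of \<open>K[N]\<close>, so that products become compositions of
  functions.\<close>

definition op :: "('g \<Rightarrow> 'k) \<Rightarrow> 'v \<Rightarrow> 'v" where
  "op f w = (\<Sum>n\<in>N. s (f n) (\<rho> n w))"

definition alg :: "('v \<Rightarrow> 'v) set" where "alg = range op"

lemma op_cong: "(\<And>n. n \<in> N \<Longrightarrow> f n = f' n) \<Longrightarrow> op f = op f'"
  by (rule ext) (simp add: op_def)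

lemma alg_add: "a \<in> alg \<Longrightarrow> a (u + w) = a u + a w"
  by (auto simp: alg_def op_def \<rho>_add N_sub scale_right_distrib sum.distrib)

lemma alg_scale: "a \<in> alg \<Longrightarrow> a (s c w) = s c (a w)"
  by (auto simp: alg_def op_def \<rho>_scale N_sub scale_sum_right mult.commute)

lemma alg_0: "a \<in> alg \<Longrightarrow> a 0 = 0"
  using alg_scale[of a 0 0] by simp

lemma alg_plus_in: "a \<in> alg \<Longrightarrow> b \<in> alg \<Longrightarrow> (\<lambda>w. a w + b w) \<in> alg"
proof -
  assume "a \<in> alg" "b \<in> alg"
  then obtain f h where "a = op f" "b = op h" by (auto simp: alg_def)
  then have "(\<lambda>w. a w + b w) = op (\<lambda>n. f n + h n)"
    by (auto simp: op_def scale_left_distrib sum.distrib)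
  then show ?thesis by (simp add: alg_def)
qed

lemma alg_scale_in: "a \<in> alg \<Longrightarrow> (\<lambda>w. s c (a w)) \<in> alg"
proof -
  assume "a \<in> alg"
  then obtain f where "a = op f" by (auto simp: alg_def)
  then have "(\<lambda>w. s c (a w)) = op (\<lambda>n. c * f n)"
    by (auto simp: op_def scale_sum_right)
  then show ?thesis by (simp add: alg_def)
qed

lemma alg_N: "n \<in> N \<Longrightarrow> \<rho> n \<in> alg"
proof -
  assume n: "n \<in> N"
  have "\<rho> n = op (\<lambda>m. if m = n then 1 else 0)"
    using finite_N n by (auto simp: op_def if_distrib[of "\<lambda>c. s c _"] cong: if_cong)
  then show ?thesis by (simp add: alg_def)
qed

lemma alg_id: "(\<lambda>w. w) \<in> alg"
  using alg_N[OF subgroup.one_closed[OF N_subgroup]] \<rho>_one by (metis ext)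

lemma alg_stable:
  assumes "subspace W" "\<And>n w. n \<in> N \<Longrightarrow> w \<in> W \<Longrightarrow> \<rho> n w \<in> W" "a \<in> alg" "w \<in> W"
  shows "a w \<in> W"
  using assms by (auto simp: alg_def op_def intro!: subspace_sum subspace_scale)

lemma alg_comm:
  assumes "a \<in> alg" "subspace W" "lin_on W T" "w \<in> W"
    "\<And>n w. n \<in> N \<Longrightarrow> w \<in> W \<Longrightarrow> \<rho> n w \<in> W"
    "\<And>n w. n \<in> N \<Longrightarrow> w \<in> W \<Longrightarrow> T (\<rho> n w) = \<rho> n (T w)"
  shows "T (a w) = a (T w)"
proof -
  obtain f where a: "a = op f" using assms(1) by (auto simp: alg_def)
  have "T (\<Sum>n\<in>M. s (f n) (\<rho> n w)) = (\<Sum>n\<in>M. s (f n) (\<rho> n (T w))) \<and> (\<Sum>n\<in>M. s (f n) (\<rho> n w)) \<in> W"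
    if "M \<subseteq> N" for M
    using finite_subset[OF that finite_N] that
  proof (induction M rule: finite_induct)
    case empty
    then show ?case using lin_on_0[OF assms(2,3)] subspace_0[OF assms(2)] by simp
  next
    case (insert n M)
    have 1: "\<rho> n w \<in> W" "s (f n) (\<rho> n w) \<in> W"
      using insert.prems assms(4,5) subspace_scale[OF assms(2)] by auto
    then have "T (s (f n) (\<rho> n w)) = s (f n) (\<rho> n (T w))"
      using insert.prems assms(3,4,6) by (auto simp: lin_on_def)
    then show ?case using insert 1 assms(3) subspace_add[OF assms(2)] by (auto simp: lin_on_def)
  qed
  then show ?thesis by (simp add: a op_def)
qed

lemma op_mult:
  "op (f \<otimes>\<^bsub>group_algebra (G\<lparr>carrier := N\<rparr>)\<^esub> h) w = op f (op h w)"
proof -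
  let ?P = "\<lambda>x. {(y, z) \<in> N \<times> N. y \<otimes> z = x}"
  have "op (f \<otimes>\<^bsub>group_algebra (G\<lparr>carrier := N\<rparr>)\<^esub> h) w =
      (\<Sum>x\<in>N. \<Sum>p\<in>?P x. s (f (fst p) * h (snd p)) (\<rho> (fst p \<otimes> snd p) w))"
    unfolding op_def
    by (rule sum.cong[OF refl])
      (auto simp: group_algebra_def scale_sum_left case_prod_unfold intro!: sum.cong)
  also have "\<dots> = (\<Sum>x\<in>N. \<Sum>p\<in>{p \<in> N \<times> N. fst p \<otimes> snd p = x}. s (f (fst p) * h (snd p)) (\<rho> (fst p \<otimes> snd p) w))"
    by (intro sum.cong) auto
  also have "\<dots> = (\<Sum>p\<in>N \<times> N. s (f (fst p) * h (snd p)) (\<rho> (fst p \<otimes> snd p) w))"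
    by (rule sum.group) (use finite_N subgroup.m_closed[OF N_subgroup] in auto)
  also have "\<dots> = (\<Sum>y\<in>N. \<Sum>z\<in>N. s (f y * h z) (\<rho> (y \<otimes> z) w))"
    by (simp add: sum.cartesian_product case_prod_unfold)
  also have "\<dots> = op f (op h w)"
    unfolding op_def by (intro sum.cong refl) (simp add: \<rho>_sum \<rho>_scale \<rho>_mult N_sub scale_sum_right)
  finally show ?thesis .
qed

abbreviation (input) kN where "kN \<equiv> (group_algebra (G\<lparr>carrier := N\<rparr>) :: ('k, 'g \<Rightarrow> 'k) module)"

lemma alg_carrier:
  assumes "a \<in> alg"
  obtains f where "f \<in> carrier kN" "a = op f"
proof -
  obtain f where "a = op f" using assms by (auto simp: alg_def)
  then have "a = op (\<lambda>n. if n \<in> N then f n else 0)"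
    using op_cong[of f "\<lambda>n. if n \<in> N then f n else 0"] by simp
  then show thesis by (intro that[of "\<lambda>n. if n \<in> N then f n else 0"]) (simp add: group_algebra_def)
qed

lemma alg_comp: "a \<in> alg \<Longrightarrow> b \<in> alg \<Longrightarrow> (\<lambda>w. a (b w)) \<in> alg"
proof -
  assume "a \<in> alg" "b \<in> alg"
  then obtain f h where "a = op f" "b = op h" by (auto simp: alg_def)
  then have "(\<lambda>w. a (b w)) = op (f \<otimes>\<^bsub>kN\<^esub> h)" by (simp add: op_mult fun_eq_iff)
  then show ?thesis by (simp add: alg_def)
qed

text \<open>Conjugation by \<open>g\<close> permutes the normal subgroup \<open>N\<close>, so it
  carries \<open>alg\<close> to itself: the coefficients are merely relabelled.\<close>

lemma alg_conj:
  assumes "a \<in> alg"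
  obtains b where "b \<in> alg" "\<And>w. \<rho> g (a w) = b (\<rho> g w)"
proof -
  obtain f where a: "a = op f" using assms by (auto simp: alg_def)
  define c where "c = inv_into N conj"
  have c: "c (conj n) = n" if "n \<in> N" for n using conj_bij that by (simp add: c_def bij_betw_def)
  have "\<rho> g (a w) = op (\<lambda>n. f (c n)) (\<rho> g w)" for w
  proof -
    have "op (\<lambda>n. f (c n)) (\<rho> g w) = (\<Sum>n\<in>N. s (f (c (conj n))) (\<rho> (conj n) (\<rho> g w)))"
      unfolding op_def
      by (rule sum.reindex_bij_betw[OF conj_bij, symmetric, of "\<lambda>m. s (f (c m)) (\<rho> m (\<rho> g w))"])
    also have "\<dots> = (\<Sum>n\<in>N. \<rho> g (s (f n) (\<rho> n w)))"
      by (rule sum.cong) (use g in \<open>simp_all add: c conj_eq \<rho>_scale\<close>)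
    finally show ?thesis using g by (simp add: a op_def \<rho>_sum)
  qed
  then show thesis using that[of "op (\<lambda>n. f (c n))"] by (auto simp: alg_def)
qed

lemma alg_conj':
  assumes "a \<in> alg"
  obtains b where "b \<in> alg" "\<And>w. a (\<rho> g w) = \<rho> g (b w)"
proof -
  obtain f where a: "a = op f" using assms by (auto simp: alg_def)
  have "a (\<rho> g w) = \<rho> g (op (\<lambda>n. f (conj n)) w)" for w
  proof -
    have "a (\<rho> g w) = (\<Sum>n\<in>N. s (f (conj n)) (\<rho> (conj n) (\<rho> g w)))"
      unfolding a op_def
      by (rule sum.reindex_bij_betw[OF conj_bij, symmetric, of "\<lambda>m. s (f m) (\<rho> m (\<rho> g w))"])
    also have "\<dots> = (\<Sum>n\<in>N. \<rho> g (s (f (conj n)) (\<rho> n w)))"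
      by (rule sum.cong) (use g in \<open>simp_all add: conj_eq \<rho>_scale\<close>)
    finally show ?thesis using g by (simp add: op_def \<rho>_sum)
  qed
  then show thesis using that[of "op (\<lambda>n. f (conj n))"] by (auto simp: alg_def)
qed

text \<open>The relations in \<open>K[N]\<close> are pushed through \<open>op\<close>. Division
  survives although \<open>op\<close> may have a kernel: an operator \<open>e i a e i\<close> that
  is nonzero comes from a nonzero corner element, which already divides \<open>e i\<close> inside
  \<open>K[N]\<close>.\<close>

lemma block_idempotents:
  obtains r :: nat and e where
    "\<And>i. i < r \<Longrightarrow> e i \<in> alg"
    "\<And>i w. i < r \<Longrightarrow> e i (e i w) = e i w"
    "\<And>i j a w. i < r \<Longrightarrow> j < r \<Longrightarrow> i \<noteq> j \<Longrightarrow> a \<in> alg \<Longrightarrow> e i (a (e j w)) = 0"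
    "\<And>i a b w. i < r \<Longrightarrow> a \<in> alg \<Longrightarrow> b \<in> alg \<Longrightarrow>
       e i (a (e i (b (e i w)))) = e i (b (e i (a (e i w))))"
    "\<And>i a u. i < r \<Longrightarrow> a \<in> alg \<Longrightarrow> e i (a (e i u)) \<noteq> 0 \<Longrightarrow>
       \<exists>b\<in>alg. \<forall>w. b (e i (a (e i w))) = e i w"
    "\<And>U w. subspace U \<Longrightarrow> (\<And>i a b. i < r \<Longrightarrow> a \<in> alg \<Longrightarrow> b \<in> alg \<Longrightarrow> a (e i (b w)) \<in> U) \<Longrightarrow> w \<in> U"
proof -
  have H: "group (G\<lparr>carrier := N\<rparr>)" by (rule subgroup.subgroup_is_group[OF N_subgroup G.is_group])
  obtain r :: nat and e where
    e: "\<And>i. i < r \<Longrightarrow> e i \<in> carrier kN"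
    "\<And>i. i < r \<Longrightarrow> e i \<otimes>\<^bsub>kN\<^esub> e i = e i"
    "\<And>i j a. i < r \<Longrightarrow> j < r \<Longrightarrow> i \<noteq> j \<Longrightarrow> a \<in> carrier kN \<Longrightarrow> (e i \<otimes>\<^bsub>kN\<^esub> a) \<otimes>\<^bsub>kN\<^esub> e j = \<zero>\<^bsub>kN\<^esub>"
    "\<And>i a b. i < r \<Longrightarrow> a \<in> carrier kN \<Longrightarrow> b \<in> carrier kN \<Longrightarrow>
       ((e i \<otimes>\<^bsub>kN\<^esub> a) \<otimes>\<^bsub>kN\<^esub> e i) \<otimes>\<^bsub>kN\<^esub> ((e i \<otimes>\<^bsub>kN\<^esub> b) \<otimes>\<^bsub>kN\<^esub> e i) =
       ((e i \<otimes>\<^bsub>kN\<^esub> b) \<otimes>\<^bsub>kN\<^esub> e i) \<otimes>\<^bsub>kN\<^esub> ((e i \<otimes>\<^bsub>kN\<^esub> a) \<otimes>\<^bsub>kN\<^esub> e i)"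
    "\<And>i a. i < r \<Longrightarrow> a \<in> carrier kN \<Longrightarrow> (e i \<otimes>\<^bsub>kN\<^esub> a) \<otimes>\<^bsub>kN\<^esub> e i \<noteq> \<zero>\<^bsub>kN\<^esub> \<Longrightarrow>
       \<exists>b\<in>carrier kN. b \<otimes>\<^bsub>kN\<^esub> ((e i \<otimes>\<^bsub>kN\<^esub> a) \<otimes>\<^bsub>kN\<^esub> e i) = e i"
    "\<And>I. \<zero>\<^bsub>kN\<^esub> \<in> I \<Longrightarrow> (\<And>x y. x \<in> I \<Longrightarrow> y \<in> I \<Longrightarrow> x \<oplus>\<^bsub>kN\<^esub> y \<in> I) \<Longrightarrow>
       (\<And>i a b. i < r \<Longrightarrow> a \<in> carrier kN \<Longrightarrow> b \<in> carrier kN \<Longrightarrow> (a \<otimes>\<^bsub>kN\<^esub> e i) \<otimes>\<^bsub>kN\<^esub> b \<in> I) \<Longrightarrow> \<one>\<^bsub>kN\<^esub> \<in> I"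
  proof (rule quasisplit_idempotents[OF H quasisplit_N], goal_cases)
    case (1 r e)
    show ?case by (rule that) (fact 1)+
  qed
  have op0: "op \<zero>\<^bsub>kN\<^esub> w = 0" for w by (simp add: op_def group_algebra_def)
  have op1: "op \<one>\<^bsub>kN\<^esub> w = w" for w
  proof -
    have "op \<one>\<^bsub>kN\<^esub> w = (\<Sum>n\<in>N. if n = \<one> then w else 0)"
      unfolding op_def by (intro sum.cong) (auto simp: group_algebra_def \<rho>_one)
    then show ?thesis using finite_N subgroup.one_closed[OF N_subgroup] by simp
  qed
  have op_add: "op (x \<oplus>\<^bsub>kN\<^esub> y) w = op x w + op y w" for x y w
    by (simp add: op_def group_algebra_def scale_left_distrib sum.distrib)
  show thesis
  proof (rule that[of r "\<lambda>i. op (e i)"])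
    show "op (e i) \<in> alg" if "i < r" for i by (simp add: alg_def)
    show e_idem: "op (e i) (op (e i) w) = op (e i) w" if "i < r" for i w
      by (simp add: e(2)[OF that] flip: op_mult)
    show "op (e i) (a (op (e j) w)) = 0" if ij: "i < r" "j < r" "i \<noteq> j" "a \<in> alg" for i j a w
    proof -
      obtain f where f: "f \<in> carrier kN" "a = op f" using alg_carrier[OF ij(4)] by blast
      from arg_cong[OF e(3)[OF ij(1-3) f(1)], of "\<lambda>x. op x w"] show ?thesis
        by (simp add: op_mult op0 f(2))
    qed
    show "op (e i) (a (op (e i) (b (op (e i) w)))) = op (e i) (b (op (e i) (a (op (e i) w))))"
      if ab: "i < r" "a \<in> alg" "b \<in> alg" for i a b w
    proof -
      obtain f where f: "f \<in> carrier kN" "a = op f" using alg_carrier[OF ab(2)] by blast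
      obtain h where h: "h \<in> carrier kN" "b = op h" using alg_carrier[OF ab(3)] by blast
      from arg_cong[OF e(4)[OF ab(1) f(1) h(1)], of "\<lambda>x. op x w"] show ?thesis
        by (simp add: op_mult e_idem ab f h)
    qed
    show "\<exists>b\<in>alg. \<forall>w. b (op (e i) (a (op (e i) w))) = op (e i) w"
      if ia: "i < r" "a \<in> alg" "op (e i) (a (op (e i) u)) \<noteq> 0" for i a u
    proof -
      obtain f where f: "f \<in> carrier kN" "a = op f" using alg_carrier[OF ia(2)] by blast
      have "(e i \<otimes>\<^bsub>kN\<^esub> f) \<otimes>\<^bsub>kN\<^esub> e i \<noteq> \<zero>\<^bsub>kN\<^esub>"
        using ia(3) f op0 by (metis op_mult)
      then obtain b where b: "b \<otimes>\<^bsub>kN\<^esub> ((e i \<otimes>\<^bsub>kN\<^esub> f) \<otimes>\<^bsub>kN\<^esub> e i) = e i" using e(5)[OF ia(1) f(1)] by blast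
      show ?thesis
        by (rule bexI[of _ "op b"]) (use arg_cong[OF b, of op] f in \<open>auto simp: op_mult alg_def fun_eq_iff\<close>)
    qed
    show "w \<in> U" if U: "subspace U" and *: "\<And>i a b. i < r \<Longrightarrow> a \<in> alg \<Longrightarrow> b \<in> alg \<Longrightarrow> a (op (e i) (b w)) \<in> U" for U w
    proof -
      have "\<one>\<^bsub>kN\<^esub> \<in> {f. op f w \<in> U}"
        by (rule e(6)) (use subspace_0[OF U] subspace_add[OF U] * in \<open>auto simp: op0 op_add op_mult alg_def\<close>)
      then show ?thesis by (simp add: op1)
    qed
  qed
qed

text \<open>Simplicity of the module \<open>K[N] w\<close>, phrased through elements: from every
  nonzero vector of it one can return to \<open>w\<close>.\<close>

definition generator :: "'v \<Rightarrow> bool" where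
  "generator w \<longleftrightarrow> w \<noteq> 0 \<and> (\<forall>a\<in>alg. a w \<noteq> 0 \<longrightarrow> (\<exists>c\<in>alg. c (a w) = w))"

lemma generator_g:
  assumes "generator w" shows "generator (\<rho> g w)"
  unfolding generator_def
proof (intro conjI ballI impI)
  show "\<rho> g w \<noteq> 0" using assms g by (simp add: generator_def \<rho>_eq_0_iff)
  fix a assume a: "a \<in> alg" "a (\<rho> g w) \<noteq> 0"
  obtain b where b: "b \<in> alg" "\<And>w. a (\<rho> g w) = \<rho> g (b w)" using alg_conj'[OF a(1)] by blast
  have "b w \<noteq> 0" using a(2) b(2) g by (auto simp: \<rho>_0)
  then obtain c where c: "c \<in> alg" "c (b w) = w" using assms b(1) by (auto simp: generator_def)
  obtain c' where c': "c' \<in> alg" "\<And>w. \<rho> g (c w) = c' (\<rho> g w)" using alg_conj[OF c(1)] by blast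
  show "\<exists>c\<in>alg. c (a (\<rho> g w)) = \<rho> g w"
    by (rule bexI[of _ c']) (simp_all add: b(2) c c' flip: c'(2))
qed

lemma cyclic_subspace: "subspace ((\<lambda>a. a w) ` alg)"
proof (rule subspaceI)
  show "0 \<in> (\<lambda>a. a w) ` alg" using alg_scale_in[OF alg_id, of 0] by (auto intro!: image_eqI[of _ _ "\<lambda>w. s 0 w"])
  show "x + y \<in> (\<lambda>a. a w) ` alg" if "x \<in> (\<lambda>a. a w) ` alg" "y \<in> (\<lambda>a. a w) ` alg" for x y
    using that alg_plus_in by (auto intro!: image_eqI[of _ _ "\<lambda>w. _ w + _ w"])
  show "s c x \<in> (\<lambda>a. a w) ` alg" if "x \<in> (\<lambda>a. a w) ` alg" for c x
    using that alg_scale_in[of _ c] by (auto intro!: image_eqI[of _ _ "\<lambda>w. s c (_ w)"])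
qed

end

section \<open>Blocks\<close>

context prime_cyclic_rep
begin

lemma \<rho>_linear: "x \<in> carrier G \<Longrightarrow> Vector_Spaces.linear s s (\<rho> x)"
  by unfold_locales (simp_all add: \<rho>_add \<rho>_scale)

lemma \<rho>_dim_le:
  assumes x: "x \<in> carrier G" and U: "subspace U" "\<And>u. u \<in> U \<Longrightarrow> \<rho> x u \<in> U'"
  shows "dim U \<le> dim U'"
proof -
  interpret x: Vector_Spaces.linear s s "\<rho> x" by (rule \<rho>_linear[OF x])
  have inj: "inj (\<rho> x)" by (rule injI) (rule \<rho>_inj[OF x])
  obtain B where B: "B \<subseteq> U" "independent B" "card B = dim U"
    using basis_subspace_exists[OF U(1)] by metis
  have "independent (\<rho> x ` B)"
    using x.independent_injective_image[OF B(2)] inj_on_subset[OF inj subset_UNIV] by blast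
  then have "card (\<rho> x ` B) \<le> dim U'" using B(1) U(2) by (intro independent_card_le_dim) auto
  then show ?thesis using card_image[OF inj_on_subset[OF inj subset_UNIV], of B] B(3) by simp
qed

lemma dim_bound_small: "int (dim U) * v (of_nat l) < int l - 1" if "dim U \<le> d"
proof -
  have "int (dim U) * v (of_nat l) \<le> int d * v (of_nat l)"
    using that v_l by (intro mult_right_mono) auto
  with d_small show ?thesis by simp
qed

lemma d_less_l: "d < l" "2 < l"
proof -
  have "int d * 1 \<le> int d * v (of_nat l)" using v_l by (intro mult_left_mono) auto
  then have "int d < int l - 1" using d_small by simp
  then show "d < l" "2 < l" using d_pos by auto
qed

end

locale block_rep = prime_cyclic_rep s Basis v l G N \<rho> d g k
  for s :: "'k::field_char_0 \<Rightarrow> 'v::ab_group_add \<Rightarrow> 'v" and Basis v l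
    and G :: "('g, 'm) monoid_scheme" (structure) and N \<rho> d g k +
  fixes r :: nat and e :: "nat \<Rightarrow> 'v \<Rightarrow> 'v" and W0 :: "'v set"
  assumes e_alg: "i < r \<Longrightarrow> e i \<in> alg"
    and e_idem: "i < r \<Longrightarrow> e i (e i w) = e i w"
    and e_orth: "i < r \<Longrightarrow> j < r \<Longrightarrow> i \<noteq> j \<Longrightarrow> a \<in> alg \<Longrightarrow> e i (a (e j w)) = 0"
    and e_comm: "i < r \<Longrightarrow> a \<in> alg \<Longrightarrow> b \<in> alg \<Longrightarrow>
       e i (a (e i (b (e i w)))) = e i (b (e i (a (e i w))))"
    and e_div: "i < r \<Longrightarrow> a \<in> alg \<Longrightarrow> e i (a (e i u)) \<noteq> 0 \<Longrightarrow>
       \<exists>b\<in>alg. \<forall>w. b (e i (a (e i w))) = e i w"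
    and e_span: "subspace U \<Longrightarrow> (\<And>i a b. i < r \<Longrightarrow> a \<in> alg \<Longrightarrow> b \<in> alg \<Longrightarrow> a (e i (b w)) \<in> U) \<Longrightarrow> w \<in> U"
    and W0: "subspace W0" "n \<in> N \<Longrightarrow> w \<in> W0 \<Longrightarrow> \<rho> n w \<in> W0" "W0 \<noteq> {0}" "W0 \<noteq> UNIV"
begin

text \<open>The ideal generated by the \<open>e i\<close> contains the identity, so a vector killed
  by every \<open>e i a\<close> is killed by 1.\<close>

lemma detect: "u \<noteq> 0 \<Longrightarrow> \<exists>i<r. \<exists>a\<in>alg. e i (a u) \<noteq> 0"
proof (rule ccontr)
  assume u: "u \<noteq> 0" and no: "\<not> (\<exists>i<r. \<exists>a\<in>alg. e i (a u) \<noteq> 0)"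
  have "u \<in> {0}" by (rule e_span) (use no alg_0 in auto)
  with u show False by simp
qed

text \<open>Nonzero vectors of \<open>e i V\<close> generate isomorphic simple modules, hence share
  their annihilator in \<open>alg\<close>. Concretely, \<open>a y\<close> nonzero makes some corner
  element \<open>e i c a e i\<close> nonzero, hence invertible in the corner; it then acts
  injectively on all of \<open>e i V\<close>, so \<open>a x = 0\<close> would force
  \<open>x = 0\<close>.\<close>

lemma transfer:
  assumes i: "i < r" and x: "e i x = x" "x \<noteq> 0" and y: "e i y = y" and a: "a \<in> alg" "a x = 0"
  shows "a y = 0"
proof (rule ccontr)
  assume "a y \<noteq> 0"
  then obtain j c where j: "j < r" "c \<in> alg" "e j (c (a y)) \<noteq> 0" using detect by blast
  have ca: "(\<lambda>w. c (a w)) \<in> alg" using alg_comp[OF j(2) a(1)] .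
  have "j = i" using e_orth[OF j(1) i _ ca, of y] j(3) y by metis
  then have "e i (c (a (e i y))) \<noteq> 0" using j(3) y by simp
  then obtain b where b: "b \<in> alg" "\<And>w. b (e i (c (a (e i w)))) = e i w"
    using e_div[OF i ca] by blast
  from b(2)[of x] x a j b(1) show False by (simp add: alg_0 e_alg i)
qed

lemma generatorI:
  assumes i: "i < r" and x: "e i x = x" "x \<noteq> 0" shows "generator x"
  unfolding generator_def
proof (intro conjI ballI impI)
  fix a assume a: "a \<in> alg" "a x \<noteq> 0"
  then obtain j c where j: "j < r" "c \<in> alg" "e j (c (a x)) \<noteq> 0" using detect by blast
  have ca: "(\<lambda>w. c (a w)) \<in> alg" using alg_comp[OF j(2) a(1)] .
  have "j = i" using e_orth[OF j(1) i _ ca, of x] j(3) x(1) by metis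
  then have "e i (c (a (e i x))) \<noteq> 0" using j(3) x(1) by simp
  then obtain b where b: "b \<in> alg" "\<And>w. b (e i (c (a (e i w)))) = e i w"
    using e_div[OF i ca] by blast
  have "(\<lambda>w. b (e i (c w))) \<in> alg" using alg_comp[OF b(1) alg_comp[OF e_alg[OF i] j(2)]] .
  then show "\<exists>c\<in>alg. c (a x) = x" using b(2)[of x] x by (intro bexI[of _ "\<lambda>w. b (e i (c w))"]) auto
qed (rule x)

lemma generatorD: "generator w \<Longrightarrow> a \<in> alg \<Longrightarrow> a w \<noteq> 0 \<Longrightarrow> \<exists>c\<in>alg. c (a w) = w"
  by (simp add: generator_def)

text \<open>For a generator \<open>w\<close>, the type is the index of the block to which the simple
  module \<open>K[N] w\<close> belongs, that is, its isomorphism class.\<close>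

definition has_type :: "'v \<Rightarrow> nat \<Rightarrow> bool" where
  "has_type w i \<longleftrightarrow> i < r \<and> (\<exists>a\<in>alg. e i (a w) \<noteq> 0)"

lemma has_type_unique:
  assumes "generator w" "has_type w i" "has_type w j" shows "i = j"
proof (rule ccontr)
  assume ne: "i \<noteq> j"
  obtain a b where a: "i < r" "a \<in> alg" "e i (a w) \<noteq> 0" and b: "j < r" "b \<in> alg" "e j (b w) \<noteq> 0"
    using assms by (auto simp: has_type_def)
  have ea: "(\<lambda>w. e i (a w)) \<in> alg" using alg_comp[OF e_alg[OF a(1)] a(2)] .
  then obtain c where c: "c \<in> alg" "c (e i (a w)) = w" using generatorD[OF assms(1) ea a(3)] by blast
  have "e j (b (c (e i (a w)))) = 0"
    using e_orth[OF b(1) a(1) _ alg_comp[OF b(2) c(1)]] ne by auto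
  with b c show False by simp
qed

lemma has_type_ex: "w \<noteq> 0 \<Longrightarrow> \<exists>i. has_type w i"
  using detect by (auto simp: has_type_def)

text \<open>Isomorphic simple modules have isomorphic conjugates, so \<open>g\<close> acts on types.
  The operator that detects type \<open>j\<close> at \<open>g w\<close> is pulled back along
  \<open>g\<close> to an operator on \<open>e i V\<close>, and \<open>transfer\<close> moves its
  nonvanishing from \<open>w\<close> to \<open>w'\<close>.\<close>

lemma has_type_g:
  assumes w: "generator w" "has_type w i" and w': "has_type w' i" and j: "has_type (\<rho> g w) j"
  shows "has_type (\<rho> g w') j"
proof -
  obtain a a' where a: "i < r" "a \<in> alg" "e i (a w) \<noteq> 0" and a': "a' \<in> alg" "e i (a' w') \<noteq> 0"
    using w w' by (auto simp: has_type_def)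
  obtain b where b: "j < r" "b \<in> alg" "e j (b (\<rho> g w)) \<noteq> 0" using j by (auto simp: has_type_def)
  have ea: "(\<lambda>w. e i (a w)) \<in> alg" using alg_comp[OF e_alg[OF a(1)] a(2)] .
  then obtain c where c: "c \<in> alg" "c (e i (a w)) = w" using generatorD[OF w(1) ea a(3)] by blast
  obtain c' where c': "c' \<in> alg" "\<And>w. \<rho> g (c w) = c' (\<rho> g w)" using alg_conj[OF c(1)] by blast
  have "(\<lambda>w. e j (b (c' w))) \<in> alg" using alg_comp[OF e_alg[OF b(1)] alg_comp[OF b(2) c'(1)]] .
  then obtain b2 where b2: "b2 \<in> alg" "\<And>w. e j (b (c' (\<rho> g w))) = \<rho> g (b2 w)" by (rule alg_conj') blast
  have "b2 (e i (a w)) \<noteq> 0"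
    using b(3) b2(2)[of "e i (a w)"] c'(2)[of "e i (a w)"] c(2) g by (auto simp: \<rho>_0)
  then have "b2 (e i (a' w')) \<noteq> 0"
    using transfer[OF a(1) _ a'(2) _ b2(1)] e_idem[OF a(1)] by blast
  then have *: "e j (b (c' (\<rho> g (e i (a' w'))))) \<noteq> 0" using b2(2) g by (simp add: \<rho>_eq_0_iff)
  have "(\<lambda>w. e i (a' w)) \<in> alg" using alg_comp[OF e_alg[OF a(1)] a'(1)] .
  then obtain a'' where a'': "a'' \<in> alg" "\<And>w. \<rho> g (e i (a' w)) = a'' (\<rho> g w)" by (rule alg_conj) blast
  have "(\<lambda>w. b (c' (a'' w))) \<in> alg" using alg_comp[OF b(2) alg_comp[OF c'(1) a''(1)]] .
  moreover have "e j (b (c' (a'' (\<rho> g w')))) \<noteq> 0" using * a''(2) by simp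
  ultimately show ?thesis using b(1) by (auto simp: has_type_def)
qed

lemma generator_funpow:
  assumes "generator w" shows "generator ((\<rho> g ^^ m) w)"
  by (induction m) (use assms generator_g in auto)

text \<open>
  Otherwise the blocks occurring in the space are permuted freely by a nontrivial \<open>l\<close>-group, and
  the odd prime \<open>l\<close> divides \<open>dim UNIV\<close>.
\<close>
lemma g_preserves_type:
  assumes w: "generator w" and i: "has_type w i"
  shows "has_type (\<rho> g w) i"
proof -
  define q where "q = l ^ k"
  have q0: "q > 0" using l_pos by (simp add: q_def)
  define R where "R m = (\<rho> g ^^ m) w" for m
  have R_gen: "generator (R m)" for m unfolding R_def by (rule generator_funpow[OF w])
  have R0: "R m \<noteq> 0" for m using R_gen by (simp add: generator_def)
  have R_Suc: "R (Suc m) = \<rho> g (R m)" for m by (simp add: R_def)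
  have "\<exists>t. \<forall>m. has_type (R m) (t m)" by (rule choice) (use has_type_ex[OF R0] in blast)
  then obtain t where t: "\<And>m. has_type (R m) (t m)" by blast
  have t_r: "t m < r" for m using t[of m] by (simp add: has_type_def)
  have t_eqI: "t m = j" if "has_type (R m) j" for m j using has_type_unique[OF R_gen t that] .
  have t_step: "t (Suc m) = t (Suc n)" if "t m = t n" for m n
  proof -
    have n: "has_type (R n) (t m)" using t[of n] that by simp
    have "has_type (\<rho> g (R m)) (t (Suc m))" using t[of "Suc m"] by (simp only: R_Suc)
    from has_type_g[OF R_gen t n this] have "has_type (R (Suc n)) (t (Suc m))" by (simp only: R_Suc)
    then show ?thesis by (rule t_eqI[symmetric])
  qed
  have t_add: "t (m + j) = t (n + j)" if "t m = t n" for m n j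
  proof (induction j)
    case (Suc j)
    then show ?case using t_step[OF Suc] by simp
  qed (simp add: that)
  have t_q: "t q = t 0"
    by (rule t_eqI) (use t[of 0] in \<open>simp add: R_def q_def \<rho>_g_funpow_order\<close>)
  \<comment> \<open>The next type depends only on the present one (\<open>t_step\<close>) and
    \<open>t q = t 0\<close>, so \<open>t\<close> is purely periodic; \<open>p\<close> is the length
    of the orbit and divides \<open>q\<close>.\<close>
  define p where "p = (LEAST p. 0 < p \<and> t p = t 0)"
  have p: "0 < p" "t p = t 0"
    using LeastI[of "\<lambda>p. 0 < p \<and> t p = t 0" q] q0 t_q by (auto simp: p_def)
  have p_min: "t j \<noteq> t 0" if "0 < j" "j < p" for j
    using that not_less_Least[of j "\<lambda>p. 0 < p \<and> t p = t 0"] by (auto simp: p_def)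
  have t_p: "t (m + p * j) = t m" for m j
  proof (induction j)
    case (Suc j)
    have "t (m + p * Suc j) = t (p + (m + p * j))" by (simp add: ac_simps)
    also have "\<dots> = t (0 + (m + p * j))" using t_add[OF p(2)] .
    finally show ?case using Suc by simp
  qed simp
  have t_inj: "t a \<noteq> t b" if "a < b" "b < p" for a b
  proof
    assume "t a = t b"
    from t_add[OF this, of "p - a"] have "t p = t (b - a + p * 1)" using that by simp
    with t_p[of "b - a" 1] p(2) p_min[of "b - a"] that show False by simp
  qed
  have "p dvd q"
  proof -
    have "t (q mod p) = t q" using t_p[of "q mod p" "q div p"] by (simp add: add.commute)
    then have "q mod p = 0" using p_min[of "q mod p"] t_q p(1) by (metis bot_nat_0.not_eq_extremum mod_less_divisor)
    then show ?thesis by (simp add: dvd_eq_mod_eq_0)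
  qed
  then obtain j where j: "p = l ^ j" using prime_l divides_primepow_nat unfolding q_def by blast
  have "j = 0"
  proof (rule ccontr)
    assume "j \<noteq> 0"
    then have lp: "l dvd p" by (simp add: j)
    \<comment> \<open>The isotypic component of type \<open>t m\<close>: the vectors on which all
      other blocks vanish.\<close>
    define U where "U m = {u. \<forall>i<r. i \<noteq> t m \<longrightarrow> (\<forall>a\<in>alg. e i (a u) = 0)}" for m
    have U_sub: "subspace (U m)" for m
      by (rule subspaceI) (auto simp: U_def alg_0 alg_add alg_scale e_alg)
    have U_alg: "b u \<in> U m" if "u \<in> U m" "b \<in> alg" for u b m
      unfolding U_def
    proof (intro CollectI allI impI ballI)
      fix i a assume i: "i < r" "i \<noteq> t m" and a: "a \<in> alg"
      have "\<forall>c\<in>alg. e i (c u) = 0" using that(1) i by (auto simp: U_def)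
      from bspec[OF this alg_comp[OF a that(2)]] show "e i (a (b u)) = 0" .
    qed
    have U_g: "\<rho> g u \<in> U (Suc m)" if u: "u \<in> U m" for u m
      unfolding U_def
    proof (intro CollectI allI impI ballI)
      fix i a assume i: "i < r" "i \<noteq> t (Suc m)" and a: "a \<in> alg"
      obtain b where b: "b \<in> alg" "\<And>w. e i (a (\<rho> g w)) = \<rho> g (b w)"
        by (rule alg_conj'[OF alg_comp[OF e_alg[OF i(1)] a]]) blast
      obtain a0 where a0: "a0 \<in> alg" "e (t m) (a0 (R m)) \<noteq> 0" using t[of m] by (auto simp: has_type_def)
      \<comment> \<open>By \<open>e_span\<close> it is enough that \<open>b\<close>, the pullback of
        \<open>e i a\<close> along \<open>g\<close>, kills all \<open>a' (e i' (b' u))\<close>. Only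
        \<open>i' = t m\<close> contributes. There \<open>transfer\<close> compares with the vector
        from \<open>R m\<close>, whose image under \<open>g\<close> has type
        \<open>t (Suc m)\<close> and is therefore killed by \<open>e i a\<close>.\<close>
      have "u \<in> {w. b w = 0}"
      proof (rule e_span)
        show "subspace {w. b w = 0}"
          by (rule subspaceI) (auto simp: alg_0 alg_add alg_scale b)
        fix i' a' b' assume *: "i' < r" "a' \<in> alg" "b' \<in> alg"
        show "a' (e i' (b' u)) \<in> {w. b w = 0}"
        proof (cases "i' = t m")
          case False
          then show ?thesis using u * b by (auto simp: U_def alg_0)
        next
          case True
          let ?u = "e i' (a0 (R m))"
          have "(\<lambda>w. a' (e i' (a0 w))) \<in> alg" using alg_comp[OF *(2) alg_comp[OF e_alg[OF *(1)] a0(1)]] .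
          then obtain a2 where a2: "a2 \<in> alg" "\<And>w. \<rho> g (a' (e i' (a0 w))) = a2 (\<rho> g w)" by (rule alg_conj) blast
          have "e i ((\<lambda>w. a (a2 w)) (R (Suc m))) = 0"
            using has_type_unique[OF R_gen t, of "Suc m" i] i alg_comp[OF a a2(1)]
            unfolding has_type_def by metis
          then have "\<rho> g (b (a' ?u)) = 0" by (simp add: R_Suc flip: b(2) a2(2))
          then have "b (a' ?u) = 0" using g by (simp add: \<rho>_eq_0_iff)
          then have "b (a' (e i' (b' u))) = 0"
            using transfer[OF *(1) e_idem[OF *(1)] _ e_idem[OF *(1)] alg_comp[OF b(1) *(2)]] a0(2) True by blast
          then show ?thesis by simp
        qed
      qed
      then show "e i (a (\<rho> g u)) = 0" using b g by (simp add: \<rho>_0)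
    qed
    have U_p: "U (m + p) = U m" for m using t_p[of m 1] by (simp add: U_def)
    have dim_step: "dim (U m) \<le> dim (U (Suc m))" for m by (rule \<rho>_dim_le[OF g U_sub U_g])
    have dim_mono: "dim (U m) \<le> dim (U (m + n))" for m n
      by (induction n) (use dim_step order.trans in auto)
    have dim_U: "dim (U m) = dim (U 0)" if "m \<le> p" for m
      using dim_mono[of 0 m] dim_mono[of m "p - m"] U_p[of 0] that by simp
    \<comment> \<open>\<open>F m\<close> is the sum of the components \<open>U j\<close> with
      \<open>j < m\<close>. It is direct because the types of one orbit are distinct, and its
      summands have equal dimension because \<open>g\<close> permutes them cyclically. Being
      \<open>G\<close>-stable, \<open>F p\<close> is everything, so \<open>p\<close> divides
      \<open>2 * d\<close>.\<close>
    define F where "F = rec_nat {0::'v} (\<lambda>m S. {x + y | x y. x \<in> S \<and> y \<in> U m})"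
    have F_0: "F 0 = {0}" and F_Suc: "F (Suc m) = {x + y | x y. x \<in> F m \<and> y \<in> U m}" for m
      by (simp_all add: F_def)
    have F_sub: "subspace (F m)" for m
      by (induction m) (auto simp: F_0 F_Suc intro!: subspace_sums U_sub)
    have F_ann: "e i (a u) = 0" if "u \<in> F m" "i < r" "\<And>j. j < m \<Longrightarrow> i \<noteq> t j" "a \<in> alg" for u m i a
      using that(1,3)
    proof (induction m arbitrary: u)
      case (Suc m)
      then obtain x y where xy: "u = x + y" "x \<in> F m" "y \<in> U m" by (auto simp: F_Suc)
      have "e i (a x) = 0" using Suc.IH[OF xy(2)] Suc.prems(2) by auto
      moreover have "e i (a y) = 0" using xy(3) Suc.prems(2)[of m] that(2,4) by (auto simp: U_def)
      ultimately show ?case by (simp add: xy alg_add that e_alg)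
    qed (simp add: F_0 alg_0 that e_alg)
    have disj: "F m \<inter> U m = {0}" if "m < p" for m
    proof -
      have "u = 0" if u: "u \<in> F m" "u \<in> U m" for u
      proof (rule ccontr)
        assume "u \<noteq> 0"
        then obtain i a where ia: "i < r" "a \<in> alg" "e i (a u) \<noteq> 0" using detect by blast
        then have "i = t m" using u(2) by (auto simp: U_def)
        then have "e i (a u) = 0" using F_ann[OF u(1) ia(1) _ ia(2)] t_inj \<open>m < p\<close> by metis
        with ia show False by simp
      qed
      then show ?thesis using subspace_0[OF F_sub] subspace_0[OF U_sub] by blast
    qed
    have dim_F: "dim (F m) = m * dim (U 0)" if "m \<le> p" for m
      using that
    proof (induction m)
      case (Suc m)
      have "dim (F (Suc m)) + dim (F m \<inter> U m) = dim (F m) + dim (U m)"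
        unfolding F_Suc by (rule dim_sums_Int[OF F_sub U_sub])
      then show ?case using Suc disj[of m] dim_U[of m] by simp
    qed (simp add: F_0)
    have U_F: "U m \<subseteq> F n" if "m < n" for m n
      using that
    proof (induction n)
      case (Suc n)
      show ?case
      proof
        fix u assume u: "u \<in> U m"
        have "u + 0 \<in> F (Suc n)" if "u \<in> F n" using that subspace_0[OF U_sub] unfolding F_Suc by blast
        moreover have "0 + u \<in> F (Suc n)" if "m = n" using that u subspace_0[OF F_sub] unfolding F_Suc by blast
        ultimately show "u \<in> F (Suc n)" using Suc u by (cases "m = n") auto
      qed
    qed simp
    have F_stable: "f u \<in> F p" if "u \<in> F n" "n \<le> p" "\<And>x y. f (x + y) = f x + f y" "f 0 = 0"
      "\<And>m u. m < p \<Longrightarrow> u \<in> U m \<Longrightarrow> f u \<in> F p" for u n f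
      using that(1,2)
    proof (induction n arbitrary: u)
      case 0
      then show ?case using that(4) subspace_0[OF F_sub] by (simp add: F_0)
    next
      case (Suc n)
      then obtain x y where xy: "u = x + y" "x \<in> F n" "y \<in> U n" by (auto simp: F_Suc)
      have "f x \<in> F p" "f y \<in> F p" using Suc.IH[OF xy(2)] Suc.prems(2) that(5)[of n y] xy(3) by auto
      then show ?case using subspace_add[OF F_sub] by (simp add: xy(1) that(3))
    qed
    have "F p = {0} \<or> F p = UNIV"
    proof (rule simple[OF F_sub], rule stableI)
      fix u assume u: "u \<in> F p"
      have "\<rho> g u \<in> F p" if "m < p" "u \<in> U m" for m u
      proof (cases "Suc m < p")
        case True
        then show ?thesis using U_g[OF that(2)] U_F by blast
      next
        case False
        then have "Suc m = 0 + p" using that by simp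
        then have "U (Suc m) = U 0" using U_p by metis
        then show ?thesis using U_g[OF that(2)] U_F[OF p(1)] by blast
      qed
      from F_stable[OF u le_refl \<rho>_add[OF g] \<rho>_0[OF g] this] show "\<rho> g u \<in> F p" .
      fix n assume n: "n \<in> N"
      have "\<rho> n u \<in> F p" if "m < p" "u \<in> U m" for m u
        using U_alg[OF that(2) alg_N[OF n]] U_F[OF that(1)] by blast
      from F_stable[OF u le_refl \<rho>_add[OF N_sub[OF n]] \<rho>_0[OF N_sub[OF n]] this] show "\<rho> n u \<in> F p" .
    qed
    moreover have "R 0 \<in> F p"
    proof -
      have "R 0 \<in> U 0" using has_type_unique[OF R_gen t, of 0] unfolding U_def has_type_def by blast
      then show ?thesis using U_F[OF p(1)] by blast
    qed
    ultimately have "F p = UNIV" using R0[of 0] by auto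
    then have "2 * d = p * dim (U 0)" using dim_F[of p] dim_V by simp
    then have "l dvd 2 * d" using lp by simp
    then have "l dvd 2 \<or> l dvd d" using prime_l by (simp add: prime_dvd_mult_iff)
    then show False using d_less_l d_pos by (auto dest!: dvd_imp_le)
  qed
  then have "p = 1" by (simp add: j)
  then have "t 1 = t 0" using p by simp
  moreover have "t 0 = i" using i by (intro t_eqI) (simp add: R_def)
  ultimately show ?thesis using t[of 1] by (simp add: R_def)
qed

end

section \<open>Intertwiners\<close>

context fd_space
begin

lemma lin_on_image_subspace:
  assumes W: "subspace W" and T: "lin_on W T"
  shows "subspace (T ` W)"
proof (rule subspaceI)
  show "0 \<in> T ` W" using lin_on_0[OF W T] subspace_0[OF W] by force
  show "a + b \<in> T ` W" if ab: "a \<in> T ` W" "b \<in> T ` W" for a b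
  proof -
    obtain a' b' where "a' \<in> W" "b' \<in> W" "a = T a'" "b = T b'" using ab by blast
    then have "a + b = T (a' + b')" "a' + b' \<in> W" using T subspace_add[OF W] by (auto simp: lin_on_def)
    then show ?thesis by blast
  qed
  show "scale c a \<in> T ` W" if a: "a \<in> T ` W" for c a
  proof -
    obtain a' where "a' \<in> W" "a = T a'" using a by blast
    then have "scale c a = T (scale c a')" "scale c a' \<in> W" using T subspace_scale[OF W] by (auto simp: lin_on_def)
    then show ?thesis by blast
  qed
qed

lemma lin_on_inv_into:
  assumes W: "subspace W" and T: "lin_on W T" and bij: "bij_betw T W W"
  shows "lin_on W (inv_into W T)"
proof -
  have inv: "inv_into W T a \<in> W" "T (inv_into W T a) = a" if "a \<in> W" for a
    using that bij by (metis bij_betw_def inv_into_into, metis bij_betw_inv_into_right)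
  have inv': "inv_into W T (T a) = a" if "a \<in> W" for a
    using that bij by (metis bij_betw_inv_into_left)
  show ?thesis
    unfolding lin_on_def
  proof (intro conjI ballI allI)
    fix a b assume ab: "a \<in> W" "b \<in> W"
    have "T (inv_into W T a + inv_into W T b) = a + b" using T inv ab by (auto simp: lin_on_def)
    then show "inv_into W T (a + b) = inv_into W T a + inv_into W T b"
      using inv'[of "inv_into W T a + inv_into W T b"] inv ab subspace_add[OF W] by metis
  next
    fix c a assume a: "a \<in> W"
    have "T (scale c (inv_into W T a)) = scale c a" using T inv a by (auto simp: lin_on_def)
    then show "inv_into W T (scale c a) = scale c (inv_into W T a)"
      using inv'[of "scale c (inv_into W T a)"] inv a subspace_scale[OF W] by metis
  qed (rule inv)
qed

end

lemma (in prime_cyclic_rep) conj_surj: "n \<in> N \<Longrightarrow> \<exists>m\<in>N. conj m = n"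
proof -
  assume "n \<in> N"
  moreover have "conj ` N = N" using conj_bij by (rule bij_betw_imp_surj_on)
  ultimately show ?thesis by (metis imageE)
qed

text \<open>With \<open>W\<close> the module generated by \<open>w0\<close>, the vector
  \<open>w1\<close> lies in \<open>g W\<close> and, like \<open>w0\<close>, in \<open>e i V\<close>.
  So \<open>w0\<close> and \<open>w1\<close> have the same annihilator, and sending
  \<open>a w1\<close> to \<open>a w0\<close> is an \<open>N\<close>-isomorphism from
  \<open>g W\<close> to \<open>W\<close>.\<close>

locale intertwined_rep = block_rep s Basis v l G N \<rho> d g k r e W0
  for s :: "'k::field_char_0 \<Rightarrow> 'v::ab_group_add \<Rightarrow> 'v" and Basis v l
    and G :: "('g, 'm) monoid_scheme" (structure) and N \<rho> d g k r e W0 +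
  fixes i :: nat and w0 w1 :: 'v and b1 :: "'v \<Rightarrow> 'v"
  assumes i: "i < r" and w0: "e i w0 = w0" "w0 \<noteq> 0"
    and b1: "b1 \<in> alg" and w1_def: "w1 = e i (b1 (\<rho> g w0))" and w1_nz: "w1 \<noteq> 0"
begin

definition W where "W = (\<lambda>a. a w0) ` alg"

lemma W_sub: "subspace W" unfolding W_def by (rule cyclic_subspace)

lemma w0_in: "w0 \<in> W" unfolding W_def by (rule image_eqI[OF _ alg_id]) simp

lemma W_alg: "a \<in> alg \<Longrightarrow> w \<in> W \<Longrightarrow> a w \<in> W"
  using alg_comp[of a] by (force simp: W_def)

lemma W_N: "n \<in> N \<Longrightarrow> w \<in> W \<Longrightarrow> \<rho> n w \<in> W"
  by (rule W_alg[OF alg_N])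

lemma w1: "e i w1 = w1"
  using e_idem[OF i] by (simp add: w1_def)

lemma w0_generator: "generator w0"
  by (rule generatorI[OF i w0])

lemma W_back: "w \<in> W \<Longrightarrow> w \<noteq> 0 \<Longrightarrow> \<exists>c\<in>alg. c w = w0"
  using generatorD[OF w0_generator] by (auto simp: W_def)

lemma W_simple:
  assumes U: "subspace U" "U \<subseteq> W" "\<And>n u. n \<in> N \<Longrightarrow> u \<in> U \<Longrightarrow> \<rho> n u \<in> U" and u: "u \<in> U" "u \<noteq> 0"
  shows "U = W"
proof
  obtain c where c: "c \<in> alg" "c u = w0" using W_back u U(2) by blast
  then have "w0 \<in> U" using alg_stable[OF U(1,3) c(1) u(1)] by simp
  then show "W \<subseteq> U" using alg_stable[OF U(1,3)] by (auto simp: W_def)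
qed (rule U(2))

lemma W_proper: "W \<noteq> UNIV"
proof
  assume W: "W = UNIV"
  obtain u where "u \<in> W0" "u \<noteq> 0" using W0(1,3) subspace_0 by blast
  then have "W0 = W" by (intro W_simple[OF W0(1) _ W0(2)]) (auto simp: W)
  then show False using W W0(4) by simp
qed

text \<open>\<open>W\<close> and \<open>g W\<close> are \<open>N\<close>-submodules and
  \<open>W\<close> is simple. If they met outside 0 they would coincide, and \<open>W\<close> would
  be a proper nonzero \<open>G\<close>-submodule. So their sum in the
  \<open>2 * d\<close>-dimensional space is direct.\<close>

lemma W_dim: "dim W \<le> d"
proof -
  interpret R: Vector_Spaces.linear s s "\<rho> g" by (rule \<rho>_linear[OF g])
  define RW where "RW = \<rho> g ` W"
  have RW: "subspace RW" unfolding RW_def by (rule R.subspace_image[OF W_sub])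
  have RW_N: "\<rho> n u \<in> RW" if n: "n \<in> N" and u: "u \<in> RW" for n u
  proof -
    obtain m where m: "m \<in> N" "conj m = n" using conj_surj n by blast
    obtain w where w: "w \<in> W" "u = \<rho> g w" using u by (auto simp: RW_def)
    then have "\<rho> n u = \<rho> g (\<rho> m w)" using conj_eq[OF m(1), of w] m(2) by simp
    then show ?thesis using W_N[OF m(1) w(1)] by (auto simp: RW_def)
  qed
  have disj: "W \<inter> RW = {0}"
  proof (rule ccontr)
    assume "W \<inter> RW \<noteq> {0}"
    then obtain u where u: "u \<in> W \<inter> RW" "u \<noteq> 0" using subspace_0[OF W_sub] subspace_0[OF RW] by blast
    have "W \<inter> RW = W"
      by (rule W_simple[OF subspace_inter[OF W_sub RW] _ _ u]) (use W_N RW_N in auto)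
    then have sub: "W \<subseteq> RW" by blast
    have "dim RW \<le> dim W"
    proof (rule \<rho>_dim_le[of "inv g"])
      fix u assume "u \<in> RW"
      then show "\<rho> (inv g) u \<in> W" using \<rho>_inv(1)[OF g] by (auto simp: RW_def)
    qed (use g RW in auto)
    from subspace_dim_equal[OF W_sub RW sub this] have "W = RW" .
    then have gW: "\<rho> g w \<in> W" if "w \<in> W" for w using that unfolding RW_def by blast
    have "W = {0} \<or> W = UNIV"
      by (rule simple[OF W_sub]) (rule stableI[OF gW W_N])
    then show False using w0_in w0 W_proper by auto
  qed
  have "dim W \<le> dim RW" by (rule \<rho>_dim_le[OF g W_sub]) (simp add: RW_def)
  moreover have "dim {x + y | x y. x \<in> W \<and> y \<in> RW} + dim (W \<inter> RW) = dim W + dim RW"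
    by (rule dim_sums_Int[OF W_sub RW])
  moreover have "dim {x + y | x y. x \<in> W \<and> y \<in> RW} \<le> 2 * d"
    unfolding dim_V[symmetric] by (rule dim_subset) simp
  ultimately show ?thesis using disj by simp
qed

lemma W_g:
  assumes "w \<in> W" shows "\<exists>a\<in>alg. \<rho> g w = a w1"
proof -
  obtain b where b: "b \<in> alg" "w = b w0" using assms by (auto simp: W_def)
  obtain b' where b': "b' \<in> alg" "\<And>w. \<rho> g (b w) = b' (\<rho> g w)" by (rule alg_conj[OF b(1)]) blast
  obtain c where c: "c \<in> alg" "c w1 = \<rho> g w0"
    using generatorD[OF generator_g[OF w0_generator] alg_comp[OF e_alg[OF i] b1]] w1_nz
    by (auto simp: w1_def)
  show ?thesis
    by (rule bexI[OF _ alg_comp[OF b'(1) c(1)]]) (simp add: b b' c)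
qed

text \<open>The intertwiner: \<open>\<rho> g\<close> from \<open>W\<close> to \<open>g W\<close>,
  followed by the isomorphism sending \<open>a w1\<close> to \<open>a w0\<close>. The choice of
  \<open>a\<close> does not matter by \<open>transfer\<close>; that is \<open>x_eq\<close>.\<close>

definition x :: "'v \<Rightarrow> 'v" where
  "x w = (SOME y. \<exists>a\<in>alg. \<rho> g w = a w1 \<and> y = a w0)"

lemma alg_minus_in: "a \<in> alg \<Longrightarrow> b \<in> alg \<Longrightarrow> (\<lambda>w. a w - b w) \<in> alg"
  using alg_plus_in[of a "\<lambda>w. s (-1) (b w)"] alg_scale_in[of b "-1"] by simp

lemma x_eq:
  assumes a: "a \<in> alg" "\<rho> g w = a w1" shows "x w = a w0"
proof -
  have "\<exists>b\<in>alg. \<rho> g w = b w1 \<and> x w = b w0"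
    unfolding x_def by (rule someI_ex) (use a in blast)
  then obtain b where b: "b \<in> alg" "\<rho> g w = b w1" "x w = b w0" by blast
  have "b w0 - a w0 = 0"
    using transfer[OF i w1 w1_nz w0(1) alg_minus_in[OF b(1) a(1)]] a b by simp
  then show ?thesis using b by simp
qed

lemma x_in: "w \<in> W \<Longrightarrow> x w \<in> W"
  using W_g[of w] x_eq[of _ w] by (auto simp: W_def)

lemma x_lin: "lin_on W x"
  unfolding lin_on_def
proof (intro conjI ballI allI)
  fix u w assume "u \<in> W" "w \<in> W"
  then obtain a b where a: "a \<in> alg" "\<rho> g u = a w1" and b: "b \<in> alg" "\<rho> g w = b w1" using W_g by metis
  have "\<rho> g (u + w) = a w1 + b w1" using a b g by (simp add: \<rho>_add)
  from x_eq[OF alg_plus_in[OF a(1) b(1)] this] show "x (u + w) = x u + x w"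
    using x_eq[OF a] x_eq[OF b] by simp
next
  fix c u assume "u \<in> W"
  then obtain a where a: "a \<in> alg" "\<rho> g u = a w1" using W_g by metis
  have "\<rho> g (s c u) = s c (a w1)" using a g by (simp add: \<rho>_scale)
  from x_eq[OF alg_scale_in[OF a(1)] this] show "x (s c u) = s c (x u)" using x_eq[OF a] by simp
qed (rule x_in)

lemma x_conj:
  assumes n: "n \<in> N" and w: "w \<in> W" shows "x (\<rho> n w) = \<rho> (conj n) (x w)"
proof -
  obtain a where a: "a \<in> alg" "\<rho> g w = a w1" using W_g[OF w] by blast
  have "\<rho> g (\<rho> n w) = \<rho> (conj n) (a w1)" using conj_eq[OF n] a by simp
  from x_eq[OF alg_comp[OF alg_N[OF conj_in[OF n]] a(1)] this] show ?thesis using x_eq[OF a] by simp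
qed

lemma x_eq_0: "w \<in> W \<Longrightarrow> x w = 0 \<Longrightarrow> w = 0"
proof -
  assume w: "w \<in> W" "x w = 0"
  obtain a where a: "a \<in> alg" "\<rho> g w = a w1" using W_g[OF w(1)] by blast
  then have "a w1 = 0" using transfer[OF i w0 w1 a(1)] x_eq[OF a] w by simp
  then show "w = 0" using a g by (simp add: \<rho>_eq_0_iff)
qed

lemma lin_bij:
  assumes T: "lin_on W T" and inj: "\<And>w. w \<in> W \<Longrightarrow> T w = 0 \<Longrightarrow> w = 0"
    and N: "\<And>n w. n \<in> N \<Longrightarrow> w \<in> W \<Longrightarrow> \<rho> n (T w) \<in> T ` W"
  shows "bij_betw T W W"
  unfolding bij_betw_def
proof
  show "inj_on T W"
  proof (rule inj_onI)
    fix a b assume "a \<in> W" "b \<in> W" "T a = T b"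
    then have "T (a - b) = 0" "a - b \<in> W" using lin_on_diff[OF W_sub T] subspace_diff[OF W_sub] by auto
    then show "a = b" using inj by fastforce
  qed
  show "T ` W = W"
  proof (rule W_simple)
    show "subspace (T ` W)" by (rule lin_on_image_subspace[OF W_sub T])
    show "T ` W \<subseteq> W" using T by (auto simp: lin_on_def)
    show "T w0 \<in> T ` W" "T w0 \<noteq> 0" using w0_in inj[of w0] w0 by auto
  qed (use N in auto)
qed

lemma x_bij: "bij_betw x W W"
proof (rule lin_bij[OF x_lin x_eq_0])
  fix n w assume n: "n \<in> N" "w \<in> W"
  obtain m where m: "m \<in> N" "conj m = n" using conj_surj n by blast
  then have "\<rho> n (x w) = x (\<rho> m w)" using x_conj[OF m(1) n(2)] by simp
  then show "\<rho> n (x w) \<in> x ` W" using W_N[OF m(1) n(2)] by simp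
qed

text \<open>The endomorphism ring \<open>End\<^sub>N W\<close>. Its members are total functions that
  count only on \<open>W\<close>, so equalities between them are asserted pointwise on
  \<open>W\<close>.\<close>

definition C :: "('v \<Rightarrow> 'v) set" where
  "C = {T. lin_on W T \<and> (\<forall>n\<in>N. \<forall>w\<in>W. T (\<rho> n w) = \<rho> n (T w))}"

lemma C_lin: "T \<in> C \<Longrightarrow> lin_on W T" and C_N: "T \<in> C \<Longrightarrow> n \<in> N \<Longrightarrow> w \<in> W \<Longrightarrow> T (\<rho> n w) = \<rho> n (T w)"
  by (auto simp: C_def)

lemma C_in: "T \<in> C \<Longrightarrow> w \<in> W \<Longrightarrow> T w \<in> W"
  using C_lin by (auto simp: lin_on_def)

lemma C_alg: "T \<in> C \<Longrightarrow> a \<in> alg \<Longrightarrow> w \<in> W \<Longrightarrow> T (a w) = a (T w)"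
  by (rule alg_comm[OF _ W_sub C_lin]) (auto intro: W_N C_N)

lemma C_ext: "T \<in> C \<Longrightarrow> T' \<in> C \<Longrightarrow> T w0 = T' w0 \<Longrightarrow> w \<in> W \<Longrightarrow> T w = T' w"
  using C_alg w0_in by (auto simp: W_def)

lemma C_e: "T \<in> C \<Longrightarrow> \<exists>b\<in>alg. T w0 = e i (b (e i w0))"
proof -
  assume T: "T \<in> C"
  then obtain b where b: "b \<in> alg" "T w0 = b w0" using C_in[OF T w0_in] by (auto simp: W_def)
  have "T w0 = e i (T w0)" using C_alg[OF T e_alg[OF i] w0_in] w0 by simp
  then show ?thesis using b w0 by auto
qed

text \<open>Here quasisplitness acts. An endomorphism is determined by its value at
  \<open>w0\<close>, which has the form \<open>e i b e i w0\<close>; composition thus corresponds to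
  multiplication in the corner of \<open>e i\<close>, and corners commute.\<close>

lemma C_comm:
  assumes T: "T \<in> C" and T': "T' \<in> C" and w: "w \<in> W" shows "T (T' w) = T' (T w)"
proof -
  have *: "S (S' w0) = e i (b' (e i (b (e i w0))))"
    if S: "S \<in> C" "S' \<in> C" "b \<in> alg" "b' \<in> alg" "S w0 = e i (b (e i w0))" "S' w0 = e i (b' (e i w0))" for S S' b b'
  proof -
    have "S (S' w0) = S (e i (b' (e i w0)))" using S by simp
    also have "\<dots> = e i (b' (e i (S w0)))"
      using C_alg[OF S(1) alg_comp[OF e_alg[OF i] alg_comp[OF S(4) e_alg[OF i]]] w0_in] .
    finally show ?thesis by (simp add: S(5) e_idem[OF i])
  qed
  obtain b b' where b: "b \<in> alg" "T w0 = e i (b (e i w0))" "b' \<in> alg" "T' w0 = e i (b' (e i w0))"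
    using C_e T T' by metis
  have 0: "T (T' w0) = T' (T w0)"
    using *[OF T T' b(1,3,2,4)] *[OF T' T b(3,1,4,2)] e_comm[OF i b(1,3)] by simp
  obtain a where a: "a \<in> alg" "w = a w0" using w by (auto simp: W_def)
  show ?thesis
    using C_alg[OF T a(1) w0_in] C_alg[OF T' a(1) w0_in] C_alg[OF T a(1) C_in[OF T' w0_in]]
      C_alg[OF T' a(1) C_in[OF T w0_in]] 0 a(2) by simp
qed

text \<open>Schur's lemma by elements: \<open>w0 = c u\<close> for some \<open>c\<close> in
  \<open>alg\<close>, so \<open>T w0 = c (T u) = 0\<close>, and \<open>w0\<close> generates
  \<open>W\<close>.\<close>

lemma C_zero:
  assumes T: "T \<in> C" and u: "u \<in> W" "u \<noteq> 0" "T u = 0" and w: "w \<in> W"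
  shows "T w = 0"
proof -
  obtain c where c: "c \<in> alg" "c u = w0" using W_back u by blast
  then have "T w0 = 0" using C_alg[OF T c(1) u(1)] u by (simp add: alg_0)
  moreover obtain a where "a \<in> alg" "w = a w0" using w by (auto simp: W_def)
  ultimately show ?thesis using C_alg[OF T _ w0_in] by (simp add: alg_0)
qed

lemma C_id: "(\<lambda>w. w) \<in> C"
  by (auto simp: C_def lin_on_def)

lemma C_scale_id: "(\<lambda>w. s c w) \<in> C"
  using subspace_scale[OF W_sub] by (auto simp: C_def lin_on_def \<rho>_scale N_sub scale_right_distrib mult.commute)

lemma C_comp: "T \<in> C \<Longrightarrow> T' \<in> C \<Longrightarrow> (\<lambda>w. T (T' w)) \<in> C"
  by (auto simp: C_def lin_on_def)

lemma C_diff: "T \<in> C \<Longrightarrow> T' \<in> C \<Longrightarrow> (\<lambda>w. T w - T' w) \<in> C"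
  using subspace_diff[OF W_sub] by (auto simp: C_def lin_on_def \<rho>_diff N_sub scale_right_diff_distrib)

lemma C_plus: "T \<in> C \<Longrightarrow> T' \<in> C \<Longrightarrow> (\<lambda>w. T w + T' w) \<in> C"
  using subspace_add[OF W_sub] by (auto simp: C_def lin_on_def \<rho>_add N_sub scale_right_distrib)

text \<open>Gives \<open>C\<close> a dimension: evaluation at \<open>w0\<close> is injective up to
  agreement on \<open>W\<close>, so this subspace of \<open>W\<close> is a copy of \<open>C\<close>,
  and its dimension is at most \<open>d\<close>.\<close>

lemma C_eval_subspace: "subspace ((\<lambda>T. T w0) ` C)"
proof (rule subspaceI)
  have I: "T w0 \<in> (\<lambda>T. T w0) ` C" if "T \<in> C" for T using that by simp
  show "0 \<in> (\<lambda>T. T w0) ` C" using I[OF C_scale_id[of 0]] by simp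
  show "a + b \<in> (\<lambda>T. T w0) ` C" if "a \<in> (\<lambda>T. T w0) ` C" "b \<in> (\<lambda>T. T w0) ` C" for a b
    using that I[OF C_plus] by auto
  show "s c a \<in> (\<lambda>T. T w0) ` C" if "a \<in> (\<lambda>T. T w0) ` C" for c a
    using that I[OF C_comp[OF C_scale_id]] by auto
qed

lemma C_funpow: "T \<in> C \<Longrightarrow> (T ^^ j) \<in> C"
  by (induction j) (use C_id C_comp in \<open>auto simp: id_def comp_def\<close>)

lemma C_inverse:
  assumes T: "T \<in> C" and u: "u \<in> W" "T u \<noteq> 0"
  obtains T' where "T' \<in> C" "\<And>w. w \<in> W \<Longrightarrow> T' (T w) = w" "\<And>w. w \<in> W \<Longrightarrow> T (T' w) = w"
proof -
  have bij: "bij_betw T W W"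
  proof (rule lin_bij[OF C_lin[OF T]])
    show "w = 0" if "w \<in> W" "T w = 0" for w using C_zero[OF T that(1) _ that(2) u(1)] u by auto
    show "\<rho> n (T w) \<in> T ` W" if n: "n \<in> N" and w: "w \<in> W" for n w
      using C_N[OF T n w] W_N[OF n w] by (metis image_eqI)
  qed
  let ?S = "inv_into W T"
  have inv: "?S a \<in> W" "T (?S a) = a" if "a \<in> W" for a
    using that bij by (metis bij_betw_def inv_into_into, metis bij_betw_inv_into_right)
  have inv': "?S (T a) = a" if "a \<in> W" for a
    using that bij by (metis bij_betw_inv_into_left)
  have "?S (\<rho> n w) = \<rho> n (?S w)" if n: "n \<in> N" and w: "w \<in> W" for n w
  proof -
    have "T (\<rho> n (?S w)) = \<rho> n w" using C_N[OF T n inv(1)[OF w]] inv(2)[OF w] by simp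
    then show ?thesis using inv'[of "\<rho> n (?S w)"] W_N[OF n inv(1)[OF w]] by simp
  qed
  then have "?S \<in> C" using lin_on_inv_into[OF W_sub C_lin[OF T] bij] by (simp add: C_def)
  then show thesis using that inv inv' by blast
qed

lemma conj_funpow: "n \<in> N \<Longrightarrow> (conj ^^ j) n = g [^] j \<otimes> n \<otimes> inv (g [^] j)"
proof (induction j)
  case (Suc j)
  have "g [^] Suc j = g \<otimes> g [^] j" by (rule G.nat_pow_Suc2[OF g])
  then show ?case using Suc g N_sub[OF Suc.prems]
    by (simp add: conj_def G.inv_mult_group G.m_assoc del: G.nat_pow_Suc)
qed (use N_sub in simp)

lemma x_funpow_conj:
  assumes n: "n \<in> N" "w \<in> W" shows "(x ^^ j) (\<rho> n w) = \<rho> ((conj ^^ j) n) ((x ^^ j) w)"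
proof (induction j)
  case (Suc j)
  have "(conj ^^ j) n \<in> N" using n conj_in by (induction j) auto
  moreover have "(x ^^ j) w \<in> W" using funpow_range[of W x w j] x_in n by auto
  ultimately show ?case using Suc x_conj by simp
qed simp

text \<open>\<open>x\<close> intertwines the action of \<open>N\<close> with its twist by
  \<open>conj\<close>, and the \<open>l ^ k\<close>-th iterate of \<open>conj\<close> is the
  identity because \<open>g\<close> has order dividing \<open>l ^ k\<close>.\<close>

lemma x_power_in_C: "(x ^^ (l ^ k)) \<in> C"
proof -
  have "(conj ^^ (l ^ k)) n = n" if "n \<in> N" for n
    using conj_funpow[OF that] g_power N_sub[OF that] by simp
  then show ?thesis using x_funpow_conj lin_on_funpow[OF x_lin] by (simp add: C_def)
qed

text \<open>Conjugation by \<open>x\<close> on \<open>C\<close>, transported to a subspace of \<open>W\<close> by evaluation at \<open>w0\<close>.\<close>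
lemma x_C_comm:
  assumes T: "T \<in> C" and w: "w \<in> W"
  shows "x (T w) = T (x w)"
proof -
  define xi where "xi = inv_into W x"
  have xi: "xi a \<in> W" "x (xi a) = a" if "a \<in> W" for a
    using that x_bij unfolding xi_def by (metis bij_betw_def inv_into_into, metis bij_betw_inv_into_right)
  have xi': "xi (x a) = a" if "a \<in> W" for a
    using that x_bij unfolding xi_def by (metis bij_betw_inv_into_left)
  have xi_lin: "lin_on W xi" unfolding xi_def by (rule lin_on_inv_into[OF W_sub x_lin x_bij])
  have xi_N: "xi (\<rho> (conj n) w) = \<rho> n (xi w)" if "n \<in> N" "w \<in> W" for n w
    using x_conj[OF that(1) xi(1)[OF that(2)]] xi(2)[OF that(2)] xi'[OF W_N[OF that(1) xi(1)[OF that(2)]]]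
    by simp
  define cj where "cj T = (\<lambda>w. x (T (xi w)))" for T
  have cj: "cj T \<in> C" if T: "T \<in> C" for T
  proof -
    have "lin_on W (cj T)"
      unfolding cj_def by (rule lin_on_comp[OF x_lin lin_on_comp[OF C_lin[OF T] xi_lin]])
    moreover have "cj T (\<rho> n w) = \<rho> n (cj T w)" if n: "n \<in> N" and w: "w \<in> W" for n w
    proof -
      obtain m where m: "m \<in> N" "conj m = n" using conj_surj n by blast
      then show ?thesis
        using xi_N[OF m(1) w] C_N[OF T m(1) xi(1)[OF w]] x_conj[OF m(1) C_in[OF T xi(1)[OF w]]]
        by (simp add: cj_def)
    qed
    ultimately show ?thesis by (simp add: C_def)
  qed
  define C0 where "C0 = (\<lambda>T. T w0) ` C"
  define \<tau> where "\<tau> u = (SOME T. T \<in> C \<and> T w0 = u)" for u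
  have \<tau>: "\<tau> u \<in> C" "\<tau> u w0 = u" if "u \<in> C0" for u
  proof -
    have "\<exists>T. T \<in> C \<and> T w0 = u" using that by (auto simp: C0_def)
    from someI_ex[OF this] show "\<tau> u \<in> C" "\<tau> u w0 = u" by (auto simp: \<tau>_def)
  qed
  define Y where "Y u = cj (\<tau> u) w0" for u
  have Y: "Y (T w0) = cj T w0" if T: "T \<in> C" for T
  proof -
    have u: "T w0 \<in> C0" using T by (simp add: C0_def)
    have "\<tau> (T w0) (xi w0) = T (xi w0)" by (rule C_ext[OF \<tau>(1)[OF u] T \<tau>(2)[OF u] xi(1)[OF w0_in]])
    then show ?thesis by (simp add: Y_def cj_def)
  qed
  have C0_I: "T w0 \<in> C0" if "T \<in> C" for T using that by (simp add: C0_def)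
  have C0_sub: "subspace C0" unfolding C0_def by (rule C_eval_subspace)
  have C0_W: "C0 \<subseteq> W" using C_in w0_in by (auto simp: C0_def)
  have Y_lin: "lin_on C0 Y"
    unfolding lin_on_def
  proof (intro conjI ballI allI)
    show "Y u \<in> C0" if "u \<in> C0" for u
      unfolding Y_def by (rule C0_I[OF cj[OF \<tau>(1)[OF that]]])
    show "Y (u + w) = Y u + Y w" if uw: "u \<in> C0" "w \<in> C0" for u w
    proof -
      obtain S T where S: "S \<in> C" "u = S w0" and T: "T \<in> C" "w = T w0" using uw by (auto simp: C0_def)
      have "Y (u + w) = cj (\<lambda>w. S w + T w) w0" using Y[OF C_plus[OF S(1) T(1)]] S T by simp
      also have "\<dots> = Y u + Y w"
        using x_lin C_in[OF S(1) xi(1)[OF w0_in]] C_in[OF T(1) xi(1)[OF w0_in]] Y S T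
        by (simp add: cj_def lin_on_def)
      finally show ?thesis .
    qed
    show "Y (s c u) = s c (Y u)" if u: "u \<in> C0" for c u
    proof -
      obtain S where S: "S \<in> C" "u = S w0" using u by (auto simp: C0_def)
      have "Y (s c u) = cj (\<lambda>w. s c (S w)) w0" using Y[OF C_comp[OF C_scale_id S(1)]] S by simp
      also have "\<dots> = s c (Y u)"
        using x_lin C_in[OF S(1) xi(1)[OF w0_in]] Y S by (simp add: cj_def lin_on_def)
      finally show ?thesis .
    qed
  qed
  have cj_pow: "(cj ^^ j) T w = (x ^^ j) (T ((xi ^^ j) w))" for j T w
  proof (induction j arbitrary: w)
    case (Suc j)
    then show ?case by (simp add: cj_def funpow_swap1)
  qed simp
  have cj_pow_C: "(cj ^^ j) T \<in> C" if "T \<in> C" for j T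
    by (induction j) (use that cj in auto)
  have Y_pow: "(Y ^^ j) (T w0) = (cj ^^ j) T w0" if "T \<in> C" for j T
  proof (induction j)
    case (Suc j)
    then show ?case using Y[OF cj_pow_C[OF that]] by simp
  qed simp
  have xxi: "(x ^^ j) ((xi ^^ j) w) = w \<and> (xi ^^ j) w \<in> W" if "w \<in> W" for j w
    using that
  proof (induction j arbitrary: w)
    case (Suc j)
    have "(xi ^^ j) (xi w) \<in> W" "(x ^^ j) ((xi ^^ j) (xi w)) = xi w" using Suc xi by auto
    then show ?case using xi Suc.prems by (simp add: funpow_swap1)
  qed simp
  \<comment> \<open>Conjugation by \<open>x ^ q\<close>, with \<open>q = l ^ k\<close>, is trivial,
    because \<open>x ^ q\<close> lies in the commutative ring \<open>C\<close>. So \<open>Y\<close>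
    has \<open>l\<close>-power order on a space of dimension at most \<open>d\<close>.\<close>
  have "Y (T w0) = T w0"
  proof (rule small_dim_trivial[OF C0_sub _ Y_lin])
    show "int (dim C0) * v (of_nat l) < int l - 1"
      using dim_subset[OF C0_W] W_dim by (intro dim_bound_small) simp
    show "T w0 \<in> C0" by (rule C0_I[OF T])
    fix u assume "u \<in> C0"
    then obtain S where S: "S \<in> C" "u = S w0" by (auto simp: C0_def)
    let ?q = "l ^ k"
    have "(Y ^^ ?q) u = (x ^^ ?q) (S ((xi ^^ ?q) w0))" using Y_pow[OF S(1)] S by (simp add: cj_pow)
    also have "\<dots> = S ((x ^^ ?q) ((xi ^^ ?q) w0))"
      by (rule C_comm[OF x_power_in_C S(1)]) (use xxi w0_in in blast)
    also have "\<dots> = u" using xxi[OF w0_in] S by simp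
    finally show "(Y ^^ ?q) u = u" .
  qed
  then have "cj T w0 = T w0" using Y[OF T] by simp
  from C_ext[OF cj[OF T] T this x_in[OF w]] show ?thesis by (simp add: cj_def xi'[OF w])
qed

end

context intertwined_rep
begin

lemma x_funpow_in: "w \<in> W \<Longrightarrow> (x ^^ j) w \<in> W"
  by (rule funpow_range[of W x]) (auto intro: x_in)

text \<open>A common eigenfunctional \<open>\<phi>\<close> embeds the field \<open>C\<close> into
  the closure as a subfield \<open>F\<close> and sends \<open>x\<close> to a number \<open>y\<close>
  with \<open>y ^ q\<close> in \<open>F\<close>. Dividing \<open>x\<close> by an element of
  \<open>C\<close> thus becomes the question of finding a \<open>q\<close>-th root of
  \<open>y ^ q\<close> inside \<open>F\<close>.\<close>

lemma x_scalar:
  obtains \<kappa> where "\<kappa> \<in> C" "\<And>w. w \<in> W \<Longrightarrow> x w = \<kappa> w"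
proof -
  define q where "q = l ^ k"
  define C0 where "C0 = (\<lambda>T. T w0) ` C"
  have C0_sub: "subspace C0" unfolding C0_def by (rule C_eval_subspace)
  obtain B where B: "finite B" "B \<subseteq> C0" "span B = C0" using basis_subspace_exists[OF C0_sub] by metis
  define \<tau> where "\<tau> u = (SOME T. T \<in> C \<and> T w0 = u)" for u
  have \<tau>: "\<tau> u \<in> C" "\<tau> u w0 = u" if "u \<in> C0" for u
  proof -
    have "\<exists>T. T \<in> C \<and> T w0 = u" using that by (auto simp: C0_def)
    from someI_ex[OF this] show "\<tau> u \<in> C" "\<tau> u w0 = u" by (auto simp: \<tau>_def)
  qed
  \<comment> \<open>Finitely many operators suffice: \<open>x\<close> and endomorphisms whose values
    at \<open>w0\<close> span \<open>C0\<close>. The eigenvalue property spreads to all of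
    \<open>C\<close> by linearity, in \<open>ev\<close>.\<close>
  define S where "S = insert x (\<tau> ` B)"
  have S: "T = x \<or> T \<in> C" if "T \<in> S" for T using that \<tau> B(2) by (auto simp: S_def)
  have S_lin: "lin_on W T" if "T \<in> S" for T using S[OF that] x_lin C_lin by auto
  have S_comm: "T (T' w) = T' (T w)" if "T \<in> S" "T' \<in> S" "w \<in> W" for T T' w
    using S[OF that(1)] S[OF that(2)] C_comm x_C_comm that(3) by metis
  have S_fin: "finite S" using B(1) by (simp add: S_def)
  obtain \<phi> where \<phi>: "functional_on W \<phi>" "\<exists>u\<in>W. \<phi> u \<noteq> 0"
    "\<And>T. T \<in> S \<Longrightarrow> \<exists>y. \<forall>w\<in>W. \<phi> (T w) = y * \<phi> w"
  proof (rule common_eigenfunctional[OF W_sub w0_in w0(2) S_fin], goal_cases)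
    case (1 T)
    show ?case by (rule S_lin) (fact 1)
  next
    case (2 T T' w)
    show ?case by (rule S_comm) (fact 2)+
  next
    case (3 \<phi>)
    show ?case by (rule that) (fact 3)+
  qed
  obtain y where y: "\<And>w. w \<in> W \<Longrightarrow> \<phi> (x w) = y * \<phi> w" using \<phi>(3)[of x] by (auto simp: S_def)
  obtain u where u: "u \<in> W" "\<phi> u \<noteq> 0" using \<phi>(2) by blast
  have \<phi>_scale: "\<phi> (s c w) = to_ac c * \<phi> w" if "w \<in> W" for c w
    using \<phi>(1) that by (simp add: functional_on_def)
  have \<phi>_diff: "\<phi> (a - b) = \<phi> a - \<phi> b" if "a \<in> W" "b \<in> W" for a b
    using functional_on_diff[OF W_sub \<phi>(1)] that .
  have \<phi>_0: "\<phi> 0 = 0" by (rule functional_on_0[OF W_sub \<phi>(1)])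
  have ev: "\<exists>c. \<forall>T\<in>C. T w0 = a \<longrightarrow> (\<forall>w\<in>W. \<phi> (T w) = c * \<phi> w)" if "a \<in> span B" for a
    using that
  proof (induction rule: span_induct_alt)
    case base
    show ?case
    proof (intro exI[of _ 0] ballI impI)
      fix T w assume T: "T \<in> C" "T w0 = 0" "w \<in> W"
      have "T w = 0" using C_zero[OF T(1) w0_in w0(2) T(2,3)] .
      then show "\<phi> (T w) = 0 * \<phi> w" by (simp add: \<phi>_0)
    qed
  next
    case (step c b a)
    have bC: "b \<in> C0" using step B(2) by auto
    obtain \<beta> where \<beta>: "\<And>w. w \<in> W \<Longrightarrow> \<phi> (\<tau> b w) = \<beta> * \<phi> w" using \<phi>(3)[of "\<tau> b"] step(1) by (auto simp: S_def)
    obtain \<alpha> where \<alpha>: "\<And>T w. T \<in> C \<Longrightarrow> T w0 = a \<Longrightarrow> w \<in> W \<Longrightarrow> \<phi> (T w) = \<alpha> * \<phi> w" using step(2) by blast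
    have "\<phi> (T w) = (to_ac c * \<beta> + \<alpha>) * \<phi> w" if T: "T \<in> C" "T w0 = s c b + a" and w: "w \<in> W" for T w
    proof -
      have cb: "(\<lambda>w. s c (\<tau> b w)) \<in> C" by (rule C_comp[OF C_scale_id \<tau>(1)[OF bC]])
      have "\<phi> (T w - s c (\<tau> b w)) = \<alpha> * \<phi> w"
        using \<alpha>[OF C_diff[OF T(1) cb] _ w] T(2) \<tau>(2)[OF bC] by simp
      then have "\<phi> (T w) - \<phi> (s c (\<tau> b w)) = \<alpha> * \<phi> w"
        using \<phi>_diff[OF C_in[OF T(1) w] C_in[OF cb w]] by simp
      then show ?thesis
        using \<phi>_scale[OF C_in[OF \<tau>(1)[OF bC] w]] \<beta>[OF w] by (simp add: algebra_simps)
    qed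
    then show ?case by blast
  qed
  have ev': "\<exists>c. \<forall>w\<in>W. \<phi> (T w) = c * \<phi> w" if "T \<in> C" for T
  proof -
    have "T w0 \<in> span B" using that by (simp add: B(3) C0_def)
    from ev[OF this] that show ?thesis by blast
  qed
  \<comment> \<open>The graph of the embedding of \<open>C\<close> into the closure;
    \<open>ch_0\<close> is its injectivity and \<open>F\<close> its image.\<close>
  define ch where "ch T c \<longleftrightarrow> T \<in> C \<and> (\<forall>w\<in>W. \<phi> (T w) = c * \<phi> w)" for T c
  have ch_0: "T w = 0" if Tw: "ch T 0" "w \<in> W" for T w
  proof (rule ccontr)
    assume ne: "T w \<noteq> 0"
    have T: "T \<in> C" using Tw by (simp add: ch_def)
    obtain T' where T': "T' \<in> C" "\<And>w. w \<in> W \<Longrightarrow> T (T' w) = w"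
      using C_inverse[OF T Tw(2) ne] by metis
    have "\<phi> (T (T' u)) = 0" using Tw(1) C_in[OF T'(1) u(1)] by (simp add: ch_def)
    with T'(2)[OF u(1)] u(2) show False by simp
  qed
  have ch_inv: "\<exists>T'. ch T' (inverse c) \<and> (\<forall>w\<in>W. T' (T w) = w)" if T: "ch T c" "c \<noteq> 0" for T c
  proof -
    have TC: "T \<in> C" using T by (simp add: ch_def)
    have "T u \<noteq> 0" using T u \<phi>_0 by (auto simp: ch_def)
    from C_inverse[OF TC u(1) this] obtain T' where T': "T' \<in> C" "\<And>w. w \<in> W \<Longrightarrow> T' (T w) = w"
      "\<And>w. w \<in> W \<Longrightarrow> T (T' w) = w" by metis
    have "\<phi> (T' w) = inverse c * \<phi> w" if w: "w \<in> W" for w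
    proof -
      have "\<phi> (T (T' w)) = c * \<phi> (T' w)" using T C_in[OF T'(1) w] by (simp add: ch_def)
      then have "\<phi> w = c * \<phi> (T' w)" using T'(3)[OF w] by simp
      then show ?thesis using T(2) by simp
    qed
    then show ?thesis using T' by (auto simp: ch_def)
  qed
  have ch_comp: "ch (\<lambda>w. T (T' w)) (c * c')" if "ch T c" "ch T' c'" for T T' c c'
    using that C_comp C_in[of T'] by (auto simp: ch_def)
  have ch_pow: "ch (T ^^ j) (c ^ j)" if "ch T c" for T c j
  proof (induction j)
    case 0
    then show ?case using C_id by (simp add: ch_def id_def)
  next
    case (Suc j)
    then show ?case using ch_comp[OF that Suc] by (simp add: comp_def)
  qed
  have ch_diff: "ch (\<lambda>w. T w - T' w) (c - c')" if "ch T c" "ch T' c'" for T T' c c'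
    using that C_diff C_in[of T'] C_in[of T] \<phi>_diff by (auto simp: ch_def left_diff_distrib)
  define F where "F = {c. \<exists>T. ch T c}"
  have K_F: "to_ac c \<in> F" for c
    using C_scale_id \<phi>_scale by (auto simp: F_def ch_def)
  have F: "subfield_set F"
  proof
    show "1 \<in> F" using K_F[of 1] by simp
    show "a - b \<in> F" if "a \<in> F" "b \<in> F" for a b using that unfolding F_def by (blast intro: ch_diff)
    show "a * b \<in> F" if "a \<in> F" "b \<in> F" for a b using that unfolding F_def by (blast intro: ch_comp)
    show "inverse a \<in> F" if "a \<in> F" for a
      using that ch_inv[of _ a] by (cases "a = 0") (auto simp: F_def)
  qed
  have y_pow: "\<phi> ((x ^^ j) w) = y ^ j * \<phi> w" if "w \<in> W" for j w
    by (induction j) (use y that x_funpow_in in auto)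
  have xq: "ch (x ^^ q) (y ^ q)" using x_power_in_C y_pow by (simp add: ch_def q_def)
  have y0: "y \<noteq> 0"
  proof
    assume "y = 0"
    moreover obtain w where "w \<in> W" "x w = u" using x_bij u(1) by (metis bij_betw_imp_surj_on imageE)
    ultimately show False using y u by auto
  qed
  obtain a where a: "\<exists>i\<le>dim W. a i \<noteq> 0" "(\<Sum>i\<le>dim W. s (a i) ((x ^^ i) u)) = 0"
    using power_relation[of W x u, OF W_sub x_in u(1)] by blast
  \<comment> \<open>A linear relation among iterates of \<open>x\<close> at \<open>u\<close>, read
    through \<open>\<phi>\<close>, makes \<open>y\<close> a root of a polynomial over
    \<open>K\<close> of degree at most \<open>dim W \<le> d < l\<close>.\<close>
  define p0 where "p0 = (\<Sum>i\<le>dim W. Polynomial.monom (to_ac (a i)) i)"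
  have cp: "poly.coeff p0 i = (if i \<le> dim W then to_ac (a i) else 0)" for i
    unfolding p0_def coeff_sum by (simp add: if_distrib cong: if_cong)
  have p0: "p0 \<noteq> 0"
  proof
    assume "p0 = 0"
    with a(1) cp show False by (metis coeff_0 to_ac_eq_0_iff')
  qed
  have p0F: "coeffs_in F p0" using K_F K_F[of 0] by (simp add: coeffs_in_def cp)
  have "Polynomial.degree p0 \<le> dim W" by (rule degree_le) (simp add: cp)
  then have p0_deg: "Polynomial.degree p0 < l" using W_dim d_less_l by simp
  have "0 = (\<Sum>i\<le>dim W. \<phi> (s (a i) ((x ^^ i) u)))"
    using functional_on_sum[OF W_sub \<phi>(1), of "{..dim W}" "\<lambda>i. s (a i) ((x ^^ i) u)"] a(2) \<phi>_0
      subspace_scale[OF W_sub] x_funpow_in u(1) by simp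
  also have "\<dots> = (\<Sum>i\<le>dim W. to_ac (a i) * y ^ i * \<phi> u)"
    using \<phi>_scale x_funpow_in y_pow u(1) by (simp add: mult.assoc)
  also have "\<dots> = poly p0 y * \<phi> u" by (simp add: p0_def poly_sum poly_monom sum_distrib_right)
  finally have p0y: "poly p0 y = 0" using u by simp
  have "y ^ (l ^ k) \<in> F" using xq by (auto simp: F_def q_def)
  then obtain b where b: "b \<in> F" "b ^ q = y ^ q"
    using prime_power_root_in_subfield[OF F prime_l y0 _ p0 p0F p0y p0_deg] unfolding q_def by metis
  obtain \<kappa> where \<kappa>: "ch \<kappa> b" using b(1) by (auto simp: F_def)
  have "q > 0" using l_pos by (simp add: q_def)
  then have "b \<noteq> 0" using b(2) y0 by (auto simp: power_0_left)
  then obtain \<mu> where \<mu>: "ch \<mu> (inverse b)" "\<And>w. w \<in> W \<Longrightarrow> \<mu> (\<kappa> w) = w" using ch_inv[OF \<kappa>] by blast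
  have \<kappa>C: "\<kappa> \<in> C" and \<mu>C: "\<mu> \<in> C" using \<kappa> \<mu> by (auto simp: ch_def)
  have \<kappa>q: "(\<kappa> ^^ q) w = (x ^^ q) w" if "w \<in> W" for w
    using ch_0[OF _ that, of "\<lambda>w. (\<kappa> ^^ q) w - (x ^^ q) w"] ch_diff[OF ch_pow[OF \<kappa>, of q] xq] b by simp
  define x' where "x' w = \<mu> (x w)" for w
  have x'_lin: "lin_on W x'" unfolding x'_def by (rule lin_on_comp[OF C_lin[OF \<mu>C] x_lin])
  have x'_pow: "(x' ^^ j) w = (\<mu> ^^ j) ((x ^^ j) w)" if "w \<in> W" for j w
  proof (induction j)
    case (Suc j)
    have "x ((\<mu> ^^ j) ((x ^^ j) w)) = (\<mu> ^^ j) (x ((x ^^ j) w))"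
      by (rule x_C_comm[OF C_funpow[OF \<mu>C] x_funpow_in[OF that]])
    then show ?case using Suc by (simp add: x'_def)
  qed simp
  have \<mu>\<kappa>: "(\<mu> ^^ j) ((\<kappa> ^^ j) w) = w" if "w \<in> W" for j w
  proof (induction j)
    case (Suc j)
    have "(\<kappa> ^^ j) w \<in> W" using C_in[OF C_funpow[OF \<kappa>C] that] .
    then have "\<mu> (\<kappa> ((\<kappa> ^^ j) w)) = (\<kappa> ^^ j) w" by (rule \<mu>(2))
    then show ?case using Suc by (simp add: funpow_swap1)
  qed simp
  have x': "x' w = w" if w: "w \<in> W" for w
  proof (rule small_dim_trivial[OF W_sub dim_bound_small[OF W_dim] x'_lin _ w])
    fix u assume u: "u \<in> W"
    show "(x' ^^ (l ^ k)) u = u"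
      using x'_pow[OF u, of q] \<kappa>q[OF u] \<mu>\<kappa>[OF u, of q] by (simp add: q_def)
  qed
  have "x w = \<kappa> w" if w: "w \<in> W" for w
  proof -
    have "\<mu> (\<kappa> (x w)) = x w" by (rule \<mu>(2)[OF x_in[OF w]])
    moreover have "\<mu> (\<kappa> (x w)) = \<kappa> (\<mu> (x w))" by (rule C_comm[OF \<mu>C \<kappa>C x_in[OF w]])
    ultimately show ?thesis using x'[OF w] by (simp add: x'_def)
  qed
  with that \<kappa>C show thesis by blast
qed

text \<open>On \<open>W\<close> the operator \<open>x\<close> agrees with an
  \<open>N\<close>-endomorphism, so \<open>n\<close> and \<open>conj n\<close> act alike there. The
  vectors on which they do for all \<open>n\<close> form a \<open>G\<close>-submodule, hence
  everything, and faithfulness finishes.\<close>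

lemma conj_trivial: "n \<in> N \<Longrightarrow> conj n = n"
proof -
  assume n: "n \<in> N"
  obtain \<kappa> where \<kappa>: "\<kappa> \<in> C" "\<And>w. w \<in> W \<Longrightarrow> x w = \<kappa> w" using x_scalar by blast
  define Z where "Z = {w. \<forall>n\<in>N. \<rho> (conj n) w = \<rho> n w}"
  have Z_sub: "subspace Z"
    by (rule subspaceI) (auto simp: Z_def \<rho>_0 \<rho>_add \<rho>_scale N_sub conj_in)
  have WZ: "w \<in> Z" if w: "w \<in> W" for w
    unfolding Z_def
  proof (intro CollectI ballI)
    fix n assume n: "n \<in> N"
    obtain w' where w': "w' \<in> W" "x w' = w" using x_bij w by (metis bij_betw_imp_surj_on imageE)
    have "\<rho> (conj n) w = x (\<rho> n w')" using x_conj[OF n w'(1)] w' by simp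
    also have "\<dots> = \<rho> n (\<kappa> w')" using \<kappa> W_N[OF n w'(1)] C_N[OF \<kappa>(1) n w'(1)] by simp
    finally show "\<rho> (conj n) w = \<rho> n w" using \<kappa>(2) w' by simp
  qed
  have conj_mult: "conj (m \<otimes> n) = conj m \<otimes> conj n" if "m \<in> N" "n \<in> N" for m n
  proof -
    have "inv g \<otimes> (g \<otimes> z) = z" if "z \<in> carrier G" for z
      using g that by (simp flip: G.m_assoc)
    then show ?thesis using g N_sub[OF that(1)] N_sub[OF that(2)] by (simp add: conj_def G.m_assoc)
  qed
  have "Z = {0} \<or> Z = UNIV"
  proof (rule simple[OF Z_sub], rule stableI)
    fix w assume w: "w \<in> Z"
    show "\<rho> g w \<in> Z"
      unfolding Z_def
    proof (intro CollectI ballI)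
      fix n assume "n \<in> N"
      then obtain m where m: "m \<in> N" "conj m = n" using conj_surj by blast
      have "\<rho> (conj n) (\<rho> g w) = \<rho> g (\<rho> n w)" using conj_eq[of n w] \<open>n \<in> N\<close> by simp
      also have "\<dots> = \<rho> g (\<rho> m w)" using w m by (auto simp: Z_def)
      also have "\<dots> = \<rho> n (\<rho> g w)" using conj_eq[OF m(1)] m(2) by simp
      finally show "\<rho> (conj n) (\<rho> g w) = \<rho> n (\<rho> g w)" .
    qed
    fix m assume m: "m \<in> N"
    show "\<rho> m w \<in> Z"
      unfolding Z_def
    proof (intro CollectI ballI)
      fix n assume n: "n \<in> N"
      have mn: "n \<otimes> m \<in> N" using subgroup.m_closed[OF N_subgroup n m] .
      have "\<rho> (conj n) (\<rho> m w) = \<rho> (conj n) (\<rho> (conj m) w)" using w m by (simp add: Z_def)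
      also have "\<dots> = \<rho> (conj (n \<otimes> m)) w"
        using conj_in n m by (simp add: conj_mult \<rho>_mult N_sub)
      also have "\<dots> = \<rho> (n \<otimes> m) w" using w mn by (simp add: Z_def)
      finally show "\<rho> (conj n) (\<rho> m w) = \<rho> n (\<rho> m w)" using n m by (simp add: \<rho>_mult N_sub)
    qed
  qed
  then have "Z = UNIV" using WZ[OF w0_in] w0 by auto
  then have *: "\<rho> (conj n) w = \<rho> n w" for w using n by (auto simp: Z_def)
  have "\<rho> (inv n \<otimes> conj n) w = w" for w
    using * n conj_in[OF n] N_sub by (simp add: \<rho>_mult \<rho>_inv)
  then have "inv n \<otimes> conj n = \<one>" using n conj_in[OF n] N_sub by (intro faithful) auto
  then have "inv n = inv (conj n)"
    using n conj_in[OF n] N_sub by (intro G.inv_equality[symmetric]) auto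
  then show "conj n = n" using n conj_in[OF n] N_sub by (metis G.inv_inv)
qed

end

theorem (in prime_cyclic_rep) conj_trivial_of_reducible:
  assumes W0: "subspace W0" "\<And>n w. n \<in> N \<Longrightarrow> w \<in> W0 \<Longrightarrow> \<rho> n w \<in> W0" "W0 \<noteq> {0}" "W0 \<noteq> UNIV"
    and n: "n \<in> N"
  shows "conj n = n"
proof -
  obtain r :: nat and e where e:
    "\<And>i. i < r \<Longrightarrow> e i \<in> alg"
    "\<And>i w. i < r \<Longrightarrow> e i (e i w) = e i w"
    "\<And>i j a w. i < r \<Longrightarrow> j < r \<Longrightarrow> i \<noteq> j \<Longrightarrow> a \<in> alg \<Longrightarrow> e i (a (e j w)) = 0"
    "\<And>i a b w. i < r \<Longrightarrow> a \<in> alg \<Longrightarrow> b \<in> alg \<Longrightarrow>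
       e i (a (e i (b (e i w)))) = e i (b (e i (a (e i w))))"
    "\<And>i a u. i < r \<Longrightarrow> a \<in> alg \<Longrightarrow> e i (a (e i u)) \<noteq> 0 \<Longrightarrow>
       \<exists>b\<in>alg. \<forall>w. b (e i (a (e i w))) = e i w"
    "\<And>U w. subspace U \<Longrightarrow> (\<And>i a b. i < r \<Longrightarrow> a \<in> alg \<Longrightarrow> b \<in> alg \<Longrightarrow> a (e i (b w)) \<in> U) \<Longrightarrow> w \<in> U"
  proof (rule block_idempotents, goal_cases)
    case (1 r e)
    show ?case by (rule that) (fact 1)+
  qed
  interpret block_rep s Basis v l G N \<rho> d g k r e W0
    by unfold_locales (fact e W0)+
  obtain u :: 'v where "u \<noteq> 0" using W0(1,3) subspace_0 by blast
  then obtain i a where i: "i < r" "a \<in> alg" "e i (a u) \<noteq> 0" using detect by blast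
  define w0 where "w0 = e i (a u)"
  have w0: "e i w0 = w0" "w0 \<noteq> 0" using i e_idem by (simp_all add: w0_def)
  have "has_type w0 i" using w0 i bexI[OF _ alg_id, of "\<lambda>a. e i (a w0) \<noteq> 0"] by (simp add: has_type_def)
  then have "has_type (\<rho> g w0) i" by (rule g_preserves_type[OF generatorI[OF i(1) w0]])
  then obtain b where b: "b \<in> alg" "e i (b (\<rho> g w0)) \<noteq> 0" by (auto simp: has_type_def)
  interpret intertwined_rep s Basis v l G N \<rho> d g k r e W0 i w0 "e i (b (\<rho> g w0))" b
    by unfold_locales (use i w0 b in auto)
  show ?thesis by (rule conj_trivial[OF n])
qed

section \<open>The cyclotomic case\<close>

text \<open>The span of \<open>B\<close> and its multiple by \<open>y\<close> meet only in 0, so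
  together they fill twice the dimension inside the span of \<open>S\<close>. It serves both for the
  degree of \<open>K(\<zeta>)\<close> and for the size of the space of self-adjoint
  elements.\<close>

lemma Kb_independent_double:
  fixes B :: "'k::field alg_closure set"
  assumes B: "finite B" "Kb.independent B" and S: "finite S"
    and sub: "B \<subseteq> Kb.span S" "(\<lambda>x. y * x) ` B \<subseteq> Kb.span S"
    and y: "\<And>b. b \<in> Kb.span B \<Longrightarrow> y * b \<in> Kb.span B \<Longrightarrow> b = 0"
  shows "2 * card B \<le> card S"
proof (cases "B = {}")
  case False
  then obtain b0 where b0: "b0 \<in> B" by blast
  have "y \<noteq> 0"
  proof
    assume "y = 0"
    then have "b0 = 0" using y[of b0] Kb.span_base[OF b0] Kb.span_zero[of B] by simp
    with b0 B(2) Kb.dependent_zero show False by blast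
  qed
  interpret y: Vector_Spaces.linear "\<lambda>(c::'k) (y::'k alg_closure). to_ac c * y" "\<lambda>c y. to_ac c * y" "\<lambda>x. y * x"
    by unfold_locales (simp_all add: algebra_simps)
  have inj: "inj (\<lambda>x. y * x)" using \<open>y \<noteq> 0\<close> by (auto simp: inj_on_def)
  define T where "T = (\<lambda>x. y * x) ` B"
  have spanT: "Kb.span T = (\<lambda>x. y * x) ` Kb.span B" unfolding T_def by (rule y.span_image)
  have T: "Kb.independent T" unfolding T_def
    by (rule y.independent_injective_image[OF B(2) inj_on_subset[OF inj subset_UNIV]])
  have cardT: "card T = card B" unfolding T_def by (rule card_image[OF inj_on_subset[OF inj subset_UNIV]])
  have finT: "finite T" using B(1) by (simp add: T_def)
  have cap: "z = 0" if "z \<in> Kb.span B" "z \<in> Kb.span T" for z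
    using that y by (auto simp: spanT)
  have "Kb.independent (B \<union> T')" if "T' \<subseteq> T" for T'
    using finite_subset[OF that finT] that
  proof (induction T' rule: finite_induct)
    case (insert t T')
    have "t \<notin> Kb.span (B \<union> T')"
    proof
      assume "t \<in> Kb.span (B \<union> T')"
      then obtain a c where ac: "t = a + c" "a \<in> Kb.span B" "c \<in> Kb.span T'" unfolding Kb.span_Un by blast
      have "c \<in> Kb.span T" using ac(3) insert.prems Kb.span_mono by blast
      then have "t - c \<in> Kb.span T" using insert.prems Kb.span_base by (intro Kb.span_diff) auto
      then have "t = c" using cap[of a] ac by simp
      then have "t \<in> Kb.span (T - {t})" using ac(3) insert Kb.span_mono[of T' "T - {t}"] by blast
      then show False using T insert.prems Kb.dependent_def by blast
    qed
    then show ?case using insert Kb.independent_insertI[of t "B \<union> T'"] by simp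
  qed (use B in simp)
  then have ind: "Kb.independent (B \<union> T)" by blast
  have "B \<inter> T = {}"
  proof (rule ccontr)
    assume "B \<inter> T \<noteq> {}"
    then obtain z where z: "z \<in> B" "z \<in> T" by blast
    then have "z = 0" by (intro cap Kb.span_base)
    with z B(2) Kb.dependent_zero show False by blast
  qed
  then have "card (B \<union> T) = 2 * card B" using B(1) finT cardT by (simp add: card_Un_disjoint)
  moreover have "card (B \<union> T) \<le> card S"
    using Kb.independent_span_bound[OF S ind] sub by (auto simp: T_def)
  ultimately show ?thesis by simp
qed simp

lemma Kb_span_mult_closed:
  assumes P: "\<And>a b. a \<in> P \<Longrightarrow> b \<in> P \<Longrightarrow> a * b \<in> P"
    and x: "x \<in> Kb.span P" and y: "y \<in> Kb.span P"
  shows "x * y \<in> Kb.span P"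
  using x
proof (induction rule: Kb.span_induct_alt)
  case (step c a x)
  from y have "a * y \<in> Kb.span P"
  proof (induction rule: Kb.span_induct_alt)
    case (step c b y)
    have "to_ac c * (a * b) \<in> Kb.span P"
      using P[OF \<open>a \<in> P\<close> step(1)] by (intro Kb.span_scale Kb.span_base)
    then show ?case using step(2) Kb.span_add by (simp add: algebra_simps)
  qed (simp add: Kb.span_zero)
  then have "to_ac c * (a * y) \<in> Kb.span P" by (rule Kb.span_scale)
  then show ?case using step(2) Kb.span_add by (simp add: algebra_simps)
qed (simp add: Kb.span_zero)

text \<open>Multiplication by a nonzero \<open>x\<close> is injective on a finite-dimensional
  algebra, hence surjective, and so it reaches 1.\<close>

lemma Kb_span_inverse:
  assumes fin: "finite P" and one: "1 \<in> Kb.span P"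
    and P: "\<And>a b. a \<in> P \<Longrightarrow> b \<in> P \<Longrightarrow> a * b \<in> P"
    and x: "x \<in> Kb.span P"
  shows "inverse x \<in> Kb.span (P :: 'k::field alg_closure set)"
proof (cases "x = 0")
  case False
  interpret x: Vector_Spaces.linear "\<lambda>(c::'k) (y::'k alg_closure). to_ac c * y" "\<lambda>c y. to_ac c * y" "\<lambda>y. x * y"
    by unfold_locales (simp_all add: algebra_simps)
  have inj: "inj (\<lambda>y. x * y)" using False by (auto simp: inj_on_def)
  obtain B where B: "B \<subseteq> P" "Kb.independent B" "P \<subseteq> Kb.span B" using Kb.maximal_independent_subset by metis
  have spanB: "Kb.span B = Kb.span P"
    using B(1,3) Kb.span_mono Kb.span_minimal[OF B(3) Kb.subspace_span] by blast
  have finB: "finite B" using finite_subset[OF B(1) fin] .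
  define T where "T = (\<lambda>y. x * y) ` B"
  have T: "Kb.independent T" unfolding T_def
    by (rule x.independent_injective_image[OF B(2) inj_on_subset[OF inj subset_UNIV]])
  have cardT: "card T = card B" unfolding T_def by (rule card_image[OF inj_on_subset[OF inj subset_UNIV]])
  have T_sub: "T \<subseteq> Kb.span B"
    using Kb_span_mult_closed[OF P x] Kb.span_base[of _ P] B(1) by (auto simp: T_def spanB)
  have "1 \<in> Kb.span T"
  proof (rule ccontr)
    assume no: "1 \<notin> Kb.span T"
    then have "Kb.independent (insert 1 T)" using T by (rule Kb.independent_insertI)
    then have "card (insert 1 T) \<le> card B"
      using Kb.independent_span_bound[OF finB, of "insert 1 T"] T_sub one spanB by auto
    moreover have "card (insert 1 T) = Suc (card B)"
      using no Kb.span_base[of 1 T] finB cardT by (auto simp: T_def card_insert_if)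
    ultimately show False by simp
  qed
  then obtain z where z: "z \<in> Kb.span B" "1 = x * z"
    unfolding T_def x.span_image by blast
  then show ?thesis using spanB by (metis inverse_unique)
qed (simp add: Kb.span_zero)

section \<open>Centrality of \<open>g\<close> and its eigenfunctional\<close>

locale reducible_self_dual_rep = prime_cyclic_rep s Basis v l G N \<rho> d g k
  for s :: "'k::field_char_0 \<Rightarrow> 'v::ab_group_add \<Rightarrow> 'v" and Basis v l
    and G :: "('g, 'm) monoid_scheme" (structure) and N \<rho> d g k +
  fixes W0 :: "'v set" and b :: "'v \<Rightarrow> 'v \<Rightarrow> 'k"
  assumes W0: "subspace W0" "n \<in> N \<Longrightarrow> w \<in> W0 \<Longrightarrow> \<rho> n w \<in> W0" "W0 \<noteq> {0}" "W0 \<noteq> UNIV"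
    and N_coprime: "coprime (card N) l"
    and b_add: "b (u + w) u' = b u u' + b w u'" "b u' (u + w) = b u' u + b u' w"
    and b_scale: "b (s c u) u' = c * b u u'" "b u' (s c u) = c * b u' u"
    and b_nondeg: "(\<And>w. b u w = 0) \<Longrightarrow> u = 0"
    and b_inv: "x \<in> carrier G \<Longrightarrow> b (\<rho> x u) (\<rho> x w) = b u w"
begin

lemma g_commutes: "x \<in> carrier G \<Longrightarrow> g \<otimes> x = x \<otimes> g"
proof -
  assume "x \<in> carrier G"
  then obtain n i where x: "n \<in> N" "x = n \<otimes> g [^] (i::nat)" using generated by blast
  have n: "n \<in> carrier G" by (rule N_sub[OF x(1)])
  have "conj n \<otimes> g = g \<otimes> n" using g n by (simp add: conj_def G.m_assoc)
  then have "g \<otimes> n = n \<otimes> g"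
    using conj_trivial_of_reducible[OF W0 x(1)] by simp
  moreover have "g \<otimes> g [^] i = g [^] i \<otimes> g"
    using G.nat_pow_Suc2[OF g, of i] by simp
  ultimately show ?thesis using g n by (simp add: x(2) flip: G.m_assoc) (simp add: G.m_assoc)
qed

lemma g_pow_commutes: "x \<in> carrier G \<Longrightarrow> \<rho> (g [^] (i::nat)) (\<rho> x w) = \<rho> x (\<rho> (g [^] i) w)"
proof -
  assume x: "x \<in> carrier G"
  have "g [^] i \<otimes> x = x \<otimes> g [^] i"
    using g_commutes[OF x] g x G.pow_mult_distrib by (metis G.group_commutes_pow)
  then show ?thesis using x g by (simp flip: \<rho>_mult)
qed

text \<open>Because \<open>g\<close> is central, the fixed vectors of a power of \<open>g\<close>
  form a \<open>G\<close>-submodule, which faithfulness keeps from being everything.\<close>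

lemma fixed_point_free:
  assumes "\<rho> (g [^] (i::nat)) w = w" "g [^] i \<noteq> \<one>" shows "w = 0"
proof -
  define Z where "Z = {w. \<rho> (g [^] i) w = w}"
  have "subspace Z" using g by (intro subspaceI) (auto simp: Z_def \<rho>_0 \<rho>_add \<rho>_scale)
  moreover have "\<rho> x w \<in> Z" if "x \<in> carrier G" "w \<in> Z" for x w
    using g_pow_commutes[OF that(1)] that(2) by (simp add: Z_def)
  ultimately have "Z = {0} \<or> Z = UNIV" by (intro simple) auto
  moreover have "Z \<noteq> UNIV" using faithful[of "g [^] i"] g assms(2) by (auto simp: Z_def)
  ultimately show ?thesis using assms(1) by (auto simp: Z_def)
qed

lemma g_nontrivial: "g \<noteq> \<one>"
proof
  assume "g = \<one>"
  then have "W0 = {0} \<or> W0 = UNIV"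
    by (intro simple[OF W0(1)]) (rule stableI, auto simp: \<rho>_one W0(2))
  with W0(3,4) show False by blast
qed

text \<open>The order of \<open>g\<close> is \<open>l ^ J\<close>.\<close>

definition J where "J = (LEAST j. g [^] (l ^ j) = \<one>)"

lemma J: "g [^] (l ^ J) = \<one>" "J > 0" "g [^] (l ^ (J - 1)) \<noteq> \<one>"
proof -
  show "g [^] (l ^ J) = \<one>" unfolding J_def by (rule LeastI[of _ k]) (rule g_power)
  then show J0: "J > 0" using g_nontrivial g by (cases J) auto
  show "g [^] (l ^ (J - 1)) \<noteq> \<one>"
    using not_less_Least[of "J - 1" "\<lambda>j. g [^] (l ^ j) = \<one>"] J0 by (simp add: J_def)
qed

text \<open>
  An eigenfunctional of \<open>g\<close> maps the space onto a \<open>K(\<zeta>\<^sub>l)\<close>-subspace of the algebraic closure; its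
  kernel and its image would both have dimension greater than \<open>d\<close> if the kernel were nonzero.
\<close>
lemma injective_eigenfunctional:
  obtains \<phi> y where "functional_on UNIV \<phi>" "inj \<phi>" "\<And>w. \<phi> (\<rho> g w) = y * \<phi> w"
    "primitive_root_of_unity l (y ^ (l ^ (J - 1)))"
proof -
  define i where "i = l ^ (J - 1)"
  define h where "h = g [^] i"
  have h: "h \<in> carrier G" using g by (simp add: h_def)
  have hl: "(\<rho> h ^^ l) w = w" for w
  proof -
    have "(\<rho> h ^^ j) w = \<rho> (g [^] (i * j)) w" for j
    proof (induction j)
      case (Suc j)
      have "g [^] (i * Suc j) = h \<otimes> g [^] (i * j)" using g by (simp add: h_def G.nat_pow_mult)
      then show ?case using Suc h g by (simp add: \<rho>_mult)
    qed (simp add: \<rho>_one)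
    moreover have "i * l = l ^ J" using J(2) by (cases J) (simp_all add: i_def)
    ultimately show ?thesis using J(1) by (simp add: \<rho>_one)
  qed
  have fix0: "w = 0" if "\<rho> h w = w" for w
    using fixed_point_free[of i w] that J(3) by (simp add: h_def i_def)
  obtain w0 :: 'v where w0: "w0 \<noteq> 0" using W0(1,3) subspace_0 by blast
  have lin: "lin_on UNIV (\<rho> g)" using g by (simp add: lin_on_def \<rho>_add \<rho>_scale)
  obtain \<phi> where \<phi>: "functional_on UNIV \<phi>" "\<exists>u\<in>UNIV. \<phi> u \<noteq> 0"
    "\<And>T. T \<in> {\<rho> g} \<Longrightarrow> \<exists>y. \<forall>x\<in>UNIV. \<phi> (T x) = y * \<phi> x"
  proof (rule common_eigenfunctional[OF subspace_UNIV _ w0, of "{\<rho> g}"], goal_cases)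
    case (5 \<phi>)
    show ?case by (rule that) (fact 5)+
  qed (use lin in auto)
  then obtain y where y: "\<And>w. \<phi> (\<rho> g w) = y * \<phi> w" by auto
  have y_pow: "\<phi> (\<rho> (g [^] j) w) = y ^ j * \<phi> w" for j w
    unfolding \<rho>_g_funpow[symmetric] by (induction j) (simp_all add: y)
  define z where "z = y ^ i"
  have z: "\<phi> (\<rho> h w) = z * \<phi> w" for w unfolding h_def z_def by (rule y_pow)
  have z_pow: "\<phi> ((\<rho> h ^^ j) w) = z ^ j * \<phi> w" for j w
    by (induction j) (simp_all add: z)
  obtain u where u: "\<phi> u \<noteq> 0" using \<phi>(2) by blast
  have zl: "z ^ l = 1" using z_pow[of l u] hl[of u] u by simp
  have "z \<noteq> 1"
  proof
    assume z1: "z = 1"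
    \<comment> \<open>The orbit sum of \<open>u\<close> under \<open>h\<close>, which has order
      \<open>l\<close>, is fixed by \<open>h\<close> and so vanishes. With \<open>z = 1\<close> the
      functional would send it to \<open>l * \<phi> u\<close>, which is nonzero.\<close>
    define u' where "u' = (\<Sum>j<l. (\<rho> h ^^ j) u)"
    have "\<rho> h u' = (\<Sum>j<l. (\<rho> h ^^ Suc j) u)" using h by (simp add: u'_def \<rho>_sum)
    also have "\<dots> = (\<Sum>j<l. (\<rho> h ^^ j) u)"
      using sum.lessThan_Suc_shift[of "\<lambda>j. (\<rho> h ^^ j) u" l] hl[of u] by simp
    finally have "u' = 0" by (intro fix0) (simp add: u'_def)
    then have "(\<Sum>j<l. \<phi> ((\<rho> h ^^ j) u)) = 0"
      using functional_on_sum[OF subspace_UNIV \<phi>(1), of "{..<l}" "\<lambda>j. (\<rho> h ^^ j) u"]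
        functional_on_0[OF subspace_UNIV \<phi>(1)] by (simp add: u'_def)
    then have "of_nat l * \<phi> u = 0" by (simp add: z_pow z1)
    then show False using u l_pos by (simp add: of_nat_ac_eq_0_iff)
  qed
  then obtain j where "j \<ge> 1" "j \<le> 1" "primitive_root_of_unity (l ^ j) z"
    using primitive_prime_powerI[OF prime_l, of z 1] zl by auto
  then have z_prim: "primitive_root_of_unity (l ^ Suc 0) z" by (cases "j = 1") auto
  define U where "U = {w. \<phi> w = 0}"
  have U: "subspace U"
    using \<phi>(1) functional_on_0[OF subspace_UNIV \<phi>(1)]
    by (intro subspaceI) (auto simp: U_def functional_on_def)
  obtain B where B: "finite B" "Kb.independent B" "Kb.span B = \<phi> ` UNIV"
    "card B + dim {u \<in> UNIV. \<phi> u = 0} \<le> dim UNIV"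
    by (rule functional_image_basis[OF subspace_UNIV \<phi>(1)])
  have "z * x \<in> Kb.span B" if "x \<in> Kb.span B" for x
    using that unfolding B(3) by (auto simp flip: z)
  from primitive_stable_dvd[OF B(1,2) z_prim this]
  have dvd: "int (l - 1) dvd int (card B) * v (of_nat l)" by simp
  have "B \<noteq> {}"
  proof
    assume "B = {}"
    then have "range \<phi> = {0}" using B(3) by simp
    then show False using u by (metis rangeI singletonD)
  qed
  then have "card B > 0" using B(1) by (simp add: card_gt_0_iff)
  then have le: "int (l - 1) \<le> int (card B) * v (of_nat l)"
    using v_l by (intro zdvd_imp_le[OF dvd]) auto
  have cB: "card B > d"
  proof (rule ccontr)
    assume "\<not> card B > d"
    then have "int (card B) * v (of_nat l) \<le> int d * v (of_nat l)" using v_l by (intro mult_right_mono) auto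
    then show False using le d_small l_pos by simp
  qed
  have "U = {0}"
  proof (rule ccontr)
    assume "U \<noteq> {0}"
    then obtain w where w: "w \<in> U" "w \<noteq> 0" using subspace_0[OF U] by blast
    have "lin_on U (\<rho> h)" using h z by (simp add: lin_on_def U_def \<rho>_add \<rho>_scale)
    then have "dim U > d"
      using small_dim_trivial[OF U dim_bound_small, of "\<rho> h" 1 w] hl fix0[of w] w by fastforce
    with B(4) cB dim_V show False by (simp add: U_def)
  qed
  have "inj \<phi>"
  proof (rule injI)
    fix a c assume "\<phi> a = \<phi> c"
    then have "a - c \<in> U" using functional_on_diff[OF subspace_UNIV \<phi>(1), of a c] by (simp add: U_def)
    then show "a = c" using \<open>U = {0}\<close> by simp
  qed
  with that[OF \<phi>(1) _ y] z_prim show thesis by (simp add: z_def i_def)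
qed

end

lemma range_power_mod:
  assumes "primitive_root_of_unity n z" "n > 0"
  shows "range (\<lambda>i. z ^ i) = (\<lambda>i. z ^ i) ` {..<n}"
proof -
  have "z ^ i = z ^ (i mod n)" for i
  proof -
    have "z ^ i = z ^ (n * (i div n) + i mod n)" by simp
    then show ?thesis using assms by (simp only: power_add power_mult primitive_root_of_unity_def) simp
  qed
  moreover have "i mod n < n" for i using assms(2) by simp
  ultimately show ?thesis by (auto simp: image_iff)
qed

section \<open>The representation as multiplication on \<open>K(\<zeta>)\<close>\<close>

locale eigenfunctional_rep = reducible_self_dual_rep s Basis v l G N \<rho> d g k W0 b
  for s :: "'k::field_char_0 \<Rightarrow> 'v::ab_group_add \<Rightarrow> 'v" and Basis v l
    and G :: "('g, 'm) monoid_scheme" (structure) and N \<rho> d g k W0 b +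
  fixes \<phi> :: "'v \<Rightarrow> 'k alg_closure" and y :: "'k alg_closure"
  assumes \<phi>_add: "\<phi> (u + w) = \<phi> u + \<phi> w" and \<phi>_scale: "\<phi> (s c w) = to_ac c * \<phi> w"
    and \<phi>_inj: "\<phi> u = \<phi> w \<Longrightarrow> u = w" and \<phi>_g: "\<phi> (\<rho> g w) = y * \<phi> w"
    and z_prim: "primitive_root_of_unity l (y ^ (l ^ (J - 1)))"
    and one_in: "1 \<in> range \<phi>"
begin

lemma \<phi>_linear: "Vector_Spaces.linear s (\<lambda>c y. to_ac c * y) \<phi>"
  by unfold_locales (simp_all add: algebra_simps \<phi>_add \<phi>_scale)

lemma \<phi>_0: "\<phi> 0 = 0"
  using \<phi>_scale[of 0 0] by simp

lemma \<phi>_diff: "\<phi> (u - w) = \<phi> u - \<phi> w"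
  by (metis \<phi>_add add_diff_cancel diff_add_cancel)

definition B where "B = \<phi> ` Basis"

lemma B: "finite B" "Kb.independent B" "Kb.span B = range \<phi>" "card B = 2 * d"
proof -
  interpret \<phi>: Vector_Spaces.linear s "\<lambda>c y. to_ac c * y" \<phi> by (rule \<phi>_linear)
  have inj: "inj \<phi>" using \<phi>_inj by (auto intro: injI)
  show "finite B" using finite_Basis by (simp add: B_def)
  show "Kb.independent B" unfolding B_def
    by (rule \<phi>.independent_injective_image[OF independent_Basis inj_on_subset[OF inj subset_UNIV]])
  show "Kb.span B = range \<phi>" unfolding B_def \<phi>.span_image span_Basis ..
  show "card B = 2 * d"
    using dim_V dim_UNIV card_image[OF inj_on_subset[OF inj subset_UNIV], of Basis] by (simp add: B_def)
qed

lemma y_stable: "x \<in> Kb.span B \<Longrightarrow> y ^ i * x \<in> Kb.span B"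
proof (induction i)
  case (Suc i)
  then obtain w where "y ^ i * x = \<phi> w" by (auto simp: B(3))
  then have "y ^ Suc i * x = \<phi> (\<rho> g w)" by (simp add: \<phi>_g mult.assoc)
  then show ?case by (simp add: B(3))
qed simp

text \<open>\<open>l - 1\<close> divides \<open>2 * d * e\<close>, which is positive and, by the
  bound on \<open>l\<close>, less than \<open>2 * (l - 1)\<close>; only the quotient 1
  remains.\<close>

lemma degree_eq: "2 * int d * v (of_nat l) = int l - 1"
proof -
  have "int ((l - 1) * l ^ 0) dvd int (card B) * v (of_nat l)"
    by (rule primitive_stable_dvd[OF B(1,2)]) (use z_prim y_stable in auto)
  then obtain c where c: "2 * int d * v (of_nat l) = (int l - 1) * c"
    using B(4) l_pos by (auto elim!: dvdE simp: of_nat_diff)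
  have "0 < 2 * int d * v (of_nat l)" using d_pos v_l by simp
  moreover have "2 * int d * v (of_nat l) < (int l - 1) * 2" using d_small by simp
  moreover have "0 < int l - 1" using d_less_l by simp
  ultimately have "0 < c" "c < 2" unfolding c
    using mult_less_cancel_left_pos[of "int l - 1" c 2] by (auto simp: zero_less_mult_iff)
  then have "c = 1" by simp
  with c show ?thesis by simp
qed

text \<open>The order of \<open>y\<close> is \<open>l ^ J\<close>, as its
  \<open>l ^ (J - 1)\<close>-th power is not 1. So \<open>(l - 1) * l ^ (J - 1)\<close> divides
  \<open>2 * d * e = l - 1\<close>, which forces \<open>J = 1\<close>.\<close>

lemma y_prim: "primitive_root_of_unity l y"
proof -
  obtain w where w: "\<phi> w = 1" using one_in by (metis imageE)
  have yg: "\<phi> (\<rho> (g [^] i) u) = y ^ i * \<phi> u" for i u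
    unfolding \<rho>_g_funpow[symmetric] by (induction i) (simp_all add: \<phi>_g)
  have yJ: "y ^ (l ^ J) = 1" using yg[of "l ^ J" w] J(1) w by (simp add: \<rho>_one)
  have ne: "y ^ (l ^ (J - 1)) \<noteq> 1"
    using z_prim primitive_power_eq_1_iff[OF z_prim l_pos, of 1] d_less_l by auto
  then have "y \<noteq> 1" by auto
  from primitive_prime_powerI[OF prime_l yJ this]
  obtain j where j: "j \<ge> 1" "j \<le> J" "primitive_root_of_unity (l ^ j) y" .
  have "j = J"
  proof (rule ccontr)
    assume "j \<noteq> J"
    then have "l ^ j dvd l ^ (J - 1)" using j by (intro le_imp_power_dvd) simp
    then show False using primitive_power_eq_1_iff[OF j(3)] l_pos ne by simp
  qed
  have "int ((l - 1) * l ^ (J - 1)) dvd int (card B) * v (of_nat l)"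
    by (rule primitive_stable_dvd[OF B(1,2)]) (use j \<open>j = J\<close> y_stable[of _ 1] in auto)
  then have "int ((l - 1) * l ^ (J - 1)) dvd int (l - 1)"
    using degree_eq B(4) l_pos by (simp add: of_nat_diff)
  then have "(l - 1) * l ^ (J - 1) dvd (l - 1) * 1" by (simp only: int_dvd_int_iff) simp
  then have "(l - 1) * l ^ (J - 1) \<le> (l - 1) * 1" using d_less_l by (intro dvd_imp_le) auto
  then have "l ^ (J - 1) \<le> 1" using d_less_l by simp
  then have "J = 1" using J(2) d_less_l one_less_power[of l "J - 1"] by (cases "J - 1 = 0") auto
  with j \<open>j = J\<close> show "primitive_root_of_unity l y" by simp
qed

definition P where "P = (\<lambda>i. y ^ i) ` {..<l}"

lemma P: "P = range (\<lambda>i. y ^ i)" "finite P" "a \<in> P \<Longrightarrow> c \<in> P \<Longrightarrow> a * c \<in> P" "1 \<in> P"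
proof -
  show *: "P = range (\<lambda>i. y ^ i)" unfolding P_def by (rule range_power_mod[OF y_prim l_pos, symmetric])
  show "finite P" by (simp add: P_def)
  show "a * c \<in> P" if "a \<in> P" "c \<in> P" using that unfolding * by (auto simp flip: power_add)
  show "1 \<in> P" unfolding * by (rule range_eqI[of _ _ 0]) simp
qed

lemma span_P_mult: "a \<in> Kb.span P \<Longrightarrow> c \<in> Kb.span P \<Longrightarrow> a * c \<in> Kb.span P"
  by (rule Kb_span_mult_closed) (rule P(3))

lemma span_P_inverse: "a \<in> Kb.span P \<Longrightarrow> inverse a \<in> Kb.span P"
  by (rule Kb_span_inverse[OF P(2) Kb.span_base[OF P(4)]]) (rule P(3))

text \<open>The span of \<open>P\<close> is the field \<open>K(y)\<close>, and by divisibility its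
  dimension exceeds \<open>d\<close>. An element \<open>x\<close> of the image outside it would give
  a second, independent copy, its multiple by \<open>x\<close>, inside a space of dimension
  \<open>2 * d\<close>.\<close>

lemma range_\<phi>: "range \<phi> = Kb.span P"
proof
  have sub: "P \<subseteq> Kb.span B"
    using y_stable[of 1] one_in by (auto simp: P_def B(3))
  then show PB: "Kb.span P \<subseteq> range \<phi>" unfolding B(3)[symmetric] by (rule Kb.span_minimal) simp
  obtain B' where B': "B' \<subseteq> P" "Kb.independent B'" "P \<subseteq> Kb.span B'"
    using Kb.maximal_independent_subset by metis
  have span: "Kb.span B' = Kb.span P"
    using B'(1,3) Kb.span_mono Kb.span_minimal[OF B'(3) Kb.subspace_span] by blast
  have fin: "finite B'" using finite_subset[OF B'(1) P(2)] .
  have "int ((l - 1) * l ^ 0) dvd int (card B') * v (of_nat l)"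
  proof (rule primitive_stable_dvd[OF fin B'(2)])
    show "primitive_root_of_unity (l ^ Suc 0) y" using y_prim by simp
    have "y \<in> P" unfolding P(1) by (rule range_eqI[of _ _ 1]) simp
    from span_P_mult[OF Kb.span_base[OF this]]
    show "y * x \<in> Kb.span B'" if "x \<in> Kb.span B'" for x
      using that unfolding span .
  qed
  then have dvd: "int (l - 1) dvd int (card B') * v (of_nat l)" by simp
  have "B' \<noteq> {}" using B'(3) P(4) by auto
  then have "card B' > 0" using fin by (simp add: card_gt_0_iff)
  then have le: "int (l - 1) \<le> int (card B') * v (of_nat l)"
    using v_l by (intro zdvd_imp_le[OF dvd]) auto
  have cB: "card B' > d"
  proof (rule ccontr)
    assume "\<not> card B' > d"
    then have "int (card B') * v (of_nat l) \<le> int d * v (of_nat l)" using v_l by (intro mult_right_mono) auto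
    then show False using le d_small l_pos by simp
  qed
  show "range \<phi> \<subseteq> Kb.span P"
  proof
    fix x assume x: "x \<in> range \<phi>"
    show "x \<in> Kb.span P"
    proof (rule ccontr)
      assume no: "x \<notin> Kb.span P"
      have PxB: "p * x \<in> Kb.span B" if "p \<in> P" for p
        using that x y_stable[of x] by (auto simp: P_def B(3))
      have "2 * card B' \<le> card B"
      proof (rule Kb_independent_double[OF fin B'(2) B(1)])
        show "B' \<subseteq> Kb.span B" using B'(1) sub by blast
        show "(\<lambda>c. x * c) ` B' \<subseteq> Kb.span B" using B'(1) PxB by (auto simp: mult.commute)
        fix a assume a: "a \<in> Kb.span B'" "x * a \<in> Kb.span B'"
        show "a = 0"
        proof (rule ccontr)
          assume "a \<noteq> 0"
          have "inverse a \<in> Kb.span P"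
            using a(1) unfolding span by (rule span_P_inverse)
          then have "x * a * inverse a \<in> Kb.span P"
            using a(2) unfolding span by (intro span_P_mult[of "x * a"])
          with no \<open>a \<noteq> 0\<close> show False by (simp add: mult.assoc)
        qed
      qed
      with cB B(4) show False by simp
    qed
  qed
qed

lemma E_mult: "a \<in> range \<phi> \<Longrightarrow> c \<in> range \<phi> \<Longrightarrow> a * c \<in> range \<phi>"
  unfolding range_\<phi> by (rule span_P_mult)

lemma E_inverse: "a \<in> range \<phi> \<Longrightarrow> inverse a \<in> range \<phi>"
  unfolding range_\<phi> by (rule span_P_inverse)

definition \<psi> where "\<psi> = inv_into UNIV \<phi>"

lemma \<psi>: "a \<in> range \<phi> \<Longrightarrow> \<phi> (\<psi> a) = a" "\<psi> (\<phi> w) = w"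
  using \<phi>_inj by (auto simp: \<psi>_def f_inv_into_f intro: inv_f_f injI)

definition \<chi> where "\<chi> x = \<phi> (\<rho> x (\<psi> 1))"

text \<open>The image is spanned by the powers of \<open>y\<close>, which are the images of
  \<open>\<rho> (g [^] i) (\<psi> 1)\<close>. Since \<open>x\<close> commutes with \<open>g\<close>,
  its effect on all of them is dictated by its effect on the vector mapped to 1.\<close>

lemma \<phi>_\<rho>: assumes x: "x \<in> carrier G" shows "\<phi> (\<rho> x w) = \<chi> x * \<phi> w"
proof -
  have yg: "\<phi> (\<rho> (g [^] i) u) = y ^ i * \<phi> u" for i :: nat and u
    unfolding \<rho>_g_funpow[symmetric] by (induction i) (simp_all add: \<phi>_g)
  have "\<forall>w. \<phi> w = a \<longrightarrow> \<phi> (\<rho> x w) = \<chi> x * a" if "a \<in> Kb.span P" for a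
    using that
  proof (induction rule: Kb.span_induct_alt)
    case base
    show ?case
    proof (intro allI impI)
      fix w assume "\<phi> w = 0"
      then have "w = 0" using \<phi>_0 by (intro \<phi>_inj) simp
      then show "\<phi> (\<rho> x w) = \<chi> x * 0" using x \<phi>_0 \<rho>_0 by simp
    qed
  next
    case (step c p a)
    obtain i where i: "p = y ^ i" using step(1) by (auto simp: P_def)
    show ?case
    proof (intro allI impI)
      fix w assume w: "\<phi> w = to_ac c * p + a"
      define u where "u = \<rho> (g [^] i) (\<psi> 1)"
      have u: "\<phi> u = p" using one_in by (simp add: u_def yg \<psi> i)
      have xu: "\<phi> (\<rho> x u) = \<chi> x * p"
        using g_pow_commutes[OF x, of i "\<psi> 1", symmetric] by (simp add: u_def yg \<chi>_def i mult.commute)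
      have "\<phi> (w - s c u) = a" by (simp add: \<phi>_diff \<phi>_scale u w)
      then have "\<phi> (\<rho> x (w - s c u)) = \<chi> x * a" using step(2) by blast
      then show "\<phi> (\<rho> x w) = \<chi> x * (to_ac c * p + a)"
        using x by (simp add: \<rho>_diff \<rho>_scale \<phi>_diff \<phi>_scale xu algebra_simps)
    qed
  qed
  moreover have "\<phi> w \<in> Kb.span P" using range_\<phi> by blast
  ultimately show ?thesis by blast
qed

lemma \<chi>_mult: "x \<in> carrier G \<Longrightarrow> x' \<in> carrier G \<Longrightarrow> \<chi> (x \<otimes> x') = \<chi> x * \<chi> x'"
  using \<phi>_\<rho>[of x "\<rho> x' (\<psi> 1)"] by (simp add: \<chi>_def \<rho>_mult)

lemma \<chi>_one: "\<chi> \<one> = 1"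
  using \<psi>(1)[OF one_in] by (simp add: \<chi>_def \<rho>_one)

lemma \<chi>_g: "\<chi> g = y"
  using \<psi>(1)[OF one_in] by (simp add: \<chi>_def \<phi>_g)

lemma \<chi>_pow: "x \<in> carrier G \<Longrightarrow> \<chi> (x [^] (i::nat)) = \<chi> x ^ i"
  by (induction i) (simp_all add: \<chi>_one \<chi>_mult mult.commute)

lemma \<chi>_inv: "x \<in> carrier G \<Longrightarrow> \<chi> (inv x) = inverse (\<chi> x)"
  using \<chi>_mult[of x "inv x"] \<chi>_one by (simp add: inverse_unique)

lemma \<chi>_nz: "x \<in> carrier G \<Longrightarrow> \<chi> x \<noteq> 0"
  using \<chi>_mult[of x "inv x"] \<chi>_one by auto

lemma \<chi>_range: "\<chi> x \<in> range \<phi>"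
  by (simp add: \<chi>_def)

lemma \<chi>_inj: "inj_on \<chi> (carrier G)"
proof (rule inj_onI)
  fix x x' assume x: "x \<in> carrier G" "x' \<in> carrier G" "\<chi> x = \<chi> x'"
  have "\<rho> x w = \<rho> x' w" for w by (rule \<phi>_inj) (simp add: \<phi>_\<rho> x)
  then have "\<rho> (inv x' \<otimes> x) w = w" for w using x by (simp add: \<rho>_mult \<rho>_inv)
  then have "inv x' \<otimes> x = \<one>" using x by (intro faithful) auto
  then have "inv (inv x') = x" using x by (intro G.inv_equality) (auto simp: G.inv_comm)
  then show "x = x'" using x by simp
qed

section \<open>The invariant form on \<open>K(\<zeta>)\<close>\<close>

definition \<beta> where "\<beta> a c = b (\<psi> a) (\<psi> c)"

lemma \<psi>_add: "a \<in> range \<phi> \<Longrightarrow> c \<in> range \<phi> \<Longrightarrow> \<psi> (a + c) = \<psi> a + \<psi> c"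
  by (rule \<phi>_inj, subst \<psi>(1)) (auto simp: \<phi>_add \<psi> simp flip: B(3) intro: Kb.span_add)

lemma \<psi>_scale: "a \<in> range \<phi> \<Longrightarrow> \<psi> (to_ac c * a) = s c (\<psi> a)"
  by (rule \<phi>_inj, subst \<psi>(1)) (auto simp: \<phi>_scale \<psi> simp flip: B(3) intro: Kb.span_scale)

lemma E_diff: "a \<in> range \<phi> \<Longrightarrow> c \<in> range \<phi> \<Longrightarrow> a - c \<in> range \<phi>"
  unfolding B(3)[symmetric] by (rule Kb.span_diff)

lemma E_add: "a \<in> range \<phi> \<Longrightarrow> c \<in> range \<phi> \<Longrightarrow> a + c \<in> range \<phi>"
  unfolding B(3)[symmetric] by (rule Kb.span_add)

lemma E_scale: "a \<in> range \<phi> \<Longrightarrow> to_ac c * a \<in> range \<phi>"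
  unfolding B(3)[symmetric] by (rule Kb.span_scale)

lemma \<beta>_add: "a \<in> range \<phi> \<Longrightarrow> a' \<in> range \<phi> \<Longrightarrow> \<beta> (a + a') c = \<beta> a c + \<beta> a' c"
  "a \<in> range \<phi> \<Longrightarrow> a' \<in> range \<phi> \<Longrightarrow> \<beta> c (a + a') = \<beta> c a + \<beta> c a'"
  by (simp_all add: \<beta>_def \<psi>_add b_add)

lemma \<beta>_scale: "a \<in> range \<phi> \<Longrightarrow> \<beta> (to_ac t * a) c = t * \<beta> a c"
  "a \<in> range \<phi> \<Longrightarrow> \<beta> c (to_ac t * a) = t * \<beta> c a"
  by (simp_all add: \<beta>_def \<psi>_scale b_scale)

lemma \<beta>_diff: "a \<in> range \<phi> \<Longrightarrow> a' \<in> range \<phi> \<Longrightarrow> \<beta> (a - a') c = \<beta> a c - \<beta> a' c"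
  "a \<in> range \<phi> \<Longrightarrow> a' \<in> range \<phi> \<Longrightarrow> \<beta> c (a - a') = \<beta> c a - \<beta> c a'"
  using \<beta>_add(1)[OF E_diff[of a a'], of a' c] \<beta>_add(2)[OF E_diff[of a a'], of a' c] by simp_all

lemma \<beta>_nondeg: "a \<in> range \<phi> \<Longrightarrow> (\<And>c. c \<in> range \<phi> \<Longrightarrow> \<beta> a c = 0) \<Longrightarrow> a = 0"
proof -
  assume a: "a \<in> range \<phi>" and *: "\<And>c. c \<in> range \<phi> \<Longrightarrow> \<beta> a c = 0"
  have "b (\<psi> a) w = 0" for w using *[of "\<phi> w"] by (simp add: \<beta>_def \<psi>)
  then have "\<psi> a = 0" by (rule b_nondeg)
  then show "a = 0" using \<psi>(1)[OF a] \<phi>_0 by simp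
qed

text \<open>Invariance of the form under \<open>x\<close> turns the adjoint of multiplication by
  \<open>\<chi> x\<close> into multiplication by its inverse. Differences
  \<open>\<chi> x - 1 / \<chi> x\<close> are therefore skew.\<close>

lemma \<beta>_\<chi>:
  assumes x: "x \<in> carrier G" and a: "a \<in> range \<phi>" and c: "c \<in> range \<phi>"
  shows "\<beta> (\<chi> x * a) c = \<beta> a (inverse (\<chi> x) * c)"
proof -
  have *: "\<psi> (\<chi> x * a) = \<rho> x (\<psi> a)" if "x \<in> carrier G" "a \<in> range \<phi>" for x a
    by (rule \<phi>_inj) (use that E_mult[OF \<chi>_range that(2)] in \<open>simp add: \<psi> \<phi>_\<rho>\<close>)
  have "\<beta> a (inverse (\<chi> x) * c) = b (\<psi> a) (\<rho> (inv x) (\<psi> c))"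
    using *[of "inv x" c] x c by (simp add: \<beta>_def \<chi>_inv)
  also have "\<dots> = b (\<rho> x (\<psi> a)) (\<rho> x (\<rho> (inv x) (\<psi> c)))" using b_inv[OF x] by simp
  also have "\<dots> = \<beta> (\<chi> x * a) c" using *[OF x a] x by (simp add: \<beta>_def \<rho>_inv)
  finally show ?thesis by simp
qed

text \<open>
  For \<open>n \<in> N\<close> with \<open>\<chi> n\<^sup>2 \<noteq> 1\<close> the quotient \<open>\<alpha>\<close> of the skew elements \<open>y - 1 / y\<close> and
  \<open>\<chi> n - 1 / \<chi> n\<close> is self-adjoint, and \<open>\<alpha> ^ (l - 1)\<close> is \<open>l\<close> times a unit; but the self-adjoint
  elements form a space of dimension at most \<open>d\<close>.
\<close>
lemma \<chi>_N: assumes n: "n \<in> N" shows "\<chi> n ^ 2 = 1"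
proof (rule ccontr)
  assume ne: "\<chi> n ^ 2 \<noteq> 1"
  define \<eta> where "\<eta> = \<chi> n"
  \<comment> \<open>Both \<open>y\<close> and \<open>\<eta>\<close> are \<open>m\<close>-th roots of
    unity, so their unit statements can be multiplied in one ring.\<close>
  define m where "m = l * card N"
  have nG: "n \<in> carrier G" by (rule N_sub[OF n])
  have cN: "card N > 0" using finite_N n by (auto simp: card_gt_0_iff)
  then have m0: "m > 0" using l_pos by (simp add: m_def)
  have \<eta>0: "\<eta> \<noteq> 0" and y0: "y \<noteq> 0" using \<chi>_nz[OF nG] \<chi>_nz[OF g] by (simp_all add: \<eta>_def \<chi>_g)
  define skew where "skew c \<longleftrightarrow> c \<in> range \<phi> \<and> (\<forall>a\<in>range \<phi>. \<forall>a'\<in>range \<phi>. \<beta> (c * a) a' = - \<beta> a (c * a'))" for c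
  define sa where "sa c \<longleftrightarrow> c \<in> range \<phi> \<and> (\<forall>a\<in>range \<phi>. \<forall>a'\<in>range \<phi>. \<beta> (c * a) a' = \<beta> a (c * a'))" for c
  have skewD: "\<beta> (c * a) a' = - \<beta> a (c * a')" if "skew c" "a \<in> range \<phi>" "a' \<in> range \<phi>" for c a a'
    using that unfolding skew_def by blast
  have saD: "\<beta> (c * a) a' = \<beta> a (c * a')" if "sa c" "a \<in> range \<phi>" "a' \<in> range \<phi>" for c a a'
    using that unfolding sa_def by blast
  have sk: "skew (\<chi> x - inverse (\<chi> x))" if x: "x \<in> carrier G" for x
    unfolding skew_def
  proof (intro conjI ballI)
    show "\<chi> x - inverse (\<chi> x) \<in> range \<phi>" by (intro E_diff E_inverse \<chi>_range)
    fix a a' assume a: "a \<in> range \<phi>" "a' \<in> range \<phi>"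
    have in1: "\<chi> x * a \<in> range \<phi>" "inverse (\<chi> x) * a \<in> range \<phi>" "\<chi> x * a' \<in> range \<phi>" "inverse (\<chi> x) * a' \<in> range \<phi>"
      using a by (auto intro: E_mult E_inverse \<chi>_range simp del: image_iff)
    have "\<beta> (inverse (\<chi> x) * a) a' = \<beta> a (\<chi> x * a')"
      using \<beta>_\<chi>[of "inv x" a a'] x a by (simp add: \<chi>_inv)
    then show "\<beta> ((\<chi> x - inverse (\<chi> x)) * a) a' = - \<beta> a ((\<chi> x - inverse (\<chi> x)) * a')"
      using \<beta>_\<chi>[OF x a] by (simp add: left_diff_distrib \<beta>_diff in1)
  qed
  define \<theta> where "\<theta> = y - inverse y"
  define \<delta> where "\<delta> = \<eta> - inverse \<eta>"
  have \<theta>: "skew \<theta>" using sk[OF g] by (simp add: \<theta>_def \<chi>_g)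
  have \<delta>: "skew \<delta>" using sk[OF nG] by (simp add: \<delta>_def \<eta>_def)
  have \<delta>0: "\<delta> \<noteq> 0"
  proof
    assume "\<delta> = 0"
    then have "\<eta> * \<eta> = 1" using \<eta>0 by (simp add: \<delta>_def field_simps)
    with ne show False by (simp add: \<eta>_def power2_eq_square)
  qed
  have \<delta>_E: "inverse \<delta> \<in> range \<phi>" using \<delta> E_inverse by (auto simp: skew_def)
  have \<theta>_E: "\<theta> \<in> range \<phi>" using \<theta> by (simp add: skew_def)
  have \<delta>': "skew (inverse \<delta>)"
    unfolding skew_def
  proof (intro conjI ballI \<delta>_E)
    fix a a' assume a: "a \<in> range \<phi>" "a' \<in> range \<phi>"
    have "\<beta> (\<delta> * (inverse \<delta> * a)) (inverse \<delta> * a') = - \<beta> (inverse \<delta> * a) (\<delta> * (inverse \<delta> * a'))"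
      by (rule skewD[OF \<delta> E_mult[OF \<delta>_E a(1)] E_mult[OF \<delta>_E a(2)]])
    then show "\<beta> (inverse \<delta> * a) a' = - \<beta> a (inverse \<delta> * a')"
      using \<delta>0 by (simp add: mult.assoc[symmetric])
  qed
  define \<alpha> where "\<alpha> = \<theta> * inverse \<delta>"
  have \<alpha>: "sa \<alpha>"
    unfolding sa_def
  proof (intro conjI ballI)
    show "\<alpha> \<in> range \<phi>" unfolding \<alpha>_def by (rule E_mult[OF \<theta>_E \<delta>_E])
    fix a a' assume a: "a \<in> range \<phi>" "a' \<in> range \<phi>"
    have "\<beta> (\<theta> * (inverse \<delta> * a)) a' = - \<beta> (inverse \<delta> * a) (\<theta> * a')"
      by (rule skewD[OF \<theta> E_mult[OF \<delta>_E a(1)] a(2)])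
    also have "\<dots> = \<beta> a (inverse \<delta> * (\<theta> * a'))"
      using skewD[OF \<delta>' a(1) E_mult[OF \<theta>_E a(2)]] by simp
    finally show "\<beta> (\<alpha> * a) a' = \<beta> a (\<alpha> * a')" by (simp add: \<alpha>_def ac_simps)
  qed
  define U where "U = {c. sa c}"
  have U_E: "U \<subseteq> range \<phi>" by (auto simp: U_def sa_def)
  have U: "Kb.subspace U"
  proof (rule Kb.subspaceI)
    have z: "\<beta> 0 c = 0" "\<beta> c 0 = 0" for c
      using \<beta>_diff[OF one_in one_in] by simp_all
    show "0 \<in> U" using E_diff[OF one_in one_in] by (simp add: U_def sa_def z)
    show "c + c' \<in> U" if "c \<in> U" "c' \<in> U" for c c'
      using that E_add[of c c'] by (simp add: U_def sa_def distrib_right \<beta>_add E_mult)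
    show "to_ac t * c \<in> U" if "c \<in> U" for c t
      using that E_scale[of c t] by (simp add: U_def sa_def mult.assoc \<beta>_scale E_mult)
  qed
  have \<alpha>U: "\<alpha> * c \<in> U" if c: "c \<in> U" for c
    unfolding U_def sa_def
  proof (intro CollectI conjI ballI)
    show "\<alpha> * c \<in> range \<phi>" using \<alpha> c by (auto simp: U_def sa_def intro: E_mult simp del: image_iff)
    fix a a' assume a: "a \<in> range \<phi>" "a' \<in> range \<phi>"
    have cE: "c \<in> range \<phi>" "\<alpha> \<in> range \<phi>" using \<alpha> c by (simp_all add: U_def sa_def)
    have "\<beta> (\<alpha> * (c * a)) a' = \<beta> (c * a) (\<alpha> * a')" by (rule saD[OF \<alpha> E_mult[OF cE(1) a(1)] a(2)])
    also have "\<dots> = \<beta> a (c * (\<alpha> * a'))"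
      using c by (intro saD a(1) E_mult[OF cE(2) a(2)]) (simp add: U_def)
    finally show "\<beta> (\<alpha> * c * a) a' = \<beta> a (\<alpha> * c * a')" by (simp add: ac_simps)
  qed
  obtain B2 where B2: "B2 \<subseteq> U" "Kb.independent B2" "U \<subseteq> Kb.span B2"
    using Kb.maximal_independent_subset by metis
  have spanB2: "Kb.span B2 = U" using Kb.span_subspace[OF B2(1,3) U] .
  have finB2: "finite B2"
    using Kb.independent_span_bound[OF B(1) B2(2)] B2(1) U_E B(3) by auto
  have y2: "primitive_root_of_unity l (y ^ 2)"
  proof (rule primitive_coprime_power[OF y_prim l_pos])
    show "coprime 2 l" using d_less_l by (intro primes_coprime[OF two_is_prime_nat prime_l]) simp
  qed
  have \<theta>_eq: "\<theta> = - (1 - y ^ 2) * inverse y" using y0 by (simp add: \<theta>_def field_simps power2_eq_square)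
  have "y ^ 2 \<noteq> 1" using primitive_power_eq_1_iff[OF y_prim l_pos, of 2] d_less_l by (auto dest: dvd_imp_le)
  then have \<theta>0: "\<theta> \<noteq> 0" using y0 by (simp add: \<theta>_eq)
  \<comment> \<open>A self-adjoint element times the skew element \<open>\<theta>\<close> is skew.
    If the product is self-adjoint as well, twice the form vanishes on it, and it is 0 by
    nondegeneracy. So \<open>U\<close> and its multiple by \<open>\<theta>\<close> are independent
    inside dimension \<open>2 * d\<close>.\<close>
  have "2 * card B2 \<le> card B"
  proof (rule Kb_independent_double[OF finB2 B2(2) B(1)])
    show "B2 \<subseteq> Kb.span B" using B2(1) U_E B(3) by auto
    show "(\<lambda>x. \<theta> * x) ` B2 \<subseteq> Kb.span B" using B2(1) U_E B(3) E_mult[OF \<theta>_E] by auto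
    fix c assume "c \<in> Kb.span B2" "\<theta> * c \<in> Kb.span B2"
    then have c: "sa c" and \<theta>c: "sa (\<theta> * c)" unfolding spanB2 by (auto simp: U_def)
    have cE: "c \<in> range \<phi>" and \<theta>cE: "\<theta> * c \<in> range \<phi>" using c \<theta>c by (simp_all add: sa_def)
    have "\<theta> * c = 0"
    proof (rule \<beta>_nondeg[OF \<theta>cE])
      fix a' assume a': "a' \<in> range \<phi>"
      have "\<beta> (\<theta> * c) a' = - \<beta> c (\<theta> * a')" by (rule skewD[OF \<theta> cE a'])
      also have "\<beta> c (\<theta> * a') = \<beta> (c * 1) (\<theta> * a')" by simp
      also have "\<dots> = \<beta> 1 (c * (\<theta> * a'))" by (rule saD[OF c one_in E_mult[OF \<theta>_E a']])
      also have "c * (\<theta> * a') = \<theta> * c * a'" by simp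
      also have "\<beta> 1 (\<theta> * c * a') = \<beta> (\<theta> * c * 1) a'" by (rule saD[OF \<theta>c one_in a', symmetric])
      finally have "\<beta> (\<theta> * c) a' = - \<beta> (\<theta> * c) a'" by simp
      then have "\<beta> (\<theta> * c) a' + \<beta> (\<theta> * c) a' = \<beta> (\<theta> * c) a' + - \<beta> (\<theta> * c) a'" by (rule arg_cong)
      then have "2 * \<beta> (\<theta> * c) a' = 0" unfolding mult_2 by simp
      then show "\<beta> (\<theta> * c) a' = 0" by simp
    qed
    then show "c = 0" using \<theta>0 by simp
  qed
  then have card_le: "card B2 \<le> d" using B(4) by simp
  have "1 \<in> U" using one_in by (simp add: U_def sa_def)
  then have "B2 \<noteq> {}" using B2(3) by auto
  then have card_pos: "card B2 > 0" using finB2 by (simp add: card_gt_0_iff)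
  obtain u where u: "cyc_unit v m u" "(1 - y ^ 2) ^ ((l - 1) * l ^ 0) = of_nat l * u"
    by (rule one_minus_primitive_power[of 0 "y ^ 2" m]) (use y2 m0 in \<open>auto simp: m_def\<close>)
  have \<eta>N: "\<eta> ^ card N = 1"
  proof -
    have "n [^]\<^bsub>G\<lparr>carrier := N\<rparr>\<^esub> Coset.order (G\<lparr>carrier := N\<rparr>) = \<one>\<^bsub>G\<lparr>carrier := N\<rparr>\<^esub>"
      using n by (intro group.pow_order_eq_1 subgroup.subgroup_is_group[OF N_subgroup G.is_group]) simp
    then have "n [^] card N = \<one>" by (simp add: Coset.order_def nat_pow_def)
    then show ?thesis using \<chi>_pow[OF nG, of "card N"] \<chi>_one by (simp add: \<eta>_def)
  qed
  have \<eta>m: "\<eta> ^ m = 1" unfolding m_def using \<eta>N by (metis power_mult mult.commute power_one)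
  have ym: "y ^ m = 1" unfolding m_def using y_prim by (simp add: primitive_root_of_unity_def power_mult)
  have "cyc_unit v m (1 - \<eta> ^ 2)"
  proof (rule cyc_unit_one_minus_coprime_root[OF _ _ N_coprime cN _ m0])
    show "(\<eta> ^ 2) ^ card N = 1" using \<eta>N by (metis power_mult mult.commute power_one)
    show "\<eta> ^ 2 \<noteq> 1" using ne by (simp add: \<eta>_def)
  qed (simp add: m_def)
  then have "cyc_unit v m (- ((1 - \<eta> ^ 2) * inverse \<eta>))"
    by (rule cyc_unit_minus[OF cyc_unit_mult[OF _ cyc_unit_inverse[OF cyc_unit_root[OF \<eta>m m0]]]])
  also have "- ((1 - \<eta> ^ 2) * inverse \<eta>) = \<delta>" using \<eta>0 by (simp add: \<delta>_def field_simps power2_eq_square)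
  finally have "cyc_unit v m \<delta>" .
  then have \<epsilon>: "cyc_unit v m (- (inverse y * inverse \<delta>))"
    by (rule cyc_unit_minus[OF cyc_unit_mult[OF cyc_unit_inverse[OF cyc_unit_root[OF ym m0]] cyc_unit_inverse]])
  \<comment> \<open>As \<open>l\<close> is odd, \<open>y ^ 2\<close> is again a primitive
    \<open>l\<close>-th root of unity, so \<open>(1 - y ^ 2) ^ (l - 1)\<close> is \<open>l\<close>
    times a unit. The other factor is a unit because \<open>\<eta> ^ 2\<close> is a nontrivial root
    of unity whose order divides \<open>card N\<close>, which is prime to \<open>l\<close>.\<close>
  have "\<alpha> = (1 - y ^ 2) * - (inverse y * inverse \<delta>)" by (simp add: \<alpha>_def \<theta>_eq algebra_simps)
  then have "\<alpha> ^ (l - 1) = of_nat l * (u * (- (inverse y * inverse \<delta>)) ^ (l - 1))"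
    using u(2) by (simp only: power_mult_distrib) simp
  from dvd_card_valuation[OF finB2 B2(2) _ this cyc_unit_mult[OF u(1) cyc_unit_power[OF \<epsilon>]] m0]
  have "int (l - 1) dvd int (card B2) * v (of_nat l)" using \<alpha>U unfolding spanB2 by blast
  then have "int (l - 1) \<le> int (card B2) * v (of_nat l)"
    using card_pos v_l by (intro zdvd_imp_le) auto
  also have "\<dots> \<le> int d * v (of_nat l)" using card_le v_l by (intro mult_right_mono) auto
  finally show False using d_small l_pos by simp
qed

end

text \<open>The \<open>n\<close> distinct powers of \<open>z\<close> exhaust the at most
  \<open>n\<close> roots of \<open>X^n - 1\<close>. Hence the eigenvalue \<open>y\<close> and the
  prescribed \<open>\<zeta>\<close> generate the same group.\<close>

lemma primitive_power_range:
  fixes z :: "'a::field"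
  assumes z: "primitive_root_of_unity n z" "n > 0"
  shows "range (\<lambda>i. z ^ i) = {w. w ^ n = 1}"
proof -
  let ?p = "Polynomial.monom 1 n - 1 :: 'a poly"
  have deg: "Polynomial.degree ?p \<le> n"
    by (intro degree_diff_le degree_monom_le) simp
  have "?p \<noteq> 0"
  proof
    assume "?p = 0"
    then have "Polynomial.degree (Polynomial.monom (1::'a) n) = Polynomial.degree (1 :: 'a poly)" by simp
    with z(2) show False by (simp add: degree_monom_eq)
  qed
  then have card: "finite {w. poly ?p w = 0}" "card {w. poly ?p w = 0} \<le> n"
    using poly_roots_finite[of ?p] card_poly_roots_bound[of ?p] deg by auto
  have roots: "{w. poly ?p w = 0} = {w. w ^ n = 1}" by (simp add: poly_monom)
  have sub: "range (\<lambda>i. z ^ i) \<subseteq> {w. w ^ n = 1}"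
    using primitive_power_eq_1_iff[OF z] by (auto simp flip: power_mult)
  have "card ((\<lambda>i. z ^ i) ` {i. 0 < i \<and> i \<le> n}) = card {i. 0 < i \<and> i \<le> n}"
    by (rule card_image[OF primitive_inj_on[OF z]])
  also have "{i. 0 < i \<and> i \<le> n} = {1..n}" by auto
  finally have "card ((\<lambda>i. z ^ i) ` {1..n}) = n" by simp
  moreover have "card ((\<lambda>i. z ^ i) ` {1..n}) \<le> card (range (\<lambda>i. z ^ i))"
    using card(1) finite_subset[OF sub] unfolding roots by (intro card_mono) auto
  ultimately have "card {w :: 'a. w ^ n = 1} \<le> card (range (\<lambda>i. z ^ i))" using card(2) unfolding roots by linarith
  then show ?thesis using card_seteq[OF _ sub] card(1) unfolding roots by blast
qed

section \<open>Identification of the group and of the field\<close>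

lemma cyclic_units_simps:
  "\<one>\<^bsub>cyclic_units z\<^esub> = 1" "x \<otimes>\<^bsub>cyclic_units z\<^esub> y = x * y"
  by (simp_all add: cyclic_units_def subgroup_generated_def units_of_def ring_of_type_algebra_def)

lemma carrier_cyclic_units:
  fixes z :: "'a::field"
  assumes z: "z ^ n = 1" "n > 0"
  shows "carrier (cyclic_units z) = range (\<lambda>i. z ^ i)"
proof -
  let ?R = "ring_of_type_algebra :: 'a ring"
  let ?U = "units_of ?R"
  interpret R: Ring.field ?R by (rule field_from_type_algebra)
  interpret U: group ?U by (rule R.units_group)
  have simps: "carrier ?R = UNIV" "x \<otimes>\<^bsub>?R\<^esub> y = x * y" "\<one>\<^bsub>?R\<^esub> = 1" for x y
    by (simp_all add: ring_of_type_algebra_def)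
  have units: "x \<in> carrier ?U \<longleftrightarrow> x \<noteq> 0" for x
  proof -
    have "x \<in> carrier ?U \<longleftrightarrow> (\<exists>y. y * x = 1 \<and> x * y = 1)"
      by (simp add: units_of_carrier Units_def simps)
    also have "\<dots> \<longleftrightarrow> x \<noteq> 0" by (auto intro!: exI[of _ "inverse x"])
    finally show ?thesis .
  qed
  have U_simps: "x \<otimes>\<^bsub>?U\<^esub> y = x * y" "\<one>\<^bsub>?U\<^esub> = 1" for x y
    by (simp_all add: units_of_mult units_of_one simps)
  have z0: "z \<noteq> 0" using z by (auto simp: power_0_left)
  have car: "carrier (cyclic_units z) = generate ?U {z}"
    using z0 units by (simp add: cyclic_units_def carrier_subgroup_generated)
  have "x \<in> range (\<lambda>i. z ^ i)" if "x \<in> generate ?U {z}" for x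
    using that
  proof (induction rule: generate.induct)
    case one
    show ?case by (rule range_eqI[of _ _ 0]) (simp add: U_simps)
  next
    case (incl h)
    then show ?case by (intro range_eqI[of _ _ 1]) simp
  next
    case (inv h)
    have "inv\<^bsub>?U\<^esub> z = z ^ (n - 1)"
      by (rule U.inv_equality) (use z z0 in \<open>auto simp: U_simps units simp flip: power_Suc2\<close>)
    then show ?case using inv by simp
  next
    case (eng h h')
    then show ?case by (auto simp: U_simps simp flip: power_add)
  qed
  moreover have "z ^ i \<in> generate ?U {z}" for i
  proof (induction i)
    case 0
    show ?case using generate.one[of ?U "{z}"] by (simp add: U_simps)
  next
    case (Suc i)
    show ?case using generate.eng[OF generate.incl[of z "{z}" ?U] Suc] by (simp add: U_simps)
  qed
  ultimately show ?thesis unfolding car by auto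
qed

text \<open>\<open>F\<close> is a field containing \<open>z\<close> and \<open>K\<close>, which
  gives one inclusion. It consists of polynomials in \<open>z\<close> over \<open>K\<close>, which
  lie in every such field.\<close>

lemma adjoin_eqI:
  fixes z :: "'k::field alg_closure"
  assumes F: "z \<in> F" "\<And>c. to_ac c \<in> F" "\<And>x y. x \<in> F \<Longrightarrow> y \<in> F \<Longrightarrow> x + y \<in> F"
      "\<And>x y. x \<in> F \<Longrightarrow> y \<in> F \<Longrightarrow> x * y \<in> F" "\<And>x. x \<in> F \<Longrightarrow> inverse x \<in> F"
    and span: "F \<subseteq> Kb.span (range (\<lambda>i. z ^ i))"
  shows "adjoin z = F"
proof
  let ?R = "ring_of_type_algebra :: 'k alg_closure ring"
  interpret R: Ring.field ?R by (rule field_from_type_algebra)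
  have simps: "carrier ?R = UNIV" "x \<otimes>\<^bsub>?R\<^esub> y = x * y" "\<one>\<^bsub>?R\<^esub> = 1" "x \<oplus>\<^bsub>?R\<^esub> y = x + y" "\<zero>\<^bsub>?R\<^esub> = 0" for x y
    by (simp_all add: ring_of_type_algebra_def)
  have neg: "\<ominus>\<^bsub>?R\<^esub> x = - x" for x
    by (rule R.minus_equality) (auto simp: simps)
  have inv: "inv\<^bsub>?R\<^esub> x = inverse x" if "x \<noteq> 0" for x
    by (rule R.comm_inv_char) (use that in \<open>auto simp: simps\<close>)
  show "adjoin z \<subseteq> F"
  proof
    fix x assume "x \<in> adjoin z"
    then show "x \<in> F" unfolding adjoin_def
    proof (induction rule: generate_field.induct)
      case one
      show ?case using F(2)[of 1] by (simp add: simps)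
    next
      case (incl h)
      then show ?case using F(1,2) by auto
    next
      case (a_inv h)
      then show ?case using F(4)[OF F(2)[of "-1"], of h] by (simp add: neg)
    next
      case (m_inv h)
      then show ?case using F(5) by (simp add: inv simps)
    qed (auto simp: simps F)
  qed
  have zi: "z ^ i \<in> adjoin z" for i
  proof (induction i)
    case 0
    show ?case using generate_field.one[of ?R] by (simp add: adjoin_def simps)
  next
    case (Suc i)
    have "z \<in> adjoin z" by (simp add: adjoin_def generate_field.incl)
    from generate_field.eng_mult[OF this[unfolded adjoin_def] Suc[unfolded adjoin_def]]
    show ?case by (simp add: adjoin_def simps)
  qed
  have "x \<in> adjoin z" if "x \<in> Kb.span (range (\<lambda>i. z ^ i))" for x
    using that
  proof (induction rule: Kb.span_induct_alt)
    case base
    have "to_ac 0 \<in> adjoin z" unfolding adjoin_def by (rule generate_field.incl) blast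
    then show ?case by simp
  next
    case (step c p x)
    have "to_ac c \<in> adjoin z" unfolding adjoin_def by (rule generate_field.incl) simp
    moreover have "p \<in> adjoin z" using step zi by auto
    ultimately have "to_ac c * p \<in> adjoin z"
      using generate_field.eng_mult[of "to_ac c" ?R _ p] by (simp add: adjoin_def simps)
    then show ?case using step(2) generate_field.eng_add[of "to_ac c * p" ?R _ x]
      by (simp add: adjoin_def simps)
  qed
  then show "F \<subseteq> adjoin z" using span by blast
qed

context eigenfunctional_rep
begin

lemma mult_rep:
  assumes \<zeta>: "primitive_root_of_unity l \<zeta>"
  shows "(\<exists>\<psi> \<in> iso G (cyclic_units \<zeta>). iso_mult_rep G s \<rho> (adjoin \<zeta>) \<psi>) \<or>
    (\<exists>\<psi> \<in> iso G (cyclic_units \<zeta> \<times>\<times> cyclic_units (- 1)).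
       iso_mult_rep G s \<rho> (adjoin \<zeta>) (\<lambda>x. fst (\<psi> x) * snd (\<psi> x)))"
proof -
  have l_odd: "odd l" using prime_odd_nat[OF prime_l] d_less_l by simp
  have P_roots: "P = {w. w ^ l = 1}" unfolding P(1) by (rule primitive_power_range[OF y_prim l_pos])
  have \<zeta>P: "range (\<lambda>i. \<zeta> ^ i) = P" unfolding P_roots by (rule primitive_power_range[OF \<zeta> l_pos])
  have car: "carrier (cyclic_units \<zeta>) = P"
    using carrier_cyclic_units[of \<zeta> l] \<zeta> l_pos \<zeta>P by (simp add: primitive_root_of_unity_def)
  have adj: "adjoin \<zeta> = range \<phi>"
  proof (rule adjoin_eqI)
    have "\<zeta> \<in> P" using \<zeta> by (simp add: P_roots primitive_root_of_unity_def)
    then show "\<zeta> \<in> range \<phi>" unfolding range_\<phi> by (rule Kb.span_base)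
    show "to_ac c \<in> range \<phi>" for c using E_scale[OF one_in, of c] by simp
    show "range \<phi> \<subseteq> Kb.span (range (\<lambda>i. \<zeta> ^ i))" by (simp add: \<zeta>P range_\<phi>)
  qed (fact E_add E_mult E_inverse)+
  have rep: "iso_mult_rep G s \<rho> (adjoin \<zeta>) \<psi>" if "\<And>x. x \<in> carrier G \<Longrightarrow> \<psi> x = \<chi> x" for \<psi>
    unfolding iso_mult_rep_def
  proof (intro exI[of _ \<phi>] conjI ballI allI)
    show "bij_betw \<phi> UNIV (adjoin \<zeta>)" using \<phi>_inj by (auto simp: bij_betw_def adj inj_on_def)
    show "\<phi> (\<rho> x w) = \<psi> x * \<phi> w" if "x \<in> carrier G" for x w
      using \<phi>_\<rho>[OF that] \<open>\<And>x. x \<in> carrier G \<Longrightarrow> \<psi> x = \<chi> x\<close>[OF that] by simp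
  qed (rule \<phi>_linear)
  have \<chi>N: "\<chi> n = 1 \<or> \<chi> n = -1" if "n \<in> N" for n
    using \<chi>_N[OF that] by (simp add: power2_eq_1_iff)
  have decomp: "\<exists>n i. n \<in> N \<and> \<chi> x = \<chi> n * y ^ i" if x: "x \<in> carrier G" for x
  proof -
    obtain n i where "n \<in> N" "x = n \<otimes> g [^] (i::nat)" using generated[OF x] by blast
    then show ?thesis using g N_sub by (auto simp: \<chi>_mult \<chi>_pow \<chi>_g)
  qed
  have yl: "y ^ l = 1" using y_prim by (simp add: primitive_root_of_unity_def)
  have yP: "y ^ i \<in> P" for i unfolding P(1) by simp
  show ?thesis
  \<comment> \<open>On \<open>N\<close> the character takes the values 1 and -1 only; whether -1
    occurs decides between \<open>\<mu>_l\<close> and its product with the signs.\<close>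
  proof (cases "\<forall>n\<in>N. \<chi> n = 1")
    case True
    have "\<chi> ` carrier G = P"
    proof
      show "\<chi> ` carrier G \<subseteq> P" using decomp True yP by fastforce
      show "P \<subseteq> \<chi> ` carrier G"
        unfolding P(1) using g by (auto simp: \<chi>_pow \<chi>_g intro!: image_eqI[of _ _ "g [^] (_::nat)"])
    qed
    then have "\<chi> \<in> iso G (cyclic_units \<zeta>)"
      using \<chi>_inj by (auto simp: iso_def hom_def bij_betw_def car cyclic_units_simps \<chi>_mult)
    then show ?thesis using rep[of \<chi>] by blast
  next
    case False
    then obtain n0 where n0: "n0 \<in> N" "\<chi> n0 = -1" using \<chi>N by blast
    \<comment> \<open>Splits \<open>\<chi> x = t * y ^ i\<close> with \<open>t = 1\<close> or
      \<open>t = -1\<close>: since \<open>l\<close> is odd and \<open>y ^ l = 1\<close>, the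
      exponent \<open>l + 1\<close> kills the sign and keeps \<open>y ^ i\<close>, while
      \<open>l\<close> kills \<open>y ^ i\<close> and keeps the sign.\<close>
    define \<psi> where "\<psi> x = (\<chi> x ^ (l + 1), \<chi> x ^ l)" for x
    have sgn: "carrier (cyclic_units (-1 :: 'k alg_closure)) = {1, -1}"
    proof -
      have "carrier (cyclic_units (-1 :: 'k alg_closure)) = range (\<lambda>i. (-1) ^ i)"
        by (rule carrier_cyclic_units[of _ 2]) simp_all
      also have "\<dots> = {1, -1}"
      proof
        show "range (\<lambda>i. (-1 :: 'k alg_closure) ^ i) \<subseteq> {1, -1}"
          by (auto simp: minus_one_power_iff)
        show "{1, -1} \<subseteq> range (\<lambda>i. (-1 :: 'k alg_closure) ^ i)"
          by (auto intro: range_eqI[of _ _ 0] range_eqI[of _ _ 1])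
      qed
      finally show ?thesis .
    qed
    have \<psi>_x: "\<psi> x = (y ^ i, \<chi> n)" if "n \<in> N" "\<chi> x = \<chi> n * y ^ i" for x n i
    proof -
      have "(y ^ i) ^ l = 1" using yl by (metis power_mult mult.commute power_one)
      then show ?thesis using \<chi>N[OF that(1)] l_odd by (auto simp: \<psi>_def that(2) power_mult_distrib power_minus_odd)
    qed
    have prod: "fst (\<psi> x) * snd (\<psi> x) = \<chi> x" if x: "x \<in> carrier G" for x
    proof -
      obtain n i where "n \<in> N" "\<chi> x = \<chi> n * y ^ i" using decomp[OF x] by blast
      then show ?thesis using \<psi>_x[of n x i] by (simp add: mult.commute)
    qed
    have "\<psi> ` carrier G = P \<times> {1, -1}"
    proof
      show "\<psi> ` carrier G \<subseteq> P \<times> {1, -1}"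
      proof
        fix p assume "p \<in> \<psi> ` carrier G"
        then obtain x where x: "x \<in> carrier G" "p = \<psi> x" by blast
        obtain n i where n: "n \<in> N" "\<chi> x = \<chi> n * y ^ i" using decomp[OF x(1)] by blast
        show "p \<in> P \<times> {1, -1}" using \<psi>_x[OF n] \<chi>N[OF n(1)] yP x(2) by auto
      qed
      show "P \<times> {1, -1} \<subseteq> \<psi> ` carrier G"
      proof
        fix p assume "p \<in> P \<times> {1, -1 :: 'k alg_closure}"
        then obtain i t where p: "p = (y ^ i, t)" "t = 1 \<or> t = -1" unfolding P(1) by auto
        obtain n where n: "n \<in> N" "\<chi> n = t"
          using p(2) n0 \<chi>_one subgroup.one_closed[OF N_subgroup] by blast
        have "\<chi> (n \<otimes> g [^] i) = \<chi> n * y ^ i" using N_sub[OF n(1)] g by (simp add: \<chi>_mult \<chi>_pow \<chi>_g)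
        from \<psi>_x[OF n(1) this] p n have "p = \<psi> (n \<otimes> g [^] i)" by simp
        moreover have "n \<otimes> g [^] i \<in> carrier G" using N_sub[OF n(1)] g by simp
        ultimately show "p \<in> \<psi> ` carrier G" by blast
      qed
    qed
    moreover have "inj_on \<psi> (carrier G)"
      using \<chi>_inj prod unfolding inj_on_def by metis
    moreover have "\<psi> (x \<otimes> x') = (fst (\<psi> x) * fst (\<psi> x'), snd (\<psi> x) * snd (\<psi> x'))"
      if "x \<in> carrier G" "x' \<in> carrier G" for x x'
      using that by (simp add: \<psi>_def \<chi>_mult power_mult_distrib)
    ultimately have "\<psi> \<in> iso G (cyclic_units \<zeta> \<times>\<times> cyclic_units (- 1))"
      by (auto simp: iso_def hom_def bij_betw_def car sgn cyclic_units_simps mult_DirProd')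
    then show ?thesis using rep[of "\<lambda>x. fst (\<psi> x) * snd (\<psi> x)"] prod by blast
  qed
qed

end

theorem (in reducible_self_dual_rep) cyclotomic_case:
  assumes \<zeta>: "primitive_root_of_unity l \<zeta>"
  shows "int l = 2 * int d * v (of_nat l) + 1 \<and>
    ((\<exists>\<psi> \<in> iso G (cyclic_units \<zeta>). iso_mult_rep G s \<rho> (adjoin \<zeta>) \<psi>) \<or>
    (\<exists>\<psi> \<in> iso G (cyclic_units \<zeta> \<times>\<times> cyclic_units (- 1)).
       iso_mult_rep G s \<rho> (adjoin \<zeta>) (\<lambda>x. fst (\<psi> x) * snd (\<psi> x))))"
proof -
  obtain \<phi> y where \<phi>: "functional_on UNIV \<phi>" "inj \<phi>" "\<And>w. \<phi> (\<rho> g w) = y * \<phi> w"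
    "primitive_root_of_unity l (y ^ (l ^ (J - 1)))"
    using injective_eigenfunctional by blast
  obtain u where u: "u \<in> W0" "u \<noteq> 0" using W0(1,3) subspace_0 by blast
  have "\<phi> u \<noteq> 0" using injD[OF \<phi>(2), of u 0] u(2) functional_on_0[OF subspace_UNIV \<phi>(1)] by auto
  \<comment> \<open>Rescaling puts 1 into the image, which then becomes the field
    \<open>K(\<zeta>)\<close> itself and not merely a multiple of it.\<close>
  define \<phi>' where "\<phi>' w = inverse (\<phi> u) * \<phi> w" for w
  interpret eigenfunctional_rep s Basis v l G N \<rho> d g k W0 b \<phi>' y
  proof unfold_locales
    fix a w c
    show "\<phi>' (a + w) = \<phi>' a + \<phi>' w" using \<phi>(1) by (simp add: \<phi>'_def functional_on_def distrib_left)
    show "\<phi>' (s c w) = to_ac c * \<phi>' w" using \<phi>(1) by (simp add: \<phi>'_def functional_on_def)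
    show "a = w" if "\<phi>' a = \<phi>' w" using that \<open>\<phi> u \<noteq> 0\<close> injD[OF \<phi>(2)] by (simp add: \<phi>'_def)
    show "\<phi>' (\<rho> g w) = y * \<phi>' w" by (simp add: \<phi>'_def \<phi>(3))
    show "1 \<in> range \<phi>'" using \<open>\<phi> u \<noteq> 0\<close> by (intro range_eqI[of _ _ u]) (simp add: \<phi>'_def)
  qed (rule \<phi>(4))
  show ?thesis using mult_rep[OF \<zeta>] degree_eq by simp
qed

section \<open>The main theorem\<close>

text \<open>The integers \<open>n\<close> vanishing in the residue field are those with positive
  valuation. Division with remainder shows that they are multiples of the least positive one, so
  their gcd \<open>l\<close> is itself among them, and integers prime to \<open>l\<close> are
  not.\<close>

lemma residual_valuation_of_ring_char:
  fixes v :: "'k::field_char_0 \<Rightarrow> int"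
  assumes v: "normalized_discrete_valuation v" and l: "Factorial_Ring.prime l"
    and char: "ring_char (residue_field v) = l"
  shows "residual_valuation v l"
proof -
  interpret field_valuation v
    using v by unfold_locales (auto simp: normalized_discrete_valuation_def)
  have val_diff: "val_ge v (x - y) M" if "val_ge v x M" "val_ge v y M" for x y M
    using val_ge_add[OF that(1) val_ge_minus[OF that(2)]] by simp
  define I where "I = {x :: 'k. val_ge v x 1}"
  have I0: "0 \<in> I" by (simp add: I_def)
  let ?R = "residue_field v"
  have zero: "\<zero>\<^bsub>?R\<^esub> = I" and one: "\<one>\<^bsub>?R\<^esub> = {x + 1 | x. x \<in> I}"
    and add: "A \<oplus>\<^bsub>?R\<^esub> A' = {x + y | x y. x \<in> A \<and> y \<in> A'}" for A A'
    by (auto simp: residue_field_def valuation_ring_def FactRing_def a_r_coset_def r_coset_def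
        set_add_def set_mult_def ring_of_type_algebra_def I_def)
  have pow: "add_pow ?R n \<one>\<^bsub>?R\<^esub> = {x + of_nat n | x. x \<in> I}" for n :: nat
  proof (induction n)
    case 0
    show ?case by (simp add: add_pow_def zero)
  next
    case (Suc n)
    have "add_pow ?R (Suc n) \<one>\<^bsub>?R\<^esub> = add_pow ?R n \<one>\<^bsub>?R\<^esub> \<oplus>\<^bsub>?R\<^esub> \<one>\<^bsub>?R\<^esub>"
      by (simp add: add_pow_def)
    also have "\<dots> = {x + y | x y. x \<in> {x + of_nat n | x. x \<in> I} \<and> y \<in> {x + 1 | x. x \<in> I}}"
      by (simp only: Suc add) (simp only: one)
    also have "\<dots> = {x + of_nat (Suc n) | x. x \<in> I}" (is "?A = ?B")
    proof
      show "?A \<subseteq> ?B"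
      proof
        fix z assume "z \<in> ?A"
        then obtain x y where "z = (x + of_nat n) + (y + 1)" "x \<in> I" "y \<in> I" by blast
        then have "z = (x + y) + of_nat (Suc n)" "x + y \<in> I" by (auto simp: I_def intro: val_ge_add)
        then show "z \<in> ?B" by blast
      qed
      show "?B \<subseteq> ?A"
      proof
        fix z assume "z \<in> ?B"
        then obtain x where "z = (x + of_nat n) + (0 + 1)" "x \<in> I" by (auto simp: algebra_simps)
        then show "z \<in> ?A" using I0 by blast
      qed
    qed
    finally show ?case .
  qed
  define D where "D = {n :: nat. val_ge v (of_nat n) 1}"
  have coset: "{x + of_nat n | x. x \<in> I} = I \<longleftrightarrow> val_ge v (of_nat n) 1" for n :: nat
  proof
    assume "{x + of_nat n | x. x \<in> I} = I"
    then have "0 + of_nat n \<in> I" using I0 by blast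
    then show "val_ge v (of_nat n) 1" by (simp add: I_def)
  next
    assume n: "val_ge v (of_nat n) 1"
    have "x + of_nat n \<in> I" if "x \<in> I" for x using that n by (auto simp: I_def intro: val_ge_add)
    moreover have "\<exists>x'. x = x' + of_nat n \<and> x' \<in> I" if "x \<in> I" for x
      using that n val_diff by (intro exI[of _ "x - of_nat n"]) (auto simp: I_def)
    ultimately show "{x + of_nat n | x. x \<in> I} = I" by blast
  qed
  have D_eq: "{n :: nat. add_pow ?R n \<one>\<^bsub>?R\<^esub> = \<zero>\<^bsub>?R\<^esub>} = D"
    unfolding pow zero coset D_def ..
  have D_l: "Gcd D = l" using char by (simp add: ring_char_def D_eq)
  \<comment> \<open>The gcd of \<open>{0}\<close> is 0, the value that encodes characteristic zero,
    and 0 is not prime.\<close>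
  have "D \<noteq> {0}" using D_l l by auto
  moreover have "0 \<in> D" by (simp add: D_def)
  ultimately obtain n1 where n1: "n1 \<in> D" "n1 > 0" by blast
  define n0 where "n0 = (LEAST n. n \<in> D \<and> n > 0)"
  have n0: "n0 \<in> D" "n0 > 0" using LeastI[of "\<lambda>n. n \<in> D \<and> n > 0" n1] n1 by (auto simp: n0_def)
  have "n0 dvd n" if n: "n \<in> D" for n
  proof -
    have "val_ge v (of_nat (n div n0) * of_nat n0) (0 + 1)"
      using n0 by (intro val_ge_mult val_ge_of_nat) (simp add: D_def)
    then have "val_ge v (of_nat n - of_nat (n div n0) * of_nat n0) 1"
      using n by (intro val_diff) (simp_all add: D_def)
    also have "(of_nat n - of_nat (n div n0) * of_nat n0 :: 'k) = of_nat (n mod n0)"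
      by (metis add_diff_cancel_left' div_mult_mod_eq of_nat_add of_nat_mult)
    finally have "n mod n0 \<in> D" by (simp add: D_def)
    then have "\<not> n mod n0 > 0"
      using not_less_Least[of "n mod n0" "\<lambda>n. n \<in> D \<and> n > 0"] n0(2) by (auto simp: n0_def)
    then show ?thesis by (simp add: dvd_eq_mod_eq_0)
  qed
  then have "Gcd D = n0" using n0(1) by (intro dvd_antisym Gcd_dvd Gcd_greatest) auto
  then have lD: "l \<in> D" and l_dvd: "\<And>n. n \<in> D \<Longrightarrow> l dvd n" using n0 D_l by (auto intro: Gcd_dvd)
  have l0: "(of_nat l :: 'k) \<noteq> 0" using l by auto
  show ?thesis
  proof unfold_locales
    show "1 \<le> v (of_nat l)" using lD l0 by (simp add: D_def val_ge_def)
    fix n assume n: "coprime n l"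
    then have "\<not> l dvd n" using l by (metis coprime_absorb_right coprime_commute not_prime_unit)
    then have "n \<notin> D" using l_dvd by blast
    then have "(of_nat n :: 'k) \<noteq> 0" "v (of_nat n) < 1" by (auto simp: D_def val_ge_def)
    then show "v (of_nat n) = 0" using val_ge_of_nat[of n] by (simp add: val_ge_def)
  qed (rule l)
qed

text \<open>A lift \<open>g1\<close> of a generator of the quotient is raised to a multiple of
  \<open>card N\<close> that is congruent to 1 modulo \<open>q = l ^ k\<close>. The factor
  \<open>card N\<close> makes the order divide \<open>q\<close>, as the group has order
  \<open>q * card N\<close>, and the congruence preserves the image in the quotient.\<close>

lemma cyclic_quotient_complement:
  fixes G (structure)
  assumes "group G" "finite (carrier G)" "N \<lhd> G" "coprime (card N) l"
    and cyc: "cyclic_group (G Mod N)" and ord: "Coset.order (G Mod N) = l ^ k"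
  obtains g where "g \<in> carrier G" "g [^] (l ^ k) = \<one>"
    "\<And>x. x \<in> carrier G \<Longrightarrow> \<exists>n\<in>N. \<exists>i::nat. x = n \<otimes> g [^] i"
proof -
  interpret N: normal N G by fact
  let ?Q = "G Mod N"
  interpret Q: group ?Q by (rule N.factorgroup_is_group)
  define q where "q = l ^ k"
  have finQ: "finite (carrier ?Q)" using assms(2) by (simp add: carrier_FactGroup)
  obtain z where z: "z \<in> carrier ?Q" "subgroup_generated ?Q {z} = ?Q" using cyc by (auto simp: cyclic_group_def)
  have "carrier ?Q = carrier (subgroup_generated ?Q {z})" using z(2) by simp
  also have "\<dots> = generate ?Q {z}" using z(1) by (simp add: carrier_subgroup_generated)
  also have "\<dots> = {z [^]\<^bsub>?Q\<^esub> i | i. i \<in> (UNIV :: nat set)}" by (rule Q.generate_pow_on_finite_carrier[OF finQ z(1)])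
  finally have carQ: "carrier ?Q = {z [^]\<^bsub>?Q\<^esub> i | i. i \<in> (UNIV :: nat set)}" .
  obtain g1 where g1: "g1 \<in> carrier G" "z = N #> g1" using z(1) by (auto simp: carrier_FactGroup)
  have finN: "finite N" using assms(2) N.subset finite_subset by blast
  have M0: "card N > 0" using finN ex_in_conv subgroup.one_closed[OF N.subgroup_axioms] unfolding card_gt_0_iff by metis
  have "coprime (card N) q" using assms(4) by (simp add: q_def)
  then obtain a c where ac: "card N * a = q * c + 1"
    using bezout_nat[of "card N" q] M0 by auto
  define g where "g = g1 [^] (card N * a)"
  have g: "g \<in> carrier G" using g1 by (simp add: g_def)
  have "Coset.order G = q * card N"
    using N.lagrange[OF N.subgroup_axioms] ord by (simp add: Coset.order_def FactGroup_def q_def)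
  then have "g [^] q = (g1 [^] Coset.order G) [^] a" using g1 by (simp add: g_def N.nat_pow_pow ac_simps)
  then have gq: "g [^] q = \<one>" using g1 N.pow_order_eq_1 by simp
  have zq: "z [^]\<^bsub>?Q\<^esub> q = \<one>\<^bsub>?Q\<^esub>" using Q.pow_order_eq_1[OF z(1)] ord by (simp add: q_def)
  have "\<exists>n\<in>N. \<exists>i::nat. x = n \<otimes> g [^] i" if x: "x \<in> carrier G" for x
  proof -
    have "N #> x \<in> carrier ?Q" using x by (simp add: carrier_FactGroup)
    then obtain i :: nat where i: "N #> x = z [^]\<^bsub>?Q\<^esub> i" unfolding carQ by blast
    have "N #> g [^] i = z [^]\<^bsub>?Q\<^esub> (card N * a * i)"
      using g1 by (simp add: g_def N.nat_pow_pow N.FactGroup_pow)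
    also have "card N * a * i = q * (c * i) + i" unfolding ac by (simp add: algebra_simps)
    also have "z [^]\<^bsub>?Q\<^esub> (q * (c * i) + i) = (z [^]\<^bsub>?Q\<^esub> q) [^]\<^bsub>?Q\<^esub> (c * i) \<otimes>\<^bsub>?Q\<^esub> z [^]\<^bsub>?Q\<^esub> i"
      using z(1) by (simp only: Q.nat_pow_mult Q.nat_pow_pow)
    also have "\<dots> = z [^]\<^bsub>?Q\<^esub> i"
      unfolding zq Q.nat_pow_one by (rule Q.l_one[OF Q.nat_pow_closed[OF z(1)]])
    finally have "N #> g [^] i = N #> x" using i by simp
    then have "x \<in> N #> g [^] i" using N.rcos_self[OF x N.subgroup_axioms] by simp
    then show ?thesis by (auto simp: r_coset_def)
  qed
  with that g gq show thesis by (simp add: q_def)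
qed

theorem theorem4p1:
  fixes l d :: nat and e :: int
    and G :: "('g, 'm) monoid_scheme" and N :: "'g set"
    and v :: "'k::field_char_0 \<Rightarrow> int"
    and s :: "'k \<Rightarrow> 'v::ab_group_add \<Rightarrow> 'v" and Basis :: "'v set"
    and \<rho> :: "'g \<Rightarrow> 'v \<Rightarrow> 'v"
    and \<zeta> :: "'k alg_closure"
  assumes "Factorial_Ring.prime l"
    and "group G" and "finite (carrier G)"
    and "N \<lhd> G" and "coprime (card N) l"
    and "cyclic_group (G Mod N)" and "\<exists>k. Coset.order (G Mod N) = l ^ k"
    and "complete_discrete_valuation v" and "ring_char (residue_field v) = l"
    and "e = v (of_nat l)"
    and "finite_dimensional_vector_space s Basis" and "vector_space.dim s UNIV = 2 * d"
    and "int l > int d * e + 1"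
    and "faithful_rep G s \<rho>" and "simple_rep G s \<rho>" and "self_dual_rep G s \<rho>"
    and "quasisplit (group_algebra (G\<lparr>carrier := N\<rparr>) :: ('k, 'g \<Rightarrow> 'k) module)"
    and "primitive_root_of_unity l \<zeta>"
  shows "simple_rep (G\<lparr>carrier := N\<rparr>) s \<rho> \<or>
    (int l = 2 * int d * e + 1 \<and>
     ((\<exists>\<psi> \<in> iso G (cyclic_units \<zeta>). iso_mult_rep G s \<rho> (adjoin \<zeta>) \<psi>) \<or>
      (\<exists>\<psi> \<in> iso G (cyclic_units \<zeta> \<times>\<times> cyclic_units (- 1)).
         iso_mult_rep G s \<rho> (adjoin \<zeta>) (\<lambda>g. fst (\<psi> g) * snd (\<psi> g)))))"
proof (cases "simple_rep (G\<lparr>carrier := N\<rparr>) s \<rho>")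
  case False
  interpret V: finite_dimensional_vector_space s Basis by fact
  interpret N: normal N G by fact
  obtain k where k: "Coset.order (G Mod N) = l ^ k" using assms(7) by blast
  obtain g where g: "g \<in> carrier G" "g [^]\<^bsub>G\<^esub> (l ^ k) = \<one>\<^bsub>G\<^esub>"
    "\<And>x. x \<in> carrier G \<Longrightarrow> \<exists>n\<in>N. \<exists>i::nat. x = n \<otimes>\<^bsub>G\<^esub> g [^]\<^bsub>G\<^esub> i"
    using cyclic_quotient_complement[OF assms(2-6) k] by blast
  interpret residual_valuation v l
    by (rule residual_valuation_of_ring_char)
      (use assms(1,8,9) in \<open>simp_all add: complete_discrete_valuation_def\<close>)
  have lin: "linear_rep G s \<rho>" using assms(15) by (simp add: simple_rep_def)
  interpret act: group_action G UNIV \<rho> using lin by (simp add: linear_rep_def)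
  interpret hom: group_hom G "BijGroup UNIV" \<rho> by (rule act.group_hom)
  have \<rho>_lin: "Vector_Spaces.linear s s (\<rho> x)" if "x \<in> carrier G" for x using lin that by (simp add: linear_rep_def)
  have \<rho>_add: "\<rho> x (u + w) = \<rho> x u + \<rho> x w" if "x \<in> carrier G" for x u w
    using \<rho>_lin[OF that] by (simp add: Vector_Spaces.linear_iff)
  have \<rho>_scale: "\<rho> x (s c w) = s c (\<rho> x w)" if "x \<in> carrier G" for x c w
    using \<rho>_lin[OF that] by (simp add: Vector_Spaces.linear_iff)
  have \<rho>_Bij: "\<rho> x \<in> Bij UNIV" if "x \<in> carrier G" for x
    using hom.hom_closed[OF that] by (simp add: BijGroup_def)
  have \<rho>_mult: "\<rho> (x \<otimes>\<^bsub>G\<^esub> x') w = \<rho> x (\<rho> x' w)" if "x \<in> carrier G" "x' \<in> carrier G" for x x' w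
    using hom.hom_mult[OF that] \<rho>_Bij[OF that(1)] \<rho>_Bij[OF that(2)] by (simp add: BijGroup_def compose_def)
  have \<rho>_one: "\<rho> \<one>\<^bsub>G\<^esub> w = w" for w
    using hom.hom_one by (simp add: BijGroup_def)
  have N_sub: "subgroup N G" by (rule normal_imp_subgroup[OF assms(4)])
  have "linear_rep (G\<lparr>carrier := N\<rparr>) s \<rho>"
    unfolding linear_rep_def
  proof (intro conjI ballI)
    show "group_action (G\<lparr>carrier := N\<rparr>) UNIV \<rho>"
    proof (intro group_action.intro group_hom.intro group_hom_axioms.intro)
      show "group (G\<lparr>carrier := N\<rparr>)" by (rule subgroup.subgroup_is_group[OF N_sub assms(2)])
      show "\<rho> \<in> hom (G\<lparr>carrier := N\<rparr>) (BijGroup UNIV)"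
        unfolding hom_def using hom.hom_mult hom.hom_closed subsetD[OF subgroup.subset[OF N_sub]] by auto
    qed (rule group_BijGroup)
    show "Vector_Spaces.linear s s (\<rho> x)" if "x \<in> carrier (G\<lparr>carrier := N\<rparr>)" for x
      using \<rho>_lin subgroup.subset[OF N_sub] that by auto
  qed (use lin in \<open>simp add: linear_rep_def\<close>)
  then have "\<not> (\<forall>W. V.subspace W \<longrightarrow> (\<forall>n\<in>N. \<rho> n ` W \<subseteq> W) \<longrightarrow> W = {0} \<or> W = UNIV)"
    using False assms(15) by (simp add: simple_rep_def)
  then obtain W0 where "V.subspace W0" "\<forall>n\<in>N. \<rho> n ` W0 \<subseteq> W0" "W0 \<noteq> {0}" "W0 \<noteq> UNIV" by blast
  then have W0: "V.subspace W0" "\<And>n w. n \<in> N \<Longrightarrow> w \<in> W0 \<Longrightarrow> \<rho> n w \<in> W0" "W0 \<noteq> {0}" "W0 \<noteq> UNIV"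
    by auto
  obtain b where b: "bilinear_form s b" "nondegenerate_form b"
    "\<And>x u w. x \<in> carrier G \<Longrightarrow> b (\<rho> x u) (\<rho> x w) = b u w"
    using assms(16) by (auto simp: self_dual_rep_def)
  have e: "e = v (of_nat l)" by fact
  interpret reducible_self_dual_rep s Basis v l G N \<rho> d g k W0 b
  proof unfold_locales
    show "V.subspace W \<Longrightarrow> (\<And>x w. x \<in> carrier G \<Longrightarrow> w \<in> W \<Longrightarrow> \<rho> x w \<in> W) \<Longrightarrow> W = {0} \<or> W = UNIV" for W
      using assms(15) unfolding simple_rep_def by blast
    show "x = \<one>\<^bsub>G\<^esub>" if "x \<in> carrier G" "\<And>w. \<rho> x w = w" for x
    proof -
      have inj: "inj_on \<rho> (carrier G)"
        using assms(14) by (simp add: faithful_rep_def faithful_action_def faithful_action_axioms_def)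
      have "\<rho> x = \<rho> \<one>\<^bsub>G\<^esub>" using that(2) \<rho>_one by (metis ext)
      from inj_onD[OF inj this that(1) N.one_closed] show ?thesis .
    qed
    show "d > 0"
    proof (rule ccontr)
      assume "\<not> d > 0"
      then have "V.dim UNIV = 0" using assms(12) by simp
      then have "(UNIV :: 'v set) \<subseteq> {0}" by (simp only: V.dim_eq_0)
      then show False using assms(15) by (auto simp: simple_rep_def)
    qed
    show "int d * v (of_nat l) < int l - 1" using assms(13) e by simp
    show "b (u + w) u' = b u u' + b w u'" "b u' (u + w) = b u' u + b u' w"
      "b (s c u) u' = c * b u u'" "b u' (s c u) = c * b u' u" for u w u' c
      using b(1) by (simp_all add: bilinear_form_def Vector_Spaces.linear_iff)
    show "u = 0" if "\<And>w. b u w = 0" for u using b(2) that by (simp add: nondegenerate_form_def)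
  qed (fact assms \<rho>_add \<rho>_scale \<rho>_mult \<rho>_one g W0 b)+
  show ?thesis using cyclotomic_case[OF assms(18)] e by simp
qed simp

end
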